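(* Let $T\colon\mathcal{X}\to\mathcal{R}$ be a reflector from a semiabelian variety $\mathcal{X}$ to a full and replete subcategory $\mathcal{R}$ of its abelian core $\mathsf{Ab}(\mathcal{X})$, and let $n\geq 1$. If an object $X$ of $\mathcal{X}$ is $(n-1)$-acyclic with respect to $T$, i.e. $\mathrm{L}_0T(X)=\mathrm{L}_1T(X)=\cdots=\mathrm{L}_{n-1}T(X)=0$, then the functors $$\mathrm{Hom}_{\mathcal{R}}(\mathrm{L}_nT(X),-),\quad \mathrm{Ext}^n(X,-)|_{\mathcal{R}}\colon\ \mathcal{R}\to\mathsf{Ab}$$ are naturally equivalent.
   Context: A semiabelian category is a pointed, Barr exact, Bourn protomodular category with binary coproducts; a semiabelian variety is a variety of universal algebras which is a semiabelian category (it has enough projectives with respect to regular epimorphisms). The abelian core $\mathsf{Ab}(\mathcal{X})$ is the full subcategory of objects admitting an (automatically unique) internal abelian group structure; it is an abelian category, reflective in $\mathcal{X}$. A reflector $T\colon\mathcal X\to\mathcal R$ is a left adjoint to the inclusion $\mathcal R\to\mathcal X$. $\mathsf{Ab}$ (without argument) is the category of abelian groups. A simplicial projective resolution $P(X)\to X$ is an augmented simplicial object with every $P_k$ projective, $P_0\to X$ a regular epimorphism, and the canonical map from $P_{k+1}$ to the simplicial kernel of the faces of $P_k$ a regular epimorphism for each $k\geq0$. The left derived functors of $T$ are defined by $\mathrm{L}_kT(X):=\mathrm{H}_kT(P(X))$ (Moore homology, regarded as an object of $\mathcal R$). For $A$ in $\mathsf{Ab}(\mathcal{X})$, $\mathrm{Ext}^k(X,A):=\mathrm{H}^k\mathrm{Hom}_{\mathcal{X}}(P(X),A)$.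 *)

theory Defs
  imports "HOL-Algebra.Coset" "HOL-Algebra.FiniteProduct"
begin

unbundle cardinal_syntax

section \<open>Categories\<close>

record ('o, 'a) cat =
  obj :: "'o set"
  arr :: "'a set"
  src :: "'a \<Rightarrow> 'o"
  tgt :: "'a \<Rightarrow> 'o"
  idn :: "'o \<Rightarrow> 'a"
  cmp :: "'a \<Rightarrow> 'a \<Rightarrow> 'a"  (infixl "\<cdot>\<index>" 70)

definition homs :: "('o, 'a) cat \<Rightarrow> 'o \<Rightarrow> 'o \<Rightarrow> 'a set" where
  "homs C A B = {f \<in> arr C. src C f = A \<and> tgt C f = B}"

definition category :: "('o, 'a) cat \<Rightarrow> bool" where
  "category C \<longleftrightarrow>
     (\<forall>f \<in> arr C. src C f \<in> obj C \<and> tgt C f \<in> obj C) \<and>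
     (\<forall>A \<in> obj C. idn C A \<in> homs C A A) \<and>
     (\<forall>f \<in> arr C. \<forall>g \<in> arr C. tgt C f = src C g \<longrightarrow>
        g \<cdot>\<^bsub>C\<^esub> f \<in> homs C (src C f) (tgt C g)) \<and>
     (\<forall>f \<in> arr C. f \<cdot>\<^bsub>C\<^esub> idn C (src C f) = f \<and> idn C (tgt C f) \<cdot>\<^bsub>C\<^esub> f = f) \<and>
     (\<forall>f \<in> arr C. \<forall>g \<in> arr C. \<forall>h \<in> arr C. tgt C f = src C g \<longrightarrow> tgt C g = src C h \<longrightarrow>
        (h \<cdot>\<^bsub>C\<^esub> g) \<cdot>\<^bsub>C\<^esub> f = h \<cdot>\<^bsub>C\<^esub> (g \<cdot>\<^bsub>C\<^esub> f))"

definition full_subcat :: "('o, 'a) cat \<Rightarrow> 'o set \<Rightarrow> ('o, 'a) cat" where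
  "full_subcat C R = C\<lparr>obj := R, arr := {f \<in> arr C. src C f \<in> R \<and> tgt C f \<in> R}\<rparr>"

definition is_iso :: "('o, 'a) cat \<Rightarrow> 'a \<Rightarrow> bool" where
  "is_iso C f \<longleftrightarrow> f \<in> arr C \<and>
     (\<exists>g \<in> homs C (tgt C f) (src C f).
        g \<cdot>\<^bsub>C\<^esub> f = idn C (src C f) \<and> f \<cdot>\<^bsub>C\<^esub> g = idn C (tgt C f))"

definition replete :: "('o, 'a) cat \<Rightarrow> 'o set \<Rightarrow> bool" where
  "replete C R \<longleftrightarrow> R \<subseteq> obj C \<and> (\<forall>f. is_iso C f \<and> src C f \<in> R \<longrightarrow> tgt C f \<in> R)"

definition is_functor ::
  "('o, 'a) cat \<Rightarrow> ('p, 'b) cat \<Rightarrow> ('o \<Rightarrow> 'p) \<Rightarrow> ('a \<Rightarrow> 'b) \<Rightarrow> bool" where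
  "is_functor C D To Ta \<longleftrightarrow>
     (\<forall>A \<in> obj C. To A \<in> obj D \<and> Ta (idn C A) = idn D (To A)) \<and>
     (\<forall>f \<in> arr C. Ta f \<in> homs D (To (src C f)) (To (tgt C f))) \<and>
     (\<forall>f \<in> arr C. \<forall>g \<in> arr C. tgt C f = src C g \<longrightarrow> Ta (g \<cdot>\<^bsub>C\<^esub> f) = Ta g \<cdot>\<^bsub>D\<^esub> Ta f)"

text \<open>A left adjoint to the inclusion of the full subcategory on \<open>R\<close>, in terms of the
  unit of the adjunction.\<close>

definition reflector ::
  "('o, 'a) cat \<Rightarrow> 'o set \<Rightarrow> ('o \<Rightarrow> 'o) \<Rightarrow> ('a \<Rightarrow> 'a) \<Rightarrow> bool" where
  "reflector C R To Ta \<longleftrightarrow>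
     is_functor C (full_subcat C R) To Ta \<and>
     (\<exists>\<eta>. (\<forall>A \<in> obj C. \<eta> A \<in> homs C A (To A)) \<and>
          (\<forall>f \<in> arr C. Ta f \<cdot>\<^bsub>C\<^esub> \<eta> (src C f) = \<eta> (tgt C f) \<cdot>\<^bsub>C\<^esub> f) \<and>
          (\<forall>A \<in> obj C. \<forall>B \<in> R. \<forall>f \<in> homs C A B. \<exists>!g. g \<in> homs C (To A) B \<and> g \<cdot>\<^bsub>C\<^esub> \<eta> A = f))"

section \<open>Limits and colimits\<close>

definition initial_object :: "('o, 'a) cat \<Rightarrow> 'o \<Rightarrow> bool" where
  "initial_object C Z \<longleftrightarrow> Z \<in> obj C \<and> (\<forall>A \<in> obj C. \<exists>!f. f \<in> homs C Z A)"

definition terminal_object :: "('o, 'a) cat \<Rightarrow> 'o \<Rightarrow> bool" where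
  "terminal_object C Z \<longleftrightarrow> Z \<in> obj C \<and> (\<forall>A \<in> obj C. \<exists>!f. f \<in> homs C A Z)"

definition zero_object :: "('o, 'a) cat \<Rightarrow> 'o \<Rightarrow> bool" where
  "zero_object C Z \<longleftrightarrow> initial_object C Z \<and> terminal_object C Z"

definition zero_arrow :: "('o, 'a) cat \<Rightarrow> 'a \<Rightarrow> bool" where
  "zero_arrow C f \<longleftrightarrow> f \<in> arr C \<and>
     (\<exists>Z g h. zero_object C Z \<and> g \<in> homs C (src C f) Z \<and> h \<in> homs C Z (tgt C f) \<and> f = h \<cdot>\<^bsub>C\<^esub> g)"

definition is_product :: "('o, 'a) cat \<Rightarrow> 'o \<Rightarrow> 'o \<Rightarrow> 'o \<Rightarrow> 'a \<Rightarrow> 'a \<Rightarrow> bool" where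
  "is_product C A B P p q \<longleftrightarrow> P \<in> obj C \<and> p \<in> homs C P A \<and> q \<in> homs C P B \<and>
     (\<forall>X \<in> obj C. \<forall>f \<in> homs C X A. \<forall>g \<in> homs C X B.
        \<exists>!u. u \<in> homs C X P \<and> p \<cdot>\<^bsub>C\<^esub> u = f \<and> q \<cdot>\<^bsub>C\<^esub> u = g)"

definition is_coproduct :: "('o, 'a) cat \<Rightarrow> 'o \<Rightarrow> 'o \<Rightarrow> 'o \<Rightarrow> 'a \<Rightarrow> 'a \<Rightarrow> bool" where
  "is_coproduct C A B S i j \<longleftrightarrow> S \<in> obj C \<and> i \<in> homs C A S \<and> j \<in> homs C B S \<and>
     (\<forall>X \<in> obj C. \<forall>f \<in> homs C A X. \<forall>g \<in> homs C B X.
        \<exists>!u. u \<in> homs C S X \<and> u \<cdot>\<^bsub>C\<^esub> i = f \<and> u \<cdot>\<^bsub>C\<^esub> j = g)"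

definition is_pullback :: "('o, 'a) cat \<Rightarrow> 'a \<Rightarrow> 'a \<Rightarrow> 'o \<Rightarrow> 'a \<Rightarrow> 'a \<Rightarrow> bool" where
  "is_pullback C f g Q p q \<longleftrightarrow>
     f \<in> arr C \<and> g \<in> arr C \<and> tgt C f = tgt C g \<and> Q \<in> obj C \<and>
     p \<in> homs C Q (src C f) \<and> q \<in> homs C Q (src C g) \<and> f \<cdot>\<^bsub>C\<^esub> p = g \<cdot>\<^bsub>C\<^esub> q \<and>
     (\<forall>X \<in> obj C. \<forall>a \<in> homs C X (src C f). \<forall>b \<in> homs C X (src C g). f \<cdot>\<^bsub>C\<^esub> a = g \<cdot>\<^bsub>C\<^esub> b \<longrightarrow>
        (\<exists>!u. u \<in> homs C X Q \<and> p \<cdot>\<^bsub>C\<^esub> u = a \<and> q \<cdot>\<^bsub>C\<^esub> u = b))"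

definition is_coequalizer :: "('o, 'a) cat \<Rightarrow> 'a \<Rightarrow> 'a \<Rightarrow> 'a \<Rightarrow> bool" where
  "is_coequalizer C f g e \<longleftrightarrow>
     f \<in> arr C \<and> g \<in> homs C (src C f) (tgt C f) \<and> e \<in> arr C \<and> src C e = tgt C f \<and>
     e \<cdot>\<^bsub>C\<^esub> f = e \<cdot>\<^bsub>C\<^esub> g \<and>
     (\<forall>h \<in> arr C. src C h = tgt C f \<and> h \<cdot>\<^bsub>C\<^esub> f = h \<cdot>\<^bsub>C\<^esub> g \<longrightarrow>
        (\<exists>!u. u \<in> homs C (tgt C e) (tgt C h) \<and> u \<cdot>\<^bsub>C\<^esub> e = h))"

definition regular_epi :: "('o, 'a) cat \<Rightarrow> 'a \<Rightarrow> bool" where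
  "regular_epi C e \<longleftrightarrow> (\<exists>f g. is_coequalizer C f g e)"

definition projective_object :: "('o, 'a) cat \<Rightarrow> 'o \<Rightarrow> bool" where
  "projective_object C Q \<longleftrightarrow> Q \<in> obj C \<and>
     (\<forall>e f. regular_epi C e \<and> f \<in> homs C Q (tgt C e) \<longrightarrow>
        (\<exists>g \<in> homs C Q (src C e). e \<cdot>\<^bsub>C\<^esub> g = f))"

text \<open>\<open>k : K \<rightarrow> A\<close> is the intersection of the kernels of the arrows \<open>f \<in> F\<close> with
  domain \<open>A\<close>; an isomorphism if \<open>F\<close> is empty.\<close>

definition joint_kernel :: "('o, 'a) cat \<Rightarrow> 'a set \<Rightarrow> 'o \<Rightarrow> 'o \<Rightarrow> 'a \<Rightarrow> bool" where
  "joint_kernel C F A K k \<longleftrightarrow>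
     A \<in> obj C \<and> K \<in> obj C \<and> F \<subseteq> {f \<in> arr C. src C f = A} \<and> k \<in> homs C K A \<and>
     (\<forall>f \<in> F. zero_arrow C (f \<cdot>\<^bsub>C\<^esub> k)) \<and>
     (\<forall>X \<in> obj C. \<forall>a \<in> homs C X A. (\<forall>f \<in> F. zero_arrow C (f \<cdot>\<^bsub>C\<^esub> a)) \<longrightarrow>
        (\<exists>!u. u \<in> homs C X K \<and> k \<cdot>\<^bsub>C\<^esub> u = a))"

definition is_cokernel :: "('o, 'a) cat \<Rightarrow> 'a \<Rightarrow> 'o \<Rightarrow> 'a \<Rightarrow> bool" where
  "is_cokernel C f Q q \<longleftrightarrow>
     f \<in> arr C \<and> Q \<in> obj C \<and> q \<in> homs C (tgt C f) Q \<and> zero_arrow C (q \<cdot>\<^bsub>C\<^esub> f) \<and>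
     (\<forall>X \<in> obj C. \<forall>a \<in> homs C (tgt C f) X. zero_arrow C (a \<cdot>\<^bsub>C\<^esub> f) \<longrightarrow>
        (\<exists>!u. u \<in> homs C Q X \<and> u \<cdot>\<^bsub>C\<^esub> q = a))"

section \<open>Semiabelian categories\<close>

definition pointed :: "('o, 'a) cat \<Rightarrow> bool" where
  "pointed C \<longleftrightarrow> (\<exists>Z. zero_object C Z)"

definition finitely_complete :: "('o, 'a) cat \<Rightarrow> bool" where
  "finitely_complete C \<longleftrightarrow> (\<exists>Z. terminal_object C Z) \<and>
     (\<forall>f \<in> arr C. \<forall>g \<in> arr C. tgt C f = tgt C g \<longrightarrow> (\<exists>Q p q. is_pullback C f g Q p q))"

definition regular_category :: "('o, 'a) cat \<Rightarrow> bool" where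
  "regular_category C \<longleftrightarrow> category C \<and> finitely_complete C \<and>
     (\<forall>f Q p q. is_pullback C f f Q p q \<longrightarrow> (\<exists>e. is_coequalizer C p q e)) \<and>
     (\<forall>e f Q p q. regular_epi C e \<and> is_pullback C e f Q p q \<longrightarrow> regular_epi C q)"

definition internal_equivalence :: "('o, 'a) cat \<Rightarrow> 'o \<Rightarrow> 'o \<Rightarrow> 'a \<Rightarrow> 'a \<Rightarrow> bool" where
  "internal_equivalence C A E r s \<longleftrightarrow>
     A \<in> obj C \<and> E \<in> obj C \<and> r \<in> homs C E A \<and> s \<in> homs C E A \<and>
     (\<forall>X \<in> obj C. \<forall>u \<in> homs C X E. \<forall>v \<in> homs C X E.
        r \<cdot>\<^bsub>C\<^esub> u = r \<cdot>\<^bsub>C\<^esub> v \<and> s \<cdot>\<^bsub>C\<^esub> u = s \<cdot>\<^bsub>C\<^esub> v \<longrightarrow> u = v) \<and>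
     (\<exists>\<delta> \<in> homs C A E. r \<cdot>\<^bsub>C\<^esub> \<delta> = idn C A \<and> s \<cdot>\<^bsub>C\<^esub> \<delta> = idn C A) \<and>
     (\<exists>\<sigma> \<in> homs C E E. r \<cdot>\<^bsub>C\<^esub> \<sigma> = s \<and> s \<cdot>\<^bsub>C\<^esub> \<sigma> = r) \<and>
     (\<forall>Q p q. is_pullback C s r Q p q \<longrightarrow>
        (\<exists>\<tau> \<in> homs C Q E. r \<cdot>\<^bsub>C\<^esub> \<tau> = r \<cdot>\<^bsub>C\<^esub> p \<and> s \<cdot>\<^bsub>C\<^esub> \<tau> = s \<cdot>\<^bsub>C\<^esub> q))"

definition barr_exact :: "('o, 'a) cat \<Rightarrow> bool" where
  "barr_exact C \<longleftrightarrow> regular_category C \<and>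
     (\<forall>A E r s. internal_equivalence C A E r s \<longrightarrow> (\<exists>f. is_pullback C f f E r s))"

definition is_point :: "('o, 'a) cat \<Rightarrow> 'a \<Rightarrow> 'a \<Rightarrow> bool" where
  "is_point C p s \<longleftrightarrow> p \<in> arr C \<and> s \<in> homs C (tgt C p) (src C p) \<and> p \<cdot>\<^bsub>C\<^esub> s = idn C (tgt C p)"

text \<open>Bourn protomodularity: for every \<open>v : Y' \<rightarrow> Y\<close> the pullback functor from points
  over \<open>Y\<close> to points over \<open>Y'\<close> reflects isomorphisms.  Here \<open>h : (p, s) \<rightarrow> (q, t)\<close> is a
  morphism of points over \<open>Y\<close>, and \<open>h'\<close> is its image under pullback along \<open>v\<close>.\<close>

definition protomodular :: "('o, 'a) cat \<Rightarrow> bool" where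
  "protomodular C \<longleftrightarrow>
     (\<forall>p s v. is_point C p s \<and> v \<in> arr C \<and> tgt C v = tgt C p \<longrightarrow>
        (\<exists>Q p' v'. is_pullback C v p Q p' v')) \<and>
     (\<forall>p s q t h v A' p' v' B' q' w' h'.
        is_point C p s \<and> is_point C q t \<and> tgt C p = tgt C q \<and>
        h \<in> homs C (src C p) (src C q) \<and> q \<cdot>\<^bsub>C\<^esub> h = p \<and> h \<cdot>\<^bsub>C\<^esub> s = t \<and>
        is_pullback C v p A' p' v' \<and> is_pullback C v q B' q' w' \<and>
        h' \<in> homs C A' B' \<and> q' \<cdot>\<^bsub>C\<^esub> h' = p' \<and> w' \<cdot>\<^bsub>C\<^esub> h' = h \<cdot>\<^bsub>C\<^esub> v' \<and>
        is_iso C h' \<longrightarrow> is_iso C h)"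

definition semiabelian :: "('o, 'a) cat \<Rightarrow> bool" where
  "semiabelian C \<longleftrightarrow> category C \<and> pointed C \<and> barr_exact C \<and> protomodular C \<and>
     (\<forall>A \<in> obj C. \<forall>B \<in> obj C. \<exists>S i j. is_coproduct C A B S i j)"

section \<open>Varieties of universal algebras\<close>

datatype 'f trm = Var nat | App 'f "'f trm list"

fun wf_trm :: "('f \<Rightarrow> nat) \<Rightarrow> 'f trm \<Rightarrow> bool" where
  "wf_trm ar (Var n) \<longleftrightarrow> True"
| "wf_trm ar (App f ts) \<longleftrightarrow> length ts = ar f \<and> (\<forall>t \<in> set ts. wf_trm ar t)"

record ('f, 'u) algebra =
  car :: "'u set"
  oper :: "'f \<Rightarrow> 'u list \<Rightarrow> 'u"

fun trm_val :: "('f, 'u) algebra \<Rightarrow> (nat \<Rightarrow> 'u) \<Rightarrow> 'f trm \<Rightarrow> 'u" where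
  "trm_val A \<rho> (Var n) = \<rho> n"
| "trm_val A \<rho> (App f ts) = oper A f (map (trm_val A \<rho>) ts)"

definition is_algebra :: "('f \<Rightarrow> nat) \<Rightarrow> ('f trm \<times> 'f trm) set \<Rightarrow> ('f, 'u) algebra \<Rightarrow> bool" where
  "is_algebra ar Eqs A \<longleftrightarrow>
     (\<forall>f xs. length xs = ar f \<and> set xs \<subseteq> car A \<longrightarrow> oper A f xs \<in> car A) \<and>
     (\<forall>(s, t) \<in> Eqs. \<forall>\<rho>. range \<rho> \<subseteq> car A \<longrightarrow> trm_val A \<rho> s = trm_val A \<rho> t)"

datatype ('f, 'u) alg_arrow =
  AlgArrow (dom_alg: "('f, 'u) algebra") (fn: "'u \<Rightarrow> 'u") (cod_alg: "('f, 'u) algebra")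

definition is_alg_hom :: "('f \<Rightarrow> nat) \<Rightarrow> ('f, 'u) alg_arrow \<Rightarrow> bool" where
  "is_alg_hom ar h \<longleftrightarrow>
     fn h \<in> car (dom_alg h) \<rightarrow>\<^sub>E car (cod_alg h) \<and>
     (\<forall>f xs. length xs = ar f \<and> set xs \<subseteq> car (dom_alg h) \<longrightarrow>
        fn h (oper (dom_alg h) f xs) = oper (cod_alg h) f (map (fn h) xs))"

text \<open>The type \<open>'u\<close> plays the role of the universe: the sets of the variety are the subsets of
  \<open>'u\<close> of cardinality strictly below \<open>|UNIV :: 'u set|\<close>.  If the latter is an inaccessible
  cardinal, these are, up to bijection, the small sets of the corresponding Grothendieck
  universe.  The requirement in \<open>semiabelian_variety\<close> that \<open>'u\<close> be
  uncountable and larger than the signature ensures that free algebras and quotients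
  exist; nothing else is asked of \<open>'u\<close>.\<close>

definition variety ::
  "('f \<Rightarrow> nat) \<Rightarrow> ('f trm \<times> 'f trm) set \<Rightarrow> (('f, 'u) algebra, ('f, 'u) alg_arrow) cat" where
  "variety ar Eqs =
     (let Algs = {A. is_algebra ar Eqs A \<and> |car A| <o |UNIV :: 'u set| } in
      \<lparr>obj = Algs,
       arr = {h. dom_alg h \<in> Algs \<and> cod_alg h \<in> Algs \<and> is_alg_hom ar h},
       src = dom_alg,
       tgt = cod_alg,
       idn = (\<lambda>A. AlgArrow A (restrict (\<lambda>x. x) (car A)) A),
       cmp = (\<lambda>h g. AlgArrow (dom_alg g) (compose (car (dom_alg g)) (fn h) (fn g)) (cod_alg h))\<rparr>)"

definition semiabelian_variety :: "(('f, 'u) algebra, ('f, 'u) alg_arrow) cat \<Rightarrow> bool" where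
  "semiabelian_variety C \<longleftrightarrow>
     |UNIV :: nat set| <o |UNIV :: 'u set| \<and> |UNIV :: 'f set| <o |UNIV :: 'u set| \<and>
     (\<exists>ar Eqs. (\<forall>(s, t) \<in> Eqs. wf_trm ar s \<and> wf_trm ar t) \<and> C = variety ar Eqs) \<and>
     semiabelian C"

section \<open>Abelian objects\<close>

record ('o, 'a) ab_structure =
  sq :: 'o      \<comment> \<open>product of the object with itself\<close>
  prj1 :: 'a
  prj2 :: 'a
  addn :: 'a
  one_ob :: 'o  \<comment> \<open>terminal object\<close>
  unt :: 'a
  negn :: 'a

definition pairing :: "('o, 'a) cat \<Rightarrow> 'o \<Rightarrow> 'a \<Rightarrow> 'a \<Rightarrow> 'a \<Rightarrow> 'a \<Rightarrow> 'a" where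
  "pairing C P p q f g = (THE u. u \<in> homs C (src C f) P \<and> p \<cdot>\<^bsub>C\<^esub> u = f \<and> q \<cdot>\<^bsub>C\<^esub> u = g)"

definition gen_add :: "('o, 'a) cat \<Rightarrow> ('o, 'a) ab_structure \<Rightarrow> 'a \<Rightarrow> 'a \<Rightarrow> 'a" where
  "gen_add C G f g = addn G \<cdot>\<^bsub>C\<^esub> pairing C (sq G) (prj1 G) (prj2 G) f g"

definition gen_zero :: "('o, 'a) cat \<Rightarrow> ('o, 'a) ab_structure \<Rightarrow> 'o \<Rightarrow> 'a" where
  "gen_zero C G X = unt G \<cdot>\<^bsub>C\<^esub> (THE t. t \<in> homs C X (one_ob G))"

text \<open>The axioms of an internal abelian group, in terms of generalised elements
  \<open>X \<rightarrow> A\<close>.\<close>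

definition internal_ab_group ::
  "('o, 'a) cat \<Rightarrow> 'o \<Rightarrow> ('o, 'a) ab_structure \<Rightarrow> bool" where
  "internal_ab_group C A G \<longleftrightarrow>
     A \<in> obj C \<and>
     is_product C A A (sq G) (prj1 G) (prj2 G) \<and> terminal_object C (one_ob G) \<and>
     addn G \<in> homs C (sq G) A \<and> unt G \<in> homs C (one_ob G) A \<and> negn G \<in> homs C A A \<and>
     (\<forall>X \<in> obj C. \<forall>f \<in> homs C X A. \<forall>g \<in> homs C X A. \<forall>h \<in> homs C X A.
        gen_add C G (gen_add C G f g) h = gen_add C G f (gen_add C G g h) \<and>
        gen_add C G f g = gen_add C G g f \<and>
        gen_add C G f (gen_zero C G X) = f \<and>
        gen_add C G f (negn G \<cdot>\<^bsub>C\<^esub> f) = gen_zero C G X)"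

definition abelian_core :: "('o, 'a) cat \<Rightarrow> 'o set" where
  "abelian_core C = {A \<in> obj C. \<exists>G. internal_ab_group C A G}"

text \<open>The choice of structure is harmless: in a semiabelian category it is unique up to the
  choice of the product and the terminal object.\<close>

definition ab_str :: "('o, 'a) cat \<Rightarrow> 'o \<Rightarrow> ('o, 'a) ab_structure" where
  "ab_str C A = (SOME G. internal_ab_group C A G)"

definition hom_group :: "('o, 'a) cat \<Rightarrow> 'o \<Rightarrow> 'o \<Rightarrow> 'a monoid" where
  "hom_group C X A =
     \<lparr>carrier = homs C X A, monoid.mult = gen_add C (ab_str C A), one = gen_zero C (ab_str C A) X\<rparr>"

section \<open>Simplicial objects\<close>

text \<open>\<open>face S k i : S\<^sub>k\<^sub>+\<^sub>1 \<rightarrow> S\<^sub>k\<close> for \<open>i \<le> k + 1\<close>, and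
  \<open>degen S k i : S\<^sub>k \<rightarrow> S\<^sub>k\<^sub>+\<^sub>1\<close> for \<open>i \<le> k\<close>.\<close>

record ('o, 'a) simpl =
  sob :: "nat \<Rightarrow> 'o"
  face :: "nat \<Rightarrow> nat \<Rightarrow> 'a"
  degen :: "nat \<Rightarrow> nat \<Rightarrow> 'a"

definition simplicial_object :: "('o, 'a) cat \<Rightarrow> ('o, 'a) simpl \<Rightarrow> bool" where
  "simplicial_object C S \<longleftrightarrow>
     (\<forall>k. sob S k \<in> obj C) \<and>
     (\<forall>k i. i \<le> Suc k \<longrightarrow> face S k i \<in> homs C (sob S (Suc k)) (sob S k)) \<and>
     (\<forall>k i. i \<le> k \<longrightarrow> degen S k i \<in> homs C (sob S k) (sob S (Suc k))) \<and>
     (\<forall>k i j. i \<le> j \<and> j \<le> Suc k \<longrightarrow>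
        face S k i \<cdot>\<^bsub>C\<^esub> face S (Suc k) (Suc j) = face S k j \<cdot>\<^bsub>C\<^esub> face S (Suc k) i) \<and>
     (\<forall>k i j. i \<le> j \<and> j \<le> k \<longrightarrow>
        degen S (Suc k) i \<cdot>\<^bsub>C\<^esub> degen S k j = degen S (Suc k) (Suc j) \<cdot>\<^bsub>C\<^esub> degen S k i) \<and>
     (\<forall>k i j. i \<le> j \<and> j \<le> k \<longrightarrow>
        face S (Suc k) i \<cdot>\<^bsub>C\<^esub> degen S (Suc k) (Suc j) = degen S k j \<cdot>\<^bsub>C\<^esub> face S k i) \<and>
     (\<forall>k j. j \<le> k \<longrightarrow>
        face S k j \<cdot>\<^bsub>C\<^esub> degen S k j = idn C (sob S k) \<and>
        face S k (Suc j) \<cdot>\<^bsub>C\<^esub> degen S k j = idn C (sob S k)) \<and>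
     (\<forall>k i j. j < i \<and> i \<le> Suc k \<longrightarrow>
        face S (Suc k) (Suc i) \<cdot>\<^bsub>C\<^esub> degen S (Suc k) j = degen S k j \<cdot>\<^bsub>C\<^esub> face S k i)"

definition map_simpl :: "('o \<Rightarrow> 'p) \<Rightarrow> ('a \<Rightarrow> 'b) \<Rightarrow> ('o, 'a) simpl \<Rightarrow> ('p, 'b) simpl" where
  "map_simpl To Ta S =
     \<lparr>sob = (\<lambda>k. To (sob S k)), face = (\<lambda>k i. Ta (face S k i)), degen = (\<lambda>k i. Ta (degen S k i))\<rparr>"

text \<open>Simplicial kernel of \<open>f 0, \<dots>, f k : A \<rightarrow> B\<close>: the universal family of
  \<open>k + 2\<close> arrows \<open>\<kappa> 0, \<dots>, \<kappa> (k + 1) : K \<rightarrow> A\<close> satisfying the face identities.\<close>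

definition simplicial_kernel ::
  "('o, 'a) cat \<Rightarrow> nat \<Rightarrow> 'o \<Rightarrow> 'o \<Rightarrow> (nat \<Rightarrow> 'a) \<Rightarrow> 'o \<Rightarrow> (nat \<Rightarrow> 'a) \<Rightarrow> bool" where
  "simplicial_kernel C k A B f K \<kappa> \<longleftrightarrow>
     K \<in> obj C \<and> (\<forall>i \<le> k. f i \<in> homs C A B) \<and> (\<forall>i \<le> Suc k. \<kappa> i \<in> homs C K A) \<and>
     (\<forall>i j. i \<le> j \<and> j \<le> k \<longrightarrow> f i \<cdot>\<^bsub>C\<^esub> \<kappa> (Suc j) = f j \<cdot>\<^bsub>C\<^esub> \<kappa> i) \<and>
     (\<forall>X \<in> obj C. \<forall>a. (\<forall>i \<le> Suc k. a i \<in> homs C X A) \<and>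
        (\<forall>i j. i \<le> j \<and> j \<le> k \<longrightarrow> f i \<cdot>\<^bsub>C\<^esub> a (Suc j) = f j \<cdot>\<^bsub>C\<^esub> a i) \<longrightarrow>
        (\<exists>!u. u \<in> homs C X K \<and> (\<forall>i \<le> Suc k. \<kappa> i \<cdot>\<^bsub>C\<^esub> u = a i)))"

definition projective_resolution ::
  "('o, 'a) cat \<Rightarrow> ('o, 'a) simpl \<Rightarrow> 'a \<Rightarrow> 'o \<Rightarrow> bool" where
  "projective_resolution C P \<epsilon> X \<longleftrightarrow>
     simplicial_object C P \<and>
     \<epsilon> \<in> homs C (sob P 0) X \<and> \<epsilon> \<cdot>\<^bsub>C\<^esub> face P 0 0 = \<epsilon> \<cdot>\<^bsub>C\<^esub> face P 0 1 \<and>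
     (\<forall>k. projective_object C (sob P k)) \<and>
     regular_epi C \<epsilon> \<and>
     (\<forall>k. \<exists>K \<kappa> u.
        simplicial_kernel C k (sob P k) (case k of 0 \<Rightarrow> X | Suc j \<Rightarrow> sob P j)
          (case k of 0 \<Rightarrow> (\<lambda>i. \<epsilon>) | Suc j \<Rightarrow> face P j) K \<kappa> \<and>
        u \<in> homs C (sob P (Suc k)) K \<and> (\<forall>i \<le> Suc k. \<kappa> i \<cdot>\<^bsub>C\<^esub> u = face P k i) \<and>
        regular_epi C u)"

section \<open>Moore homology and derived functors\<close>

text \<open>\<open>N\<^sub>k = \<Inter>\<^sub>i\<^sub><\<^sub>k Ker d\<^sub>i \<subseteq> S\<^sub>k\<close>, with differential
  \<open>bd k : N\<^sub>k\<^sub>+\<^sub>1 \<rightarrow> N\<^sub>k\<close> induced by the last face \<open>d\<^sub>k\<^sub>+\<^sub>1\<close>.\<close>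

definition moore_complex ::
  "('o, 'a) cat \<Rightarrow> ('o, 'a) simpl \<Rightarrow> (nat \<Rightarrow> 'o) \<Rightarrow> (nat \<Rightarrow> 'a) \<Rightarrow> bool" where
  "moore_complex C S N bd \<longleftrightarrow>
     (\<exists>\<nu>. (\<forall>k. joint_kernel C (case k of 0 \<Rightarrow> {} | Suc j \<Rightarrow> face S j ` {..j}) (sob S k) (N k) (\<nu> k)) \<and>
          (\<forall>k. bd k \<in> homs C (N (Suc k)) (N k) \<and>
               \<nu> k \<cdot>\<^bsub>C\<^esub> bd k = face S k (Suc k) \<cdot>\<^bsub>C\<^esub> \<nu> (Suc k)))"

text \<open>\<open>H\<close> is the cokernel of the factorisation of \<open>N\<^sub>k\<^sub>+\<^sub>1 \<rightarrow> N\<^sub>k\<close> through the kernel of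
  \<open>N\<^sub>k \<rightarrow> N\<^sub>k\<^sub>-\<^sub>1\<close> (through \<open>N\<^sub>0\<close> if \<open>k = 0\<close>).\<close>

definition homology_object ::
  "('o, 'a) cat \<Rightarrow> (nat \<Rightarrow> 'o) \<Rightarrow> (nat \<Rightarrow> 'a) \<Rightarrow> nat \<Rightarrow> 'o \<Rightarrow> bool" where
  "homology_object C N bd k H \<longleftrightarrow>
     (\<exists>Z \<zeta> b q. joint_kernel C (case k of 0 \<Rightarrow> {} | Suc j \<Rightarrow> {bd j}) (N k) Z \<zeta> \<and>
        b \<in> homs C (N (Suc k)) Z \<and> \<zeta> \<cdot>\<^bsub>C\<^esub> b = bd k \<and> is_cokernel C b H q)"

definition moore_homology :: "('o, 'a) cat \<Rightarrow> ('o, 'a) simpl \<Rightarrow> nat \<Rightarrow> 'o \<Rightarrow> bool" where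
  "moore_homology C S k H \<longleftrightarrow> (\<exists>N bd. moore_complex C S N bd \<and> homology_object C N bd k H)"

text \<open>\<open>L\<close> is (a representative of the isomorphism class of) \<open>H\<^sub>k T(P)\<close>.  The Moore
  homology is computed in the ambient semiabelian category \<open>C\<close>.  When \<open>T\<close> takes values in
  a reflective subcategory \<open>R\<close> of the abelian core this agrees with the homology in the
  abelian core.  It must not be replaced by kernels and cokernels formed inside \<open>R\<close>, which
  is not assumed closed under quotients.\<close>

definition left_derived ::
  "('o, 'a) cat \<Rightarrow> ('o \<Rightarrow> 'o) \<Rightarrow> ('a \<Rightarrow> 'a) \<Rightarrow> ('o, 'a) simpl \<Rightarrow> nat \<Rightarrow> 'o \<Rightarrow> bool" where
  "left_derived C To Ta P k L \<longleftrightarrow> moore_homology C (map_simpl To Ta P) k L"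

section \<open>Functors to abelian groups\<close>

record ('o, 'a, 'g) ab_functor =
  fob :: "'o \<Rightarrow> 'g monoid"
  farr :: "'a \<Rightarrow> 'g \<Rightarrow> 'g"

definition is_ab_functor :: "('o, 'a) cat \<Rightarrow> ('o, 'a, 'g) ab_functor \<Rightarrow> bool" where
  "is_ab_functor D F \<longleftrightarrow>
     (\<forall>A \<in> obj D. comm_group (fob F A) \<and> (\<forall>x \<in> carrier (fob F A). farr F (idn D A) x = x)) \<and>
     (\<forall>a \<in> arr D. farr F a \<in> hom (fob F (src D a)) (fob F (tgt D a))) \<and>
     (\<forall>a \<in> arr D. \<forall>b \<in> arr D. tgt D a = src D b \<longrightarrow>
        (\<forall>x \<in> carrier (fob F (src D a)). farr F (b \<cdot>\<^bsub>D\<^esub> a) x = farr F b (farr F a x)))"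

definition naturally_equivalent ::
  "('o, 'a) cat \<Rightarrow> ('o, 'a, 'g) ab_functor \<Rightarrow> ('o, 'a, 'h) ab_functor \<Rightarrow> bool" where
  "naturally_equivalent D F G \<longleftrightarrow> is_ab_functor D F \<and> is_ab_functor D G \<and>
     (\<exists>\<phi>. (\<forall>A \<in> obj D. \<phi> A \<in> iso (fob F A) (fob G A)) \<and>
          (\<forall>a \<in> arr D. \<forall>x \<in> carrier (fob F (src D a)).
             \<phi> (tgt D a) (farr F a x) = farr G a (\<phi> (src D a) x)))"

text \<open>Restricted to a full subcategory \<open>R\<close> containing \<open>X\<close> this is
  \<open>Hom\<close> of \<open>R\<close>.\<close>

definition Hom_functor :: "('o, 'a) cat \<Rightarrow> 'o \<Rightarrow> ('o, 'a, 'a) ab_functor" where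
  "Hom_functor C X = \<lparr>fob = hom_group C X, farr = (\<lambda>a f. a \<cdot>\<^bsub>C\<^esub> f)\<rparr>"

text \<open>The alternating sum \<open>\<Sum>\<^sub>i\<^sub>\<le>\<^sub>k\<^sub>+\<^sub>1 (-1)\<^sup>i f \<cdot> d\<^sub>i\<close> in the group of arrows
  \<open>P\<^sub>k\<^sub>+\<^sub>1 \<rightarrow> A\<close>.\<close>

definition coboundary :: "('o, 'a) cat \<Rightarrow> ('o, 'a) simpl \<Rightarrow> 'o \<Rightarrow> nat \<Rightarrow> 'a \<Rightarrow> 'a" where
  "coboundary C P A k f =
     (let G = hom_group C (sob P (Suc k)) A in
      finprod G (\<lambda>i. if even i then f \<cdot>\<^bsub>C\<^esub> face P k i else inv\<^bsub>G\<^esub> (f \<cdot>\<^bsub>C\<^esub> face P k i)) {..Suc k})"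

definition cocycles :: "('o, 'a) cat \<Rightarrow> ('o, 'a) simpl \<Rightarrow> 'o \<Rightarrow> nat \<Rightarrow> 'a set" where
  "cocycles C P A k =
     kernel (hom_group C (sob P k) A) (hom_group C (sob P (Suc k)) A) (coboundary C P A k)"

definition coboundaries :: "('o, 'a) cat \<Rightarrow> ('o, 'a) simpl \<Rightarrow> 'o \<Rightarrow> nat \<Rightarrow> 'a set" where
  "coboundaries C P A k =
     (case k of 0 \<Rightarrow> {\<one>\<^bsub>hom_group C (sob P 0) A\<^esub>}
      | Suc j \<Rightarrow> coboundary C P A j ` homs C (sob P j) A)"

text \<open>The elements of the quotient group are cosets of coboundaries; an arrow \<open>a : A \<rightarrow> B\<close>
  sends the coset of \<open>f\<close> to that of \<open>a \<cdot> f\<close>.\<close>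

definition Ext_functor :: "('o, 'a) cat \<Rightarrow> ('o, 'a) simpl \<Rightarrow> nat \<Rightarrow> ('o, 'a, 'a set) ab_functor" where
  "Ext_functor C P k =
     \<lparr>fob = (\<lambda>A. (hom_group C (sob P k) A)\<lparr>carrier := cocycles C P A k\<rparr> Mod coboundaries C P A k),
      farr = (\<lambda>a c. coboundaries C P (tgt C a) k <#>\<^bsub>hom_group C (sob P k) (tgt C a)\<^esub> ((\<lambda>f. a \<cdot>\<^bsub>C\<^esub> f) ` c))\<rparr>"

end

theory Submission
  imports Defs
begin

text \<open>Since maps \<open>P\<^sub>k \<rightarrow> A\<close> into \<open>A \<in> R\<close> are the same as maps \<open>T P\<^sub>k \<rightarrow> A\<close>, the cohomology
  can be computed on the simplicial object \<open>T P\<close>, which consists of abelian objects that are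
  projective relative to regular epimorphisms between objects of \<open>R\<close>.  A normalisation argument
  replaces \<open>T P\<close> by its Moore complex \<open>N\<close>, whose terms are retracts of those of \<open>T P\<close>.  As the
  homology of \<open>N\<close> vanishes below degree \<open>n\<close>, Barr exactness and relative projectivity split \<open>N\<close> up
  to degree \<open>n\<close>, so the \<open>n\<close>-cycles \<open>Z\<close> are a direct summand of \<open>N\<^sub>n\<close>; modulo coboundaries an
  \<open>n\<close>-cocycle is then the same as a map \<open>Z \<rightarrow> A\<close> vanishing on boundaries, i.e. a map \<open>L\<^sub>n T(X) \<rightarrow> A\<close>.\<close>

section \<open>Arrows in a semiabelian category\<close>

text \<open>Since \<open>R\<close> need not be closed under quotients, images, boundaries and the
  homology object have to be formed in the ambient category; only kernels can be kept inside
  \<open>R\<close>. The obstacle is to turn vanishing homology into lifts of arrows out of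
  \<open>T P\<close>. An arrow out of \<open>P k\<close> is lifted in the ambient category, where
  \<open>P k\<close> is projective, and the lift extends along the unit because its target, a Moore
  object, lies in \<open>R\<close>. All additive arguments take place in the groups of arrows
  \<open>X -> A\<close> with \<open>A\<close> abelian. Addition there is natural in \<open>X\<close>
  by construction, but the group structure on each \<open>A\<close> is an arbitrary choice, so that
  additivity of composition with \<open>A -> B\<close> is a theorem; protomodularity enters only
  through it. Exactness, beyond regularity, enters only where a zero cokernel has to force
  surjectivity.\<close>

locale semiabelian_category =
  fixes C :: "('o, 'a) cat" (structure)
  assumes semiabelian: "semiabelian C"
begin

lemma category: "category C"
  using semiabelian by (simp add: semiabelian_def)

lemma homsD:
  assumes "f \<in> homs C A B"
  shows "f \<in> arr C" "src C f = A" "tgt C f = B" "A \<in> obj C" "B \<in> obj C"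
  using assms category by (auto simp: homs_def category_def)

lemma comp_in [intro]:
  assumes "f \<in> homs C A B" "g \<in> homs C B D"
  shows "g \<cdot> f \<in> homs C A D"
  using assms category unfolding category_def homs_def by auto

lemma comp_assoc:
  assumes "f \<in> homs C A B" "g \<in> homs C B D" "h \<in> homs C D E"
  shows "(h \<cdot> g) \<cdot> f = h \<cdot> (g \<cdot> f)"
  using assms category unfolding category_def homs_def by auto

lemma idn_in [intro]: "A \<in> obj C \<Longrightarrow> idn C A \<in> homs C A A"
  using category by (auto simp: category_def)

lemma comp_idn:
  assumes "f \<in> homs C A B"
  shows "f \<cdot> idn C A = f" "idn C B \<cdot> f = f"
  using assms category unfolding category_def homs_def by auto

lemma ex_zero_object: "\<exists>Z. zero_object C Z"
  using semiabelian by (simp add: semiabelian_def pointed_def)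

lemma finitely_complete: "finitely_complete C"
  using semiabelian by (simp add: semiabelian_def barr_exact_def regular_category_def)

section \<open>Zero objects and zero arrows\<close>

lemma terminal_eq:
  assumes "terminal_object C T" "f \<in> homs C A T" "g \<in> homs C A T"
  shows "f = g"
  using assms homsD(4)[OF assms(2)] unfolding terminal_object_def by blast

lemma initial_eq:
  assumes "initial_object C T" "f \<in> homs C T A" "g \<in> homs C T A"
  shows "f = g"
  using assms homsD(5)[OF assms(2)] unfolding initial_object_def by blast

lemma zero_object_arrows:
  assumes "zero_object C Z" "A \<in> obj C"
  obtains f g where "f \<in> homs C Z A" "g \<in> homs C A Z"
proof -
  have "\<exists>!f. f \<in> homs C Z A" "\<exists>!f. f \<in> homs C A Z"
    using assms by (simp_all add: zero_object_def initial_object_def terminal_object_def)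
  then show thesis using that by metis
qed

lemma zero_object_obj: "zero_object C Z \<Longrightarrow> Z \<in> obj C"
  by (simp add: zero_object_def initial_object_def)

lemma to_zero_eq:
  assumes "zero_object C Z" "f \<in> homs C A Z" "g \<in> homs C A Z"
  shows "f = g"
  using assms(1) terminal_eq[OF _ assms(2,3)] by (simp add: zero_object_def)

lemma from_zero_eq:
  assumes "zero_object C Z" "f \<in> homs C Z A" "g \<in> homs C Z A"
  shows "f = g"
  using assms(1) initial_eq[OF _ assms(2,3)] by (simp add: zero_object_def)

lemma zero_arrowI:
  assumes "zero_object C Z" "g \<in> homs C A Z" "h \<in> homs C Z B"
  shows "zero_arrow C (h \<cdot> g)"
proof -
  have hg: "h \<cdot> g \<in> homs C A B" using assms by blast
  then show ?thesis using assms homsD[OF hg] unfolding zero_arrow_def by auto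
qed

lemma zero_arrowE:
  assumes "zero_arrow C f" "f \<in> homs C A B"
  obtains Z g h where "zero_object C Z" "g \<in> homs C A Z" "h \<in> homs C Z B" "f = h \<cdot> g"
  using assms homsD[OF assms(2)] unfolding zero_arrow_def by auto

text \<open>Two zero arrows may factor through different zero objects; the comparison arrow between
  these identifies the factorisations. Hence a hom-set has one zero arrow, whichever zero object
  witnesses it.\<close>

lemma zero_arrow_unique:
  assumes "zero_arrow C f" "zero_arrow C f'" "f \<in> homs C A B" "f' \<in> homs C A B"
  shows "f = f'"
proof -
  obtain Z g h where Z: "zero_object C Z" "g \<in> homs C A Z" "h \<in> homs C Z B" "f = h \<cdot> g"
    using assms zero_arrowE by blast
  obtain Z' g' h' where Z': "zero_object C Z'" "g' \<in> homs C A Z'" "h' \<in> homs C Z' B" "f' = h' \<cdot> g'"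
    using assms zero_arrowE by blast
  obtain j where j: "j \<in> homs C Z Z'"
    using zero_object_arrows[OF Z(1) zero_object_obj[OF Z'(1)]] by metis
  have "h' \<cdot> j = h" using from_zero_eq[OF Z(1) comp_in[OF j Z'(3)] Z(3)] .
  moreover have "j \<cdot> g = g'" using to_zero_eq[OF Z'(1) comp_in[OF Z(2) j] Z'(2)] .
  ultimately show ?thesis using comp_assoc[OF Z(2) j Z'(3)] Z(4) Z'(4) by simp
qed

lemma ex_zero_arrow:
  assumes "A \<in> obj C" "B \<in> obj C"
  shows "\<exists>f \<in> homs C A B. zero_arrow C f"
proof -
  obtain Z where Z: "zero_object C Z" using ex_zero_object by blast
  obtain g where g: "g \<in> homs C A Z" using zero_object_arrows[OF Z assms(1)] by metis
  obtain h where h: "h \<in> homs C Z B" using zero_object_arrows[OF Z assms(2)] by metis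
  show ?thesis using zero_arrowI[OF Z g h] comp_in[OF g h] by blast
qed

lemma zero_arrow_comp_left:
  assumes "zero_arrow C f" "f \<in> homs C A B" "g \<in> homs C B D"
  shows "zero_arrow C (g \<cdot> f)"
proof -
  obtain Z k h where Z: "zero_object C Z" "k \<in> homs C A Z" "h \<in> homs C Z B" "f = h \<cdot> k"
    using assms zero_arrowE by blast
  then have "g \<cdot> f = (g \<cdot> h) \<cdot> k" using assms comp_assoc by metis
  then show ?thesis using Z assms zero_arrowI[OF Z(1,2), of "g \<cdot> h" D] by auto
qed

lemma zero_arrow_comp_right:
  assumes "zero_arrow C f" "f \<in> homs C A B" "g \<in> homs C D A"
  shows "zero_arrow C (f \<cdot> g)"
proof -
  obtain Z k h where Z: "zero_object C Z" "k \<in> homs C A Z" "h \<in> homs C Z B" "f = h \<cdot> k"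
    using assms zero_arrowE by blast
  then have "f \<cdot> g = h \<cdot> (k \<cdot> g)" using assms comp_assoc by metis
  then show ?thesis using Z assms zero_arrowI[OF Z(1) _ Z(3), of "k \<cdot> g" D] by auto
qed

lemma zero_arrow_to_zero:
  assumes "zero_object C Z" "f \<in> homs C A Z"
  shows "zero_arrow C f"
  using zero_arrowI[OF assms(1) assms(2) idn_in] assms comp_idn homsD(5) by fastforce

text \<open>Terminal objects of a pointed category are zero objects: the identity of
  \<open>T\<close> equals the zero endomorphism by uniqueness. This applies to the unit of an
  abelian object, which starts at an arbitrary terminal object.\<close>

lemma zero_arrow_from_terminal:
  assumes "terminal_object C T" "f \<in> homs C T A"
  shows "zero_arrow C f"
proof -
  have T: "T \<in> obj C" using assms(1) by (simp add: terminal_object_def)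
  obtain z where z: "z \<in> homs C T T" "zero_arrow C z" using ex_zero_arrow T by blast
  then have "z = idn C T" using terminal_eq[OF assms(1)] T by blast
  then show ?thesis using zero_arrow_comp_left[OF z(2,1) assms(2)] comp_idn[OF assms(2)] by simp
qed

section \<open>Binary products and pairings\<close>

lemma product_pairing:
  assumes "is_product C A B Q p q" "f \<in> homs C X A" "g \<in> homs C X B"
  shows "pairing C Q p q f g \<in> homs C X Q"
    "p \<cdot> pairing C Q p q f g = f" "q \<cdot> pairing C Q p q f g = g"
proof -
  have "\<exists>!u. u \<in> homs C X Q \<and> p \<cdot> u = f \<and> q \<cdot> u = g"
    using assms homsD(4)[OF assms(2)] unfolding is_product_def by blast
  then have "\<exists>!u. u \<in> homs C (src C f) Q \<and> p \<cdot> u = f \<and> q \<cdot> u = g"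
    using homsD[OF assms(2)] by simp
  from theI'[OF this] show "pairing C Q p q f g \<in> homs C X Q"
    "p \<cdot> pairing C Q p q f g = f" "q \<cdot> pairing C Q p q f g = g"
    using homsD[OF assms(2)] unfolding pairing_def by auto
qed

lemma product_eqI:
  assumes "is_product C A B Q p q" "u \<in> homs C X Q" "v \<in> homs C X Q"
    and "p \<cdot> u = p \<cdot> v" "q \<cdot> u = q \<cdot> v"
  shows "u = v"
proof -
  have pq: "p \<in> homs C Q A" "q \<in> homs C Q B" using assms(1) by (auto simp: is_product_def)
  have "p \<cdot> u \<in> homs C X A" "q \<cdot> u \<in> homs C X B" using pq assms by auto
  then have "\<exists>!w. w \<in> homs C X Q \<and> p \<cdot> w = p \<cdot> u \<and> q \<cdot> w = q \<cdot> u"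
    using assms(1) homsD(4)[OF assms(2)] unfolding is_product_def by blast
  then show ?thesis using assms by metis
qed

lemma pairing_comp:
  assumes "is_product C A B Q p q" "f \<in> homs C X A" "g \<in> homs C X B" "x \<in> homs C Y X"
  shows "pairing C Q p q f g \<cdot> x = pairing C Q p q (f \<cdot> x) (g \<cdot> x)"
proof -
  have pq: "p \<in> homs C Q A" "q \<in> homs C Q B" using assms(1) by (auto simp: is_product_def)
  note 1 = product_pairing[OF assms(1-3)]
  have "f \<cdot> x \<in> homs C Y A" "g \<cdot> x \<in> homs C Y B" using assms by auto
  note 2 = product_pairing[OF assms(1) this]
  show ?thesis
    by (rule product_eqI[OF assms(1) _ 2(1)])
      (use 1 2 assms pq comp_assoc[OF assms(4) 1(1) pq(1)] comp_assoc[OF assms(4) 1(1) pq(2)] in auto)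
qed

section \<open>Groups of arrows into abelian objects\<close>

abbreviation Ab where "Ab \<equiv> abelian_core C"

lemma ab_str:
  assumes "A \<in> Ab"
  shows "internal_ab_group C A (ab_str C A)"
  using assms unfolding ab_str_def abelian_core_def by (auto intro: someI_ex)

lemma Ab_obj: "A \<in> Ab \<Longrightarrow> A \<in> obj C"
  by (simp add: abelian_core_def)

lemma carrier_hom_group [simp]: "carrier (hom_group C X A) = homs C X A"
  by (simp add: hom_group_def)

lemma ab_product:
  assumes "A \<in> Ab"
  shows "is_product C A A (sq (ab_str C A)) (prj1 (ab_str C A)) (prj2 (ab_str C A))"
  using ab_str[OF assms] by (simp add: internal_ab_group_def)

lemma gen_add_in:
  assumes "A \<in> Ab" "f \<in> homs C X A" "g \<in> homs C X A"
  shows "gen_add C (ab_str C A) f g \<in> homs C X A"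
  using product_pairing[OF ab_product[OF assms(1)] assms(2,3)] ab_str[OF assms(1)]
  unfolding gen_add_def internal_ab_group_def by blast

lemma gen_zero_unfold:
  assumes "A \<in> Ab" "X \<in> obj C"
  obtains t where "t \<in> homs C X (one_ob (ab_str C A))"
    "gen_zero C (ab_str C A) X = unt (ab_str C A) \<cdot> t"
    "unt (ab_str C A) \<in> homs C (one_ob (ab_str C A)) A"
    "terminal_object C (one_ob (ab_str C A))"
proof -
  have *: "terminal_object C (one_ob (ab_str C A))" "unt (ab_str C A) \<in> homs C (one_ob (ab_str C A)) A"
    using ab_str[OF assms(1)] by (auto simp: internal_ab_group_def)
  then have "\<exists>!t. t \<in> homs C X (one_ob (ab_str C A))"
    using assms(2) by (auto simp: terminal_object_def)
  from theI'[OF this] show ?thesis using that * unfolding gen_zero_def by blast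
qed

lemma gen_zero_in:
  assumes "A \<in> Ab" "X \<in> obj C"
  shows "gen_zero C (ab_str C A) X \<in> homs C X A"
  using gen_zero_unfold[OF assms] by (metis comp_in)

lemma one_in: "A \<in> Ab \<Longrightarrow> X \<in> obj C \<Longrightarrow> \<one>\<^bsub>hom_group C X A\<^esub> \<in> homs C X A"
  using gen_zero_in by (simp add: hom_group_def)

lemma zero_arrow_one:
  assumes "A \<in> Ab" "X \<in> obj C"
  shows "zero_arrow C \<one>\<^bsub>hom_group C X A\<^esub>"
  using gen_zero_unfold[OF assms] zero_arrow_comp_right zero_arrow_from_terminal
  by (metis hom_group_def monoid.select_convs(2))

text \<open>The bridge between two notions of zero: kernels and cokernels are phrased with
  \<open>zero_arrow\<close>, computations with the neutral element of a group of arrows.\<close>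

lemma zero_arrow_iff:
  assumes "A \<in> Ab" "f \<in> homs C X A"
  shows "zero_arrow C f \<longleftrightarrow> f = \<one>\<^bsub>hom_group C X A\<^esub>"
  using zero_arrow_unique[OF _ zero_arrow_one assms(2) one_in] zero_arrow_one assms homsD(4) by metis

lemma comm_group_hom_group:
  assumes "A \<in> Ab" "X \<in> obj C"
  shows "comm_group (hom_group C X A)"
proof -
  let ?G = "ab_str C A"
  have ax: "gen_add C ?G (gen_add C ?G f g) h = gen_add C ?G f (gen_add C ?G g h) \<and>
        gen_add C ?G f g = gen_add C ?G g f \<and>
        gen_add C ?G f (gen_zero C ?G X) = f \<and>
        gen_add C ?G f (negn ?G \<cdot> f) = gen_zero C ?G X"
    if "f \<in> homs C X A" "g \<in> homs C X A" "h \<in> homs C X A" for f g h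
    using ab_str[OF assms(1)] assms(2) that unfolding internal_ab_group_def by blast
  have neg: "negn ?G \<in> homs C A A" using ab_str[OF assms(1)] by (simp add: internal_ab_group_def)
  show ?thesis
  proof (rule comm_groupI)
    fix f assume "f \<in> carrier (hom_group C X A)"
    then have f: "f \<in> homs C X A" by simp
    show "\<exists>g\<in>carrier (hom_group C X A). g \<otimes>\<^bsub>hom_group C X A\<^esub> f = \<one>\<^bsub>hom_group C X A\<^esub>"
      using ax[OF f comp_in[OF f neg] f] comp_in[OF f neg]
      by (intro bexI[of _ "negn ?G \<cdot> f"]) (simp_all add: hom_group_def, metis)
  next
    fix f g h assume "f \<in> carrier (hom_group C X A)" "g \<in> carrier (hom_group C X A)" "h \<in> carrier (hom_group C X A)"
    then have fgh: "f \<in> homs C X A" "g \<in> homs C X A" "h \<in> homs C X A" by simp_all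
    show "f \<otimes>\<^bsub>hom_group C X A\<^esub> g \<otimes>\<^bsub>hom_group C X A\<^esub> h = f \<otimes>\<^bsub>hom_group C X A\<^esub> (g \<otimes>\<^bsub>hom_group C X A\<^esub> h)"
      using ax[OF fgh, THEN conjunct1] by (simp add: hom_group_def)
  next
    fix f g assume "f \<in> carrier (hom_group C X A)" "g \<in> carrier (hom_group C X A)"
    then have fg: "f \<in> homs C X A" "g \<in> homs C X A" by simp_all
    show "f \<otimes>\<^bsub>hom_group C X A\<^esub> g = g \<otimes>\<^bsub>hom_group C X A\<^esub> f"
      using ax[OF fg fg(1), THEN conjunct2, THEN conjunct1] by (simp add: hom_group_def)
    show "f \<otimes>\<^bsub>hom_group C X A\<^esub> g \<in> carrier (hom_group C X A)"
      using gen_add_in[OF assms(1) fg] by (simp add: hom_group_def)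
  next
    fix f assume "f \<in> carrier (hom_group C X A)"
    then have f: "f \<in> homs C X A" by simp
    show "\<one>\<^bsub>hom_group C X A\<^esub> \<otimes>\<^bsub>hom_group C X A\<^esub> f = f"
      using ax[OF f gen_zero_in[OF assms] f] by (simp add: hom_group_def) metis
  qed (use gen_zero_in[OF assms] in \<open>simp add: hom_group_def\<close>)
qed

text \<open>Naturality of pairings gives this directly. Additivity in the other variable is harder
  and comes in \<open>postcomp_mult\<close>.\<close>

lemma precomp_mult:
  assumes "A \<in> Ab" "f \<in> homs C X A" "g \<in> homs C X A" "x \<in> homs C Y X"
  shows "(f \<otimes>\<^bsub>hom_group C X A\<^esub> g) \<cdot> x = (f \<cdot> x) \<otimes>\<^bsub>hom_group C Y A\<^esub> (g \<cdot> x)"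
proof -
  have "addn (ab_str C A) \<in> homs C (sq (ab_str C A)) A"
    using ab_str[OF assms(1)] by (simp add: internal_ab_group_def)
  then show ?thesis
    using pairing_comp[OF ab_product[OF assms(1)] assms(2-4)]
      product_pairing(1)[OF ab_product[OF assms(1)] assms(2,3)] assms(4) comp_assoc
    by (simp add: hom_group_def gen_add_def)
qed

lemma precomp_hom:
  assumes "A \<in> Ab" "x \<in> homs C Y X"
  shows "(\<lambda>f. f \<cdot> x) \<in> hom (hom_group C X A) (hom_group C Y A)"
  using precomp_mult assms by (auto simp: hom_def)

lemma precomp_group_hom:
  assumes "A \<in> Ab" "x \<in> homs C Y X"
  shows "group_hom (hom_group C X A) (hom_group C Y A) (\<lambda>f. f \<cdot> x)"
  using precomp_hom[OF assms] comm_group_hom_group[OF assms(1)] homsD[OF assms(2)]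
  by (simp add: group_hom_def group_hom_axioms_def comm_group_def)

section \<open>Pullbacks, kernels and the additivity of composition\<close>

lemma pullbackD:
  assumes "is_pullback C f g Q p q" "f \<in> homs C A D" "g \<in> homs C B D"
  shows "p \<in> homs C Q A" "q \<in> homs C Q B" "f \<cdot> p = g \<cdot> q"
    and "a \<in> homs C X A \<Longrightarrow> b \<in> homs C X B \<Longrightarrow> f \<cdot> a = g \<cdot> b \<Longrightarrow>
      \<exists>!u. u \<in> homs C X Q \<and> p \<cdot> u = a \<and> q \<cdot> u = b"
  using assms(1) homsD[OF assms(2)] homsD[OF assms(3)] homsD(4)[of a X A]
  by (simp_all add: is_pullback_def)

lemma ex_pullback:
  assumes "f \<in> homs C A D" "g \<in> homs C B D"
  obtains Q p q where "is_pullback C f g Q p q"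
  using finitely_complete homsD[OF assms(1)] homsD[OF assms(2)] unfolding finitely_complete_def by metis

text \<open>The kernel is the pullback of an arrow out of a zero object. The second projection lands
  in that zero object and carries no information, so the universal property splits into existence
  and cancellation, both in terms of \<open>k\<close> alone.\<close>

lemma ex_kernel:
  assumes "f \<in> homs C A B"
  obtains K k where "k \<in> homs C K A" "zero_arrow C (f \<cdot> k)"
    "\<And>X a. a \<in> homs C X A \<Longrightarrow> zero_arrow C (f \<cdot> a) \<Longrightarrow> \<exists>u \<in> homs C X K. k \<cdot> u = a"
    "\<And>X u v. u \<in> homs C X K \<Longrightarrow> v \<in> homs C X K \<Longrightarrow> k \<cdot> u = k \<cdot> v \<Longrightarrow> u = v"
proof -
  obtain Z where Z: "zero_object C Z" using ex_zero_object by blast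
  obtain z where z: "z \<in> homs C Z B"
    using zero_object_arrows[OF Z homsD(5)[OF assms]] by metis
  obtain K p k where pb: "is_pullback C f z K k p"
    using ex_pullback[OF assms z] .
  have k: "k \<in> homs C K A" "p \<in> homs C K Z" "f \<cdot> k = z \<cdot> p"
    using pullbackD[OF pb assms z] by auto
  have un: "\<exists>!u. u \<in> homs C X K \<and> k \<cdot> u = a \<and> p \<cdot> u = b"
    if "a \<in> homs C X A" "b \<in> homs C X Z" "f \<cdot> a = z \<cdot> b" for X a b
    using pullbackD(4)[OF pb assms z that] .
  show ?thesis
  proof (rule that[OF k(1)])
    show "zero_arrow C (f \<cdot> k)" using zero_arrowI[OF Z k(2) z] k(3) by simp
    fix X a assume a: "a \<in> homs C X A" and za: "zero_arrow C (f \<cdot> a)"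
    obtain b where b: "b \<in> homs C X Z"
      using zero_object_arrows[OF Z homsD(4)[OF a]] by metis
    have zz: "zero_arrow C (z \<cdot> b)" using zero_arrowI[OF Z b z] .
    have "f \<cdot> a \<in> homs C X B" using a assms by (rule comp_in)
    moreover have "z \<cdot> b \<in> homs C X B" using b z by (rule comp_in)
    ultimately have "f \<cdot> a = z \<cdot> b" using zero_arrow_unique[OF za zz] by simp
    then show "\<exists>u \<in> homs C X K. k \<cdot> u = a" using un[OF a b] by metis
  next
    fix X u v assume u: "u \<in> homs C X K" and v: "v \<in> homs C X K" and e: "k \<cdot> u = k \<cdot> v"
    have pu: "p \<cdot> u \<in> homs C X Z" "p \<cdot> v \<in> homs C X Z" using u v k by auto
    then have "p \<cdot> u = p \<cdot> v" using to_zero_eq[OF Z] by metis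
    moreover have "f \<cdot> (k \<cdot> u) = z \<cdot> (p \<cdot> u)"
      using comp_assoc[OF u k(1) assms] comp_assoc[OF u k(2) z] k(3) by simp
    ultimately have "\<exists>!w. w \<in> homs C X K \<and> k \<cdot> w = k \<cdot> u \<and> p \<cdot> w = p \<cdot> u"
      using un[OF comp_in[OF u k(1)] pu(1)] by simp
    then show "u = v" using u v e \<open>p \<cdot> u = p \<cdot> v\<close> by metis
  qed
qed

text \<open>Protomodularity, applied to the kernel of \<open>u - v\<close> as a point over the second factor,
  shows that the two injections into a product are jointly epic.\<close>

lemma product_injections_jointly_epic:
  assumes prod: "is_product C A A Q p q" and B: "B \<in> Ab"
    and u: "u \<in> homs C Q B" and v: "v \<in> homs C Q B"
    and i: "i \<in> homs C A Q" "p \<cdot> i = idn C A" "zero_arrow C (q \<cdot> i)"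
    and j: "j \<in> homs C A Q" "q \<cdot> j = idn C A"
    and eq: "u \<cdot> i = v \<cdot> i" "u \<cdot> j = v \<cdot> j"
  shows "u = v"
proof -
  have pq: "p \<in> homs C Q A" "q \<in> homs C Q A" using prod by (auto simp: is_product_def)
  have A: "A \<in> obj C" and Q: "Q \<in> obj C" using homsD[OF i(1)] by auto
  interpret G: comm_group "hom_group C Q B" using comm_group_hom_group B Q by blast
  \<comment> \<open>\<open>d\<close> vanishes exactly where \<open>u\<close> and \<open>v\<close>
    agree, so its kernel \<open>e\<close> serves as their equaliser and both \<open>i\<close> and
    \<open>j\<close> factor through it.\<close>
  define d where "d = u \<otimes>\<^bsub>hom_group C Q B\<^esub> inv\<^bsub>hom_group C Q B\<^esub> v"
  have d: "d \<in> homs C Q B"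
    using G.m_closed[of u "inv\<^bsub>hom_group C Q B\<^esub> v"] G.inv_closed[of v] u v unfolding d_def by simp
  have dx: "zero_arrow C (d \<cdot> x) \<longleftrightarrow> u \<cdot> x = v \<cdot> x" if x: "x \<in> homs C Y Q" for x Y
  proof -
    interpret h: group_hom "hom_group C Q B" "hom_group C Y B" "\<lambda>f. f \<cdot> x"
      using precomp_group_hom B x by blast
    have "d \<cdot> x = (u \<cdot> x) \<otimes>\<^bsub>hom_group C Y B\<^esub> inv\<^bsub>hom_group C Y B\<^esub> (v \<cdot> x)"
      using u v h.hom_mult[of u "inv\<^bsub>hom_group C Q B\<^esub> v"] h.hom_inv[of v] G.inv_closed[of v]
      unfolding d_def by simp
    moreover have "u \<cdot> x \<in> homs C Y B" "v \<cdot> x \<in> homs C Y B" "d \<cdot> x \<in> homs C Y B" using u v x d by auto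
    ultimately show ?thesis
      using zero_arrow_iff[OF B] by (metis h.H.inv_equality h.H.inv_inv h.H.r_inv carrier_hom_group h.H.inv_closed)
  qed
  obtain E e where e: "e \<in> homs C E Q" "zero_arrow C (d \<cdot> e)"
    and lift: "\<And>X a. a \<in> homs C X Q \<Longrightarrow> zero_arrow C (d \<cdot> a) \<Longrightarrow> \<exists>u \<in> homs C X E. e \<cdot> u = a"
    and mono: "\<And>X u v. u \<in> homs C X E \<Longrightarrow> v \<in> homs C X E \<Longrightarrow> e \<cdot> u = e \<cdot> v \<Longrightarrow> u = v"
    by (rule ex_kernel[OF d]) blast
  obtain i' where i': "i' \<in> homs C A E" "e \<cdot> i' = i" using lift[OF i(1)] dx[OF i(1)] eq by blast
  obtain j' where j': "j' \<in> homs C A E" "e \<cdot> j' = j" using lift[OF j(1)] dx[OF j(1)] eq by blast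
  obtain Z where Z: "zero_object C Z" using ex_zero_object by blast
  obtain z where z: "z \<in> homs C Z A" using zero_object_arrows[OF Z A] by metis
  obtain t where t: "t \<in> homs C A Z" using zero_object_arrows[OF Z A] by metis
  have qe: "q \<cdot> e \<in> homs C E A" using pq e by blast
  have zt: "z \<cdot> t = q \<cdot> i" using zero_arrow_unique[OF zero_arrowI[OF Z t z] i(3)] t z i pq by blast
  have qei: "(q \<cdot> e) \<cdot> i' = q \<cdot> i" using comp_assoc[OF i'(1) e(1) pq(2)] i' by simp
  have kerQ: "x = i \<cdot> (p \<cdot> x)" if x: "x \<in> homs C X Q" and c: "c \<in> homs C X Z" "z \<cdot> c = q \<cdot> x" for X x c
  proof (rule product_eqI[OF prod x])
    have px: "p \<cdot> x \<in> homs C X A" using pq x by blast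
    then show "i \<cdot> (p \<cdot> x) \<in> homs C X Q" using i by blast
    show "p \<cdot> x = p \<cdot> (i \<cdot> (p \<cdot> x))"
      using comp_assoc[OF px i(1) pq(1)] i comp_idn[OF px] by simp
    have "zero_arrow C (q \<cdot> x)" using zero_arrowI[OF Z c(1) z] c(2) by simp
    moreover have "zero_arrow C ((q \<cdot> i) \<cdot> (p \<cdot> x))"
      using zero_arrow_comp_right[OF i(3) _ px] i pq by blast
    moreover have "q \<cdot> x \<in> homs C X A" "(q \<cdot> i) \<cdot> (p \<cdot> x) \<in> homs C X A" using pq x px i by blast+
    ultimately show "q \<cdot> x = q \<cdot> (i \<cdot> (p \<cdot> x))"
      using comp_assoc[OF px i(1) pq(2)] zero_arrow_unique by metis
  qed
  \<comment> \<open>Pulling back along \<open>z : Z -> A\<close> out of the zero object computes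
    kernels. The kernel of \<open>q\<close> is \<open>A\<close> with inclusion \<open>i\<close>, and
    that of \<open>q \<cdot> e\<close> is again \<open>A\<close>, with inclusion \<open>i'\<close>;
    so \<open>e\<close> restricts to the identity of \<open>A\<close>, and protomodularity makes it
    an isomorphism.\<close>
  have pbQ: "is_pullback C z q A t i"
    unfolding is_pullback_def
  proof (intro conjI ballI impI)
    fix X c x assume "X \<in> obj C" and c': "c \<in> homs C X (src C z)" and x': "x \<in> homs C X (src C q)" and e1: "z \<cdot> c = q \<cdot> x"
    have c: "c \<in> homs C X Z" and x: "x \<in> homs C X Q" using c' x' homsD[OF z] homsD[OF pq(2)] by auto
    have px: "p \<cdot> x \<in> homs C X A" using pq x by blast
    show "\<exists>!w. w \<in> homs C X A \<and> t \<cdot> w = c \<and> i \<cdot> w = x"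
    proof (rule ex1I[of _ "p \<cdot> x"])
      show "p \<cdot> x \<in> homs C X A \<and> t \<cdot> (p \<cdot> x) = c \<and> i \<cdot> (p \<cdot> x) = x"
        using px kerQ[OF x c e1] to_zero_eq[OF Z comp_in[OF px t] c] by simp
      fix w assume "w \<in> homs C X A \<and> t \<cdot> w = c \<and> i \<cdot> w = x"
      then show "w = p \<cdot> x" using comp_assoc[OF _ i(1) pq(1)] i comp_idn by metis
    qed
  qed (use homsD[OF z] homsD[OF pq(2)] homsD[OF t] t i zt in auto)
  have pbE: "is_pullback C z (q \<cdot> e) A t i'"
    unfolding is_pullback_def
  proof (intro conjI ballI impI)
    fix X c x assume "X \<in> obj C" and c': "c \<in> homs C X (src C z)" and x': "x \<in> homs C X (src C (q \<cdot> e))" and e1: "z \<cdot> c = (q \<cdot> e) \<cdot> x"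
    have c: "c \<in> homs C X Z" and x: "x \<in> homs C X E" using c' x' homsD[OF z] homsD[OF qe] by auto
    have ex: "e \<cdot> x \<in> homs C X Q" using e x by blast
    have e2: "z \<cdot> c = q \<cdot> (e \<cdot> x)" using e1 comp_assoc[OF x e(1) pq(2)] by simp
    have w0: "p \<cdot> (e \<cdot> x) \<in> homs C X A" using pq ex by blast
    show "\<exists>!w. w \<in> homs C X A \<and> t \<cdot> w = c \<and> i' \<cdot> w = x"
    proof (rule ex1I[of _ "p \<cdot> (e \<cdot> x)"])
      have "e \<cdot> (i' \<cdot> (p \<cdot> (e \<cdot> x))) = e \<cdot> x"
        using kerQ[OF ex c e2] comp_assoc[OF w0 i'(1) e(1)] i'(2) by simp
      then have "i' \<cdot> (p \<cdot> (e \<cdot> x)) = x" using mono[OF _ x] w0 i'(1) by blast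
      then show "p \<cdot> (e \<cdot> x) \<in> homs C X A \<and> t \<cdot> (p \<cdot> (e \<cdot> x)) = c \<and> i' \<cdot> (p \<cdot> (e \<cdot> x)) = x"
        using w0 to_zero_eq[OF Z comp_in[OF w0 t] c] by simp
      fix w assume w: "w \<in> homs C X A \<and> t \<cdot> w = c \<and> i' \<cdot> w = x"
      then have "e \<cdot> x = i \<cdot> w" using comp_assoc[OF _ i'(1) e(1)] i' by metis
      then show "w = p \<cdot> (e \<cdot> x)" using comp_assoc[OF _ i(1) pq(1)] w i comp_idn by metis
    qed
  qed (use homsD[OF z] homsD[OF qe] homsD[OF t] t i' zt qei in auto)
  have "protomodular C" using semiabelian by (simp add: semiabelian_def)
  moreover have "is_point C (q \<cdot> e) j'" "is_point C q j"
    using homsD[OF qe] homsD[OF pq(2)] j j' comp_assoc[OF j'(1) e(1) pq(2)] by (auto simp: is_point_def)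
  moreover have "is_iso C (idn C A)"
    using idn_in[OF A] homsD[OF idn_in[OF A]] comp_idn[OF idn_in[OF A]] unfolding is_iso_def by auto
  moreover have "tgt C (q \<cdot> e) = tgt C q" "e \<in> homs C (src C (q \<cdot> e)) (src C q)"
    using homsD[OF qe] homsD[OF pq(2)] e by auto
  moreover have "t \<cdot> idn C A = t" "i \<cdot> idn C A = e \<cdot> i'"
    using comp_idn[OF t] comp_idn[OF i(1)] i' by auto
  ultimately have "is_iso C e"
    using pbE pbQ j'(2) idn_in[OF A] unfolding protomodular_def by blast
  then obtain g where g: "g \<in> homs C Q E" "e \<cdot> g = idn C Q"
    using homsD[OF e(1)] unfolding is_iso_def by auto
  have "u \<cdot> e = v \<cdot> e" using dx e by blast
  then have "(u \<cdot> e) \<cdot> g = (v \<cdot> e) \<cdot> g" by simp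
  then show "u = v"
    using comp_assoc[OF g(1) e(1) u] comp_assoc[OF g(1) e(1) v] g(2) comp_idn[OF u] comp_idn[OF v] by simp
qed

text \<open>The chosen structures on \<open>A\<close> and \<open>B\<close> come with no
  compatibility. Compare, on the product of \<open>A\<close> with itself, \<open>a\<close> after the
  addition with the sum of \<open>a\<close> after the two projections: both restrict to
  \<open>a\<close> on the two injections, which are jointly epic.\<close>

lemma postcomp_mult:
  assumes A: "A \<in> Ab" and B: "B \<in> Ab" and a: "a \<in> homs C A B"
    and f: "f \<in> homs C X A" and g: "g \<in> homs C X A"
  shows "a \<cdot> (f \<otimes>\<^bsub>hom_group C X A\<^esub> g) = (a \<cdot> f) \<otimes>\<^bsub>hom_group C X B\<^esub> (a \<cdot> g)"
proof -
  let ?G = "ab_str C A"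
  let ?Q = "sq ?G" and ?p = "prj1 ?G" and ?q = "prj2 ?G" and ?m = "addn ?G"
  have prod: "is_product C A A ?Q ?p ?q" using ab_product A by blast
  have pq: "?p \<in> homs C ?Q A" "?q \<in> homs C ?Q A" using prod by (auto simp: is_product_def)
  have m: "?m \<in> homs C ?Q A" using ab_str[OF A] by (simp add: internal_ab_group_def)
  have oA: "A \<in> obj C" using Ab_obj A by blast
  have id: "idn C A \<in> homs C A A" using oA by blast
  define o' where "o' = \<one>\<^bsub>hom_group C A A\<^esub>"
  have o': "o' \<in> homs C A A" "zero_arrow C o'" using A oA one_in zero_arrow_one unfolding o'_def by auto
  have mp: "?m \<cdot> pairing C ?Q ?p ?q r s = r \<otimes>\<^bsub>hom_group C Y A\<^esub> s" for r s Y
    by (simp add: hom_group_def gen_add_def)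
  define i where "i = pairing C ?Q ?p ?q (idn C A) o'"
  define j where "j = pairing C ?Q ?p ?q o' (idn C A)"
  note i = product_pairing[OF prod id o'(1), folded i_def]
  note j = product_pairing[OF prod o'(1) id, folded j_def]
  interpret GA: comm_group "hom_group C A A" using comm_group_hom_group A oA by blast
  interpret GB: comm_group "hom_group C A B" using comm_group_hom_group B oA by blast
  have mi: "?m \<cdot> i = idn C A" "?m \<cdot> j = idn C A"
    unfolding i_def j_def mp[where Y = A] o'_def using GA.r_one[of "idn C A"] GA.l_one[of "idn C A"] id by auto
  have ao: "a \<cdot> o' = \<one>\<^bsub>hom_group C A B\<^esub>"
    using zero_arrow_iff[OF B comp_in[OF o'(1) a]] zero_arrow_comp_left[OF o'(2,1) a] by simp
  define w where "w = (a \<cdot> ?p) \<otimes>\<^bsub>hom_group C ?Q B\<^esub> (a \<cdot> ?q)"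
  have ap: "a \<cdot> ?p \<in> homs C ?Q B" "a \<cdot> ?q \<in> homs C ?Q B" using a pq by auto
  have w: "w \<in> homs C ?Q B" using gen_add_in[OF B ap] unfolding w_def hom_group_def by simp
  have wx: "w \<cdot> x = (a \<cdot> (?p \<cdot> x)) \<otimes>\<^bsub>hom_group C Y B\<^esub> (a \<cdot> (?q \<cdot> x))" if x: "x \<in> homs C Y ?Q" for x Y
    unfolding w_def using precomp_mult[OF B ap x] comp_assoc[OF x pq(1) a] comp_assoc[OF x pq(2) a] by simp
  have "a \<cdot> ?m = w"
  proof (rule product_injections_jointly_epic[OF prod B _ w i(1) i(2) _ j(1) j(3)])
    show "a \<cdot> ?m \<in> homs C ?Q B" using a m by blast
    show "zero_arrow C (?q \<cdot> i)" using i o' by simp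
    show "(a \<cdot> ?m) \<cdot> i = w \<cdot> i"
      using comp_assoc[OF i(1) m a] mi wx[OF i(1)] i ao comp_idn[OF a] GB.r_one[of a] a by simp
    show "(a \<cdot> ?m) \<cdot> j = w \<cdot> j"
      using comp_assoc[OF j(1) m a] mi wx[OF j(1)] j ao comp_idn[OF a] GB.l_one[of a] a by simp
  qed
  moreover note fg = product_pairing[OF prod f g]
  ultimately show ?thesis
    using comp_assoc[OF fg(1) m a] wx[OF fg(1)] fg mp[of f g X] by simp
qed

lemma postcomp_hom:
  assumes "A \<in> Ab" "B \<in> Ab" "a \<in> homs C A B"
  shows "(\<lambda>f. a \<cdot> f) \<in> hom (hom_group C X A) (hom_group C X B)"
  using postcomp_mult assms by (auto simp: hom_def)

lemma postcomp_group_hom: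
  assumes "A \<in> Ab" "B \<in> Ab" "a \<in> homs C A B" "X \<in> obj C"
  shows "group_hom (hom_group C X A) (hom_group C X B) (\<lambda>f. a \<cdot> f)"
  using postcomp_hom[OF assms(1-3)] comm_group_hom_group assms
  by (simp add: group_hom_def group_hom_axioms_def comm_group_def)

lemma comp_one:
  assumes "A \<in> Ab" "B \<in> Ab" "a \<in> homs C A B" "X \<in> obj C"
  shows "a \<cdot> \<one>\<^bsub>hom_group C X A\<^esub> = \<one>\<^bsub>hom_group C X B\<^esub>"
  using group_hom.hom_one[OF postcomp_group_hom[OF assms]] .

lemma one_comp:
  assumes "A \<in> Ab" "x \<in> homs C Y X"
  shows "\<one>\<^bsub>hom_group C X A\<^esub> \<cdot> x = \<one>\<^bsub>hom_group C Y A\<^esub>"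
  using group_hom.hom_one[OF precomp_group_hom[OF assms]] .

end

section \<open>Alternating sums in commutative groups\<close>

definition signed :: "('a, 'b) monoid_scheme \<Rightarrow> nat \<Rightarrow> 'a \<Rightarrow> 'a" where
  "signed G i x = (if even i then x else inv\<^bsub>G\<^esub> x)"

text \<open>The bound is inclusive, matching the index set \<open>{..Suc k}\<close> of
  \<open>coboundary\<close>. Splitting off the last term leaves the signs of the others unchanged,
  which suits the inductions below.\<close>

primrec alt_sum :: "('a, 'b) monoid_scheme \<Rightarrow> (nat \<Rightarrow> 'a) \<Rightarrow> nat \<Rightarrow> 'a" where
  "alt_sum G t 0 = t 0"
| "alt_sum G t (Suc m) = alt_sum G t m \<otimes>\<^bsub>G\<^esub> signed G (Suc m) (t (Suc m))"

context comm_group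
begin

lemma signed_closed [simp]: "x \<in> carrier G \<Longrightarrow> signed G i x \<in> carrier G"
  by (simp add: signed_def)

lemma signed_one [simp]: "signed G i \<one> = \<one>"
  by (simp add: signed_def)

lemma signed_zero [simp]: "signed G 0 x = x"
  by (simp add: signed_def)

lemma signed_Suc: "x \<in> carrier G \<Longrightarrow> signed G (Suc i) x = inv (signed G i x)"
  by (simp add: signed_def)

lemma signed_signed [simp]: "x \<in> carrier G \<Longrightarrow> signed G i (signed G i x) = x"
  by (simp add: signed_def)

lemma signed_mult:
  "x \<in> carrier G \<Longrightarrow> y \<in> carrier G \<Longrightarrow> signed G i (x \<otimes> y) = signed G i x \<otimes> signed G i y"
  by (simp add: signed_def inv_mult)

lemma alt_sum_closed [simp]: "(\<And>i. i \<le> m \<Longrightarrow> t i \<in> carrier G) \<Longrightarrow> alt_sum G t m \<in> carrier G"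
  by (induction m) auto

lemma alt_sum_cong: "(\<And>i. i \<le> m \<Longrightarrow> t i = s i) \<Longrightarrow> alt_sum G t m = alt_sum G s m"
  by (induction m) auto

lemma finprod_signed:
  "(\<And>i. i \<le> m \<Longrightarrow> t i \<in> carrier G) \<Longrightarrow> finprod G (\<lambda>i. signed G i (t i)) {..m} = alt_sum G t m"
proof (induction m)
  case (Suc m)
  then have "(\<lambda>i. signed G i (t i)) \<in> {..Suc m} \<rightarrow> carrier G" by auto
  from finprod_Suc[OF this] Suc show ?case by (simp add: m_comm)
qed simp

lemma alt_sum_one: "(\<And>i. i \<le> m \<Longrightarrow> t i = \<one>) \<Longrightarrow> alt_sum G t m = \<one>"
  by (induction m) auto

lemma alt_sum_mult:
  "(\<And>i. i \<le> m \<Longrightarrow> t i \<in> carrier G) \<Longrightarrow> (\<And>i. i \<le> m \<Longrightarrow> s i \<in> carrier G) \<Longrightarrow>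
    alt_sum G (\<lambda>i. t i \<otimes> s i) m = alt_sum G t m \<otimes> alt_sum G s m"
  by (induction m) (auto simp: signed_mult m_ac)

lemma alt_sum_signed:
  "(\<And>i. i \<le> m \<Longrightarrow> t i \<in> carrier G) \<Longrightarrow> alt_sum G (\<lambda>i. signed G k (t i)) m = signed G k (alt_sum G t m)"
proof (induction m)
  case (Suc m)
  moreover have "signed G (Suc m) (signed G k x) = signed G k (signed G (Suc m) x)" if "x \<in> carrier G" for x
    using that by (simp add: signed_def)
  ultimately show ?case by (simp add: signed_mult)
qed simp

lemma alt_sum_last:
  "(\<And>i. i < m \<Longrightarrow> t i = \<one>) \<Longrightarrow> t m \<in> carrier G \<Longrightarrow> alt_sum G t m = signed G m (t m)"
  using alt_sum_one[of "m - 1" t] by (cases m) auto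

text \<open>Neighbouring terms carry opposite signs. The pair at \<open>i\<close> and
  \<open>Suc i\<close> will come from the two faces of which a degeneracy is a section.\<close>

lemma alt_sum_two:
  assumes "\<And>l. l \<le> m \<Longrightarrow> l \<noteq> i \<Longrightarrow> l \<noteq> Suc i \<Longrightarrow> t l = \<one>" "t (Suc i) = t i" "t i \<in> carrier G"
    and "i < m"
  shows "alt_sum G t m = \<one>"
  using assms(1,4)
proof (induction m)
  case (Suc m)
  show ?case
  proof (cases "m = i")
    case True
    then have "alt_sum G t m = signed G i (t i)" using Suc.prems assms(3) alt_sum_last[of m t] by simp
    then show ?thesis using True assms by (simp add: signed_Suc)
  next
    case False
    then show ?thesis using Suc by simp
  qed
qed simp

text \<open>The abstract form of the cancellation in \<open>normalize_step\<close>. The terms of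
  \<open>s\<close> below \<open>j\<close> vanish, those at \<open>j\<close> and \<open>Suc j\<close>
  cancel, and the later ones repeat \<open>t\<close> with the index shifted by one, hence with
  opposite sign; of \<open>t\<close> only the part up to \<open>j\<close> remains.\<close>

lemma alt_sum_shift:
  assumes "\<And>i. i < j \<Longrightarrow> s i = \<one>" "s (Suc j) = s j" "s j \<in> carrier G"
    and "\<And>i. j < i \<Longrightarrow> i \<le> m \<Longrightarrow> s (Suc i) = t i"
    and "\<And>i. i \<le> m \<Longrightarrow> t i \<in> carrier G" and "j \<le> m"
  shows "alt_sum G s (Suc m) \<otimes> alt_sum G t m = alt_sum G t j"
  using assms(6,4,5)
proof (induction m rule: dec_induct)
  case base
  have "alt_sum G s (Suc j) = \<one>" using assms(1-3) by (intro alt_sum_two[of _ j]) auto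
  then show ?case using base by simp
next
  case (step m)
  have t: "alt_sum G t m \<in> carrier G" "t (Suc m) \<in> carrier G" using step.prems by auto
  have s: "alt_sum G s (Suc m) \<in> carrier G"
  proof (rule alt_sum_closed)
    fix i assume i: "i \<le> Suc m"
    consider "i < j" | "i = j" | "i = Suc j" | k where "i = Suc k" "j < k" "k \<le> m"
      using i by (cases i) (auto, linarith)
    then show "s i \<in> carrier G" using assms(1-3) step.prems by cases auto
  qed
  let ?x = "signed G (Suc m) (t (Suc m))"
  have x: "?x \<in> carrier G" using t by simp
  have "alt_sum G s (Suc (Suc m)) \<otimes> alt_sum G t (Suc m)
      = (alt_sum G s (Suc m) \<otimes> inv ?x) \<otimes> (alt_sum G t m \<otimes> ?x)"
    using step.prems(1)[of "Suc m"] step.hyps signed_Suc[OF t(2), of "Suc m"] by simp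
  also have "\<dots> = (alt_sum G s (Suc m) \<otimes> alt_sum G t m) \<otimes> (inv ?x \<otimes> ?x)"
    using s t(1) x by (simp del: alt_sum.simps add: m_ac)
  also have "\<dots> = alt_sum G t j" using step s t x by (simp del: alt_sum.simps add: l_inv)
  finally show ?case .
qed

text \<open>The reason why a coboundary squares to zero. In the induction the last row of the array
  equals the last column; the row enters with the sign of \<open>Suc (Suc m)\<close>, the column
  with that of \<open>Suc m\<close>, so they cancel and leave the smaller array.\<close>

lemma alt_sum_square:
  assumes "\<And>i j. i \<le> Suc m \<Longrightarrow> j \<le> m \<Longrightarrow> a i j \<in> carrier G"
    and "\<And>i j. i \<le> j \<Longrightarrow> j \<le> m \<Longrightarrow> a (Suc j) i = a i j"
  shows "alt_sum G (\<lambda>i. alt_sum G (a i) m) (Suc m) = \<one>"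
  using assms
proof (induction m)
  case 0
  then show ?case by (simp add: signed_Suc)
next
  case (Suc m)
  let ?c = "\<lambda>i. a i (Suc m)"
  have cl: "alt_sum G (a i) m \<in> carrier G" "?c i \<in> carrier G" if "i \<le> Suc m" for i
    using Suc.prems(1) that by auto
  have c2: "alt_sum G ?c (Suc m) \<in> carrier G" using cl(2) by (rule alt_sum_closed)
  have "alt_sum G (\<lambda>i. alt_sum G (a i) (Suc m)) (Suc m)
      = alt_sum G (\<lambda>i. alt_sum G (a i) m) (Suc m) \<otimes> alt_sum G (\<lambda>i. signed G (Suc m) (?c i)) (Suc m)"
    using cl alt_sum_mult[of "Suc m" "\<lambda>i. alt_sum G (a i) m" "\<lambda>i. signed G (Suc m) (?c i)"] by simp
  also have "\<dots> = signed G (Suc m) (alt_sum G ?c (Suc m))"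
    using Suc cl alt_sum_signed[of "Suc m" ?c "Suc m"] c2 by (simp del: alt_sum.simps)
  finally have 1: "alt_sum G (\<lambda>i. alt_sum G (a i) (Suc m)) (Suc m) = signed G (Suc m) (alt_sum G ?c (Suc m))" .
  have 2: "alt_sum G (a (Suc (Suc m))) (Suc m) = alt_sum G ?c (Suc m)"
    using Suc.prems(2) by (intro alt_sum_cong) auto
  show ?case
    unfolding alt_sum.simps(2)[of G _ "Suc m"] 1 2 using c2 by (simp del: alt_sum.simps add: signed_Suc)
qed

end

lemma (in group_hom) hom_signed: "x \<in> carrier G \<Longrightarrow> h (signed G i x) = signed H i (h x)"
  by (simp add: signed_def)

lemma hom_alt_sum:
  assumes "group_hom G H h" "comm_group G" "\<And>i. i \<le> m \<Longrightarrow> t i \<in> carrier G"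
  shows "h (alt_sum G t m) = alt_sum H (\<lambda>i. h (t i)) m"
proof -
  interpret group_hom G H h by fact
  interpret G: comm_group G by fact
  show ?thesis using assms(3) by (induction m) (auto simp: hom_signed)
qed

declare alt_sum.simps(2) [simp del]

section \<open>Cochains of a simplicial object\<close>

locale simplicial = semiabelian_category C for C :: "('o, 'a) cat" (structure) +
  fixes S :: "('o, 'a) simpl"
  assumes simplicial: "simplicial_object C S"
begin

lemma sob: "sob S k \<in> obj C"
  and face: "i \<le> Suc k \<Longrightarrow> face S k i \<in> homs C (sob S (Suc k)) (sob S k)"
  and degen: "i \<le> k \<Longrightarrow> degen S k i \<in> homs C (sob S k) (sob S (Suc k))"
  and face_face: "i \<le> j \<Longrightarrow> j \<le> Suc k \<Longrightarrow>
    face S k i \<cdot> face S (Suc k) (Suc j) = face S k j \<cdot> face S (Suc k) i"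
  and degen_degen: "i \<le> j \<Longrightarrow> j \<le> k \<Longrightarrow>
    degen S (Suc k) i \<cdot> degen S k j = degen S (Suc k) (Suc j) \<cdot> degen S k i"
  and face_degen_less: "i \<le> j \<Longrightarrow> j \<le> k \<Longrightarrow>
    face S (Suc k) i \<cdot> degen S (Suc k) (Suc j) = degen S k j \<cdot> face S k i"
  and face_degen_eq: "j \<le> k \<Longrightarrow> face S k j \<cdot> degen S k j = idn C (sob S k)"
  and face_degen_Suc: "j \<le> k \<Longrightarrow> face S k (Suc j) \<cdot> degen S k j = idn C (sob S k)"
  and face_degen_greater: "j < i \<Longrightarrow> i \<le> Suc k \<Longrightarrow>
    face S (Suc k) (Suc i) \<cdot> degen S (Suc k) j = degen S k j \<cdot> face S k i"
  using simplicial unfolding simplicial_object_def by auto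

end

locale cochains = simplicial C S for C :: "('o, 'a) cat" (structure) and S +
  fixes A :: 'o
  assumes A: "A \<in> Ab"
begin

abbreviation H where "H k \<equiv> hom_group C (sob S k) A"

lemma H: "comm_group (H k)"
  using comm_group_hom_group A sob by blast

lemma coboundary_alt_sum:
  assumes f: "f \<in> homs C (sob S k) A"
  shows "coboundary C S A k f = alt_sum (H (Suc k)) (\<lambda>i. f \<cdot> face S k i) (Suc k)"
proof -
  interpret H: comm_group "H (Suc k)" by (rule H)
  have "f \<cdot> face S k i \<in> carrier (H (Suc k))" if "i \<le> Suc k" for i
    using comp_in[OF face f] that by simp
  from H.finprod_signed[where m = "Suc k", OF this] show ?thesis unfolding coboundary_def Let_def signed_def by simp
qed

lemma coboundary_comp:
  assumes f: "f \<in> homs C (sob S k) A" and x: "x \<in> homs C Y (sob S (Suc k))"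
  shows "coboundary C S A k f \<cdot> x = alt_sum (hom_group C Y A) (\<lambda>i. f \<cdot> (face S k i \<cdot> x)) (Suc k)"
proof -
  interpret Y: comm_group "hom_group C Y A" using comm_group_hom_group A homsD[OF x] by blast
  have "coboundary C S A k f \<cdot> x = alt_sum (hom_group C Y A) (\<lambda>i. (f \<cdot> face S k i) \<cdot> x) (Suc k)"
    unfolding coboundary_alt_sum[OF f]
    by (rule hom_alt_sum[OF precomp_group_hom[OF A x] H]) (use comp_in[OF face f] in simp)
  also have "\<dots> = alt_sum (hom_group C Y A) (\<lambda>i. f \<cdot> (face S k i \<cdot> x)) (Suc k)"
    by (rule Y.alt_sum_cong) (use comp_assoc[OF x face f] in simp)
  finally show ?thesis .
qed

lemma coboundary_in:
  assumes f: "f \<in> homs C (sob S k) A"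
  shows "coboundary C S A k f \<in> homs C (sob S (Suc k)) A"
proof -
  interpret H: comm_group "H (Suc k)" by (rule H)
  have "alt_sum (H (Suc k)) (\<lambda>i. f \<cdot> face S k i) (Suc k) \<in> carrier (H (Suc k))"
    by (rule H.alt_sum_closed) (use comp_in[OF face f] in simp)
  then show ?thesis by (simp add: coboundary_alt_sum[OF f])
qed

lemma coboundary_hom: "group_hom (H k) (H (Suc k)) (coboundary C S A k)"
proof -
  interpret H: comm_group "H k" by (rule H)
  interpret H': comm_group "H (Suc k)" by (rule H)
  show ?thesis
  proof (unfold_locales, rule homI)
    fix f g assume "f \<in> carrier (H k)" "g \<in> carrier (H k)"
    then have fg: "f \<in> homs C (sob S k) A" "g \<in> homs C (sob S k) A" by simp_all
    then have "f \<otimes>\<^bsub>H k\<^esub> g \<in> homs C (sob S k) A" using H.m_closed[of f g] by simp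
    then have "coboundary C S A k (f \<otimes>\<^bsub>H k\<^esub> g)
        = alt_sum (H (Suc k)) (\<lambda>i. (f \<otimes>\<^bsub>H k\<^esub> g) \<cdot> face S k i) (Suc k)"
      by (rule coboundary_alt_sum)
    also have "\<dots> = alt_sum (H (Suc k)) (\<lambda>i. (f \<cdot> face S k i) \<otimes>\<^bsub>H (Suc k)\<^esub> (g \<cdot> face S k i)) (Suc k)"
      by (rule H'.alt_sum_cong) (use precomp_mult[OF A fg face] in simp)
    also have "\<dots> = coboundary C S A k f \<otimes>\<^bsub>H (Suc k)\<^esub> coboundary C S A k g"
      unfolding coboundary_alt_sum[OF fg(1)] coboundary_alt_sum[OF fg(2)]
      by (rule H'.alt_sum_mult) (use comp_in[OF face] fg in auto)
    finally show "coboundary C S A k (f \<otimes>\<^bsub>H k\<^esub> g)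
        = coboundary C S A k f \<otimes>\<^bsub>H (Suc k)\<^esub> coboundary C S A k g" .
  qed (use coboundary_in in simp)
qed

lemma coboundary_coboundary:
  assumes f: "f \<in> homs C (sob S k) A"
  shows "coboundary C S A (Suc k) (coboundary C S A k f) = \<one>\<^bsub>H (Suc (Suc k))\<^esub>"
proof -
  interpret H: comm_group "H (Suc (Suc k))" by (rule H)
  let ?a = "\<lambda>i j. f \<cdot> (face S k j \<cdot> face S (Suc k) i)"
  have "coboundary C S A (Suc k) (coboundary C S A k f)
      = alt_sum (H (Suc (Suc k))) (\<lambda>i. coboundary C S A k f \<cdot> face S (Suc k) i) (Suc (Suc k))"
    by (rule coboundary_alt_sum[OF coboundary_in[OF f]])
  also have "\<dots> = alt_sum (H (Suc (Suc k))) (\<lambda>i. alt_sum (H (Suc (Suc k))) (?a i) (Suc k)) (Suc (Suc k))"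
    by (rule H.alt_sum_cong) (use coboundary_comp[OF f face] in simp)
  also have "\<dots> = \<one>\<^bsub>H (Suc (Suc k))\<^esub>"
  proof (rule H.alt_sum_square)
    show "?a i j \<in> carrier (H (Suc (Suc k)))" if "i \<le> Suc (Suc k)" "j \<le> Suc k" for i j
      using comp_in[OF comp_in[OF face face] f] that by simp
    show "?a (Suc j) i = ?a i j" if "i \<le> j" "j \<le> Suc k" for i j
      using face_face that by simp
  qed
  finally show ?thesis .
qed

text \<open>The counter \<open>j\<close> lets normalisation proceed one degeneracy at a time;
  \<open>j = Suc k\<close> exhausts the degeneracies into degree \<open>Suc k\<close>. Degree 0
  receives none and is not covered.\<close>

definition normalized :: "nat \<Rightarrow> nat \<Rightarrow> 'a \<Rightarrow> bool" where
  "normalized k j f \<longleftrightarrow> f \<in> homs C (sob S (Suc k)) A \<and>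
     (\<forall>i < j. f \<cdot> degen S k i = \<one>\<^bsub>H k\<^esub>)"

lemma comp_degen_one:
  assumes f: "f \<in> homs C (sob S (Suc k)) A" and i: "i \<le> k" "f \<cdot> degen S k i = \<one>\<^bsub>H k\<^esub>"
    and x: "x \<in> homs C Y (sob S k)"
  shows "f \<cdot> (degen S k i \<cdot> x) = \<one>\<^bsub>hom_group C Y A\<^esub>"
  using comp_assoc[OF x degen[OF i(1)] f] i(2) one_comp[OF A x] by simp

text \<open>Evaluated on the degeneracy \<open>l\<close>, the faces \<open>l\<close> and
  \<open>Suc l\<close> contribute equal terms of opposite sign; every other face moves past the
  degeneracy and leaves one that \<open>f\<close> kills.\<close>

lemma coboundary_normalized:
  assumes f: "normalized k (Suc k) f"
  shows "normalized (Suc k) (Suc (Suc k)) (coboundary C S A (Suc k) f)"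
  unfolding normalized_def
proof (intro conjI allI impI)
  have fin: "f \<in> homs C (sob S (Suc k)) A" and f0: "\<And>i. i \<le> k \<Longrightarrow> f \<cdot> degen S k i = \<one>\<^bsub>H k\<^esub>"
    using f by (auto simp: normalized_def)
  show "coboundary C S A (Suc k) f \<in> homs C (sob S (Suc (Suc k))) A" using coboundary_in[OF fin] .
  fix l assume "l < Suc (Suc k)"
  then have l: "l \<le> Suc k" by simp
  interpret H: comm_group "H (Suc k)" by (rule H)
  let ?t = "\<lambda>i. f \<cdot> (face S (Suc k) i \<cdot> degen S (Suc k) l)"
  have "coboundary C S A (Suc k) f \<cdot> degen S (Suc k) l = alt_sum (H (Suc k)) ?t (Suc (Suc k))"
    by (rule coboundary_comp[OF fin degen[OF l]])
  also have "\<dots> = \<one>\<^bsub>H (Suc k)\<^esub>"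
  proof (rule H.alt_sum_two[of _ l])
    show "?t (Suc l) = ?t l" using face_degen_eq[OF l] face_degen_Suc[OF l] by simp
    show "?t l \<in> carrier (H (Suc k))" using comp_in[OF comp_in[OF degen[OF l] face] fin] l by simp
    show "l < Suc (Suc k)" using l by simp
    fix i assume i: "i \<le> Suc (Suc k)" "i \<noteq> l" "i \<noteq> Suc l"
    show "?t i = \<one>\<^bsub>H (Suc k)\<^esub>"
    proof (cases "i < l")
      case True
      then obtain l' where l': "l = Suc l'" by (cases l) auto
      then show ?thesis
        using True l face_degen_less[of i l' k] comp_degen_one[OF fin _ f0 face] by simp
    next
      case False
      then obtain i' where i': "i = Suc i'" "l < i'" using i by (cases i) auto
      then show ?thesis
        using i face_degen_greater[of l i' k] comp_degen_one[OF fin _ f0 face] by simp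
    qed
  qed
  finally show "coboundary C S A (Suc k) f \<cdot> degen S (Suc k) l = \<one>\<^bsub>H (Suc k)\<^esub>" .
qed

text \<open>For a cocycle \<open>f\<close>, all but the first \<open>j + 1\<close> terms of \<open>\<delta> (f \<cdot> s\<^sub>j)\<close> cancel; therefore
  subtracting \<open>(-1)\<^sup>j \<delta> (f \<cdot> s\<^sub>j)\<close> makes \<open>f\<close> vanish on one more degeneracy.\<close>

lemma normalize_step:
  assumes f: "normalized k j f" and j: "j \<le> k"
    and cocycle: "coboundary C S A (Suc k) f = \<one>\<^bsub>H (Suc (Suc k))\<^esub>"
  defines "u \<equiv> signed (H k) j (f \<cdot> degen S k j)"
  shows "normalized k (Suc j) (f \<otimes>\<^bsub>H (Suc k)\<^esub> inv\<^bsub>H (Suc k)\<^esub> coboundary C S A k u)"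
proof -
  interpret Hk: comm_group "H k" by (rule H)
  interpret H: comm_group "H (Suc k)" by (rule H)
  interpret \<delta>: group_hom "H k" "H (Suc k)" "coboundary C S A k" by (rule coboundary_hom)
  have fin: "f \<in> homs C (sob S (Suc k)) A" and f0: "\<And>i. i < j \<Longrightarrow> f \<cdot> degen S k i = \<one>\<^bsub>H k\<^esub>"
    using f by (auto simp: normalized_def)
  have g: "f \<cdot> degen S k j \<in> homs C (sob S k) A" using comp_in[OF degen[OF j] fin] .
  let ?t = "\<lambda>i. (f \<cdot> degen S k j) \<cdot> face S k i"
  let ?s = "\<lambda>i. f \<cdot> (face S (Suc k) i \<cdot> degen S (Suc k) j)"
  have t: "?t i \<in> carrier (H (Suc k))" if "i \<le> Suc k" for i using comp_in[OF face[OF that] g] by simp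
  have j': "j \<le> Suc k" using j by simp
  \<comment> \<open>The cocycle condition is evaluated on the degeneracy \<open>j\<close>:
    \<open>?s\<close> lists its terms, \<open>?t\<close> those of the coboundary of
    \<open>f \<cdot> degen S k j\<close>.\<close>
  have "alt_sum (H (Suc k)) ?s (Suc (Suc k)) = coboundary C S A (Suc k) f \<cdot> degen S (Suc k) j"
    using coboundary_comp[OF fin degen[OF j']] by simp
  also have "\<dots> = \<one>\<^bsub>H (Suc k)\<^esub>" using cocycle one_comp[OF A degen[OF j']] by simp
  finally have s1: "alt_sum (H (Suc k)) ?s (Suc (Suc k)) = \<one>\<^bsub>H (Suc k)\<^esub>" .
  have "alt_sum (H (Suc k)) ?s (Suc (Suc k)) \<otimes>\<^bsub>H (Suc k)\<^esub> alt_sum (H (Suc k)) ?t (Suc k)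
      = alt_sum (H (Suc k)) ?t j"
  proof (rule H.alt_sum_shift)
    show "?s (Suc j) = ?s j" using face_degen_eq[OF j'] face_degen_Suc[OF j'] by simp
    show "?s j \<in> carrier (H (Suc k))" using comp_in[OF comp_in[OF degen[OF j'] face] fin] j by simp
    show "?s i = \<one>\<^bsub>H (Suc k)\<^esub>" if ij: "i < j" for i
    proof -
      obtain j0 where j0: "j = Suc j0" using ij by (cases j) auto
      then show ?thesis
        using ij j face_degen_less[of i j0 k] comp_degen_one[OF fin _ f0 face] by simp
    qed
    show "?s (Suc i) = ?t i" if "j < i" "i \<le> Suc k" for i
      using that face_degen_greater[of j i k] comp_assoc[OF face degen[OF j] fin] by simp
  qed (use t j in auto)
  then have du: "coboundary C S A k (f \<cdot> degen S k j) = alt_sum (H (Suc k)) ?t j"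
    unfolding s1 coboundary_alt_sum[OF g] using H.l_one[OF H.alt_sum_closed[OF t], of "Suc k" "\<lambda>i. i"] by simp
  have uin: "u \<in> homs C (sob S k) A" using Hk.signed_closed[of "f \<cdot> degen S k j" j] g unfolding u_def by simp
  have dui: "coboundary C S A k u \<in> homs C (sob S (Suc k)) A" using coboundary_in[OF uin] .
  have du_degen: "coboundary C S A k u \<cdot> degen S k l
      = signed (H k) j (alt_sum (H k) (\<lambda>i. f \<cdot> (degen S k j \<cdot> (face S k i \<cdot> degen S k l))) j)"
    if l: "l \<le> k" for l
  proof -
    interpret p: group_hom "H (Suc k)" "H k" "\<lambda>f. f \<cdot> degen S k l"
      by (rule precomp_group_hom[OF A degen[OF l]])
    have "coboundary C S A k u \<cdot> degen S k l = signed (H k) j (alt_sum (H (Suc k)) ?t j \<cdot> degen S k l)"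
      unfolding u_def using \<delta>.hom_signed[of "f \<cdot> degen S k j" j] g du
        p.hom_signed[of "alt_sum (H (Suc k)) ?t j" j] H.alt_sum_closed[of j ?t] t j by simp
    also have "alt_sum (H (Suc k)) ?t j \<cdot> degen S k l = alt_sum (H k) (\<lambda>i. ?t i \<cdot> degen S k l) j"
      by (rule hom_alt_sum[OF p.group_hom_axioms H]) (use t j in auto)
    also have "\<dots> = alt_sum (H k) (\<lambda>i. f \<cdot> (degen S k j \<cdot> (face S k i \<cdot> degen S k l))) j"
    proof (rule Hk.alt_sum_cong)
      fix i assume "i \<le> j"
      then have i: "i \<le> Suc k" using j by simp
      show "?t i \<cdot> degen S k l = f \<cdot> (degen S k j \<cdot> (face S k i \<cdot> degen S k l))"
        using comp_assoc[OF degen[OF l] face[OF i] g]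
          comp_assoc[OF comp_in[OF degen[OF l] face[OF i]] degen[OF j] fin] by simp
    qed
    finally show ?thesis .
  qed
  \<comment> \<open>For \<open>l < j\<close> the two degeneracies can be exchanged so that
    \<open>degen S k l\<close> stands directly next to \<open>f\<close>, which kills it.\<close>
  have dd: "f \<cdot> (degen S k j \<cdot> (degen S k' l \<cdot> x)) = \<one>\<^bsub>hom_group C Y A\<^esub>"
    if k': "k = Suc k'" and l: "l < j" and x: "x \<in> homs C Y (sob S k')" for l x k' Y
  proof -
    obtain j0 where j0: "j = Suc j0" using l by (cases j) auto
    have lj: "l \<le> j0" "j0 \<le> k'" using l j j0 k' by auto
    have d1: "degen S k' l \<in> homs C (sob S k') (sob S k)" "degen S k' j0 \<in> homs C (sob S k') (sob S k)"
      using degen lj k' by auto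
    have d2: "degen S k j \<in> homs C (sob S k) (sob S (Suc k))" "degen S k l \<in> homs C (sob S k) (sob S (Suc k))"
      using degen j l by auto
    have "degen S k j \<cdot> (degen S k' l \<cdot> x) = degen S k l \<cdot> (degen S k' j0 \<cdot> x)"
      using degen_degen[OF lj] comp_assoc[OF x d1(1) d2(1)] comp_assoc[OF x d1(2) d2(2)] k' j0 by simp
    then show ?thesis
      using comp_degen_one[OF fin _ f0[OF l] comp_in[OF x d1(2)]] l j by simp
  qed
  \<comment> \<open>For \<open>l = j\<close> only the term with index \<open>j\<close> survives, and
    the sign built into \<open>u\<close> turns it into \<open>f \<cdot> degen S k j\<close>. For
    \<open>l < j\<close> both sides vanish, so the vanishing already achieved is not lost.\<close>
  have key: "coboundary C S A k u \<cdot> degen S k l = f \<cdot> degen S k l" if l: "l \<le> j" for l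
  proof -
    let ?r = "\<lambda>i. f \<cdot> (degen S k j \<cdot> (face S k i \<cdot> degen S k l))"
    have lk: "l \<le> k" using l j by simp
    have rl: "?r l = f \<cdot> degen S k j" "?r (Suc l) = f \<cdot> degen S k j"
      using face_degen_eq[OF lk] face_degen_Suc[OF lk] comp_idn[OF degen[OF j]] by auto
    have r0: "?r i = \<one>\<^bsub>H k\<^esub>" if il: "i < l" for i
    proof -
      obtain l' k' where l': "l = Suc l'" "k = Suc k'" using il lk by (cases l; cases k) auto
      then show ?thesis
        using il l lk face_degen_less[of i l' k'] dd[OF l'(2) _ face] by simp
    qed
    show ?thesis
    proof (cases "l = j")
      case True
      have "alt_sum (H k) ?r j = signed (H k) j (?r j)"
        by (rule Hk.alt_sum_last) (use r0 True rl g in auto)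
      then show ?thesis using du_degen[OF lk] True rl g by simp
    next
      case False
      then have lj: "l < j" using l by simp
      have "alt_sum (H k) ?r j = \<one>\<^bsub>H k\<^esub>"
      proof (rule Hk.alt_sum_two[of _ l])
        fix i assume i: "i \<le> j" "i \<noteq> l" "i \<noteq> Suc l"
        show "?r i = \<one>\<^bsub>H k\<^esub>"
        proof (cases "i < l")
          case False
          then obtain i' k' where i': "i = Suc i'" "l < i'" "k = Suc k'" using i j by (cases i; cases k) auto
          then show ?thesis
            using i j lj face_degen_greater[of l i' k'] dd[OF i'(3) lj face] by simp
        qed (rule r0)
      qed (use rl lj g in auto)
      then show ?thesis using du_degen[OF lk] f0[OF lj] by simp
    qed
  qed
  show ?thesis
    unfolding normalized_def
  proof (intro conjI allI impI)
    show "f \<otimes>\<^bsub>H (Suc k)\<^esub> inv\<^bsub>H (Suc k)\<^esub> coboundary C S A k u \<in> homs C (sob S (Suc k)) A"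
      using H.m_closed[of f] H.inv_closed[of "coboundary C S A k u"] fin dui by simp
    fix l assume "l < Suc j"
    then have l: "l \<le> j" "l \<le> k" using j by auto
    interpret p: group_hom "H (Suc k)" "H k" "\<lambda>f. f \<cdot> degen S k l"
      by (rule precomp_group_hom[OF A degen[OF l(2)]])
    show "f \<otimes>\<^bsub>H (Suc k)\<^esub> inv\<^bsub>H (Suc k)\<^esub> coboundary C S A k u \<cdot> degen S k l = \<one>\<^bsub>H k\<^esub>"
      using p.hom_mult[of f "inv\<^bsub>H (Suc k)\<^esub> coboundary C S A k u"] p.hom_inv[of "coboundary C S A k u"]
        H.inv_closed[of "coboundary C S A k u"] fin dui key[OF l(1)]
        Hk.r_inv[of "f \<cdot> degen S k l"] comp_in[OF degen[OF l(2)] fin] by simp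
  qed
qed

text \<open>Each step changes the cocycle by a coboundary, so it stays a cocycle and the next step
  applies; as \<open>coboundary\<close> is a homomorphism, the corrections add up to that of a
  single \<open>u\<close>.\<close>

lemma ex_normalized:
  assumes f: "f \<in> homs C (sob S (Suc k)) A"
    and cocycle: "coboundary C S A (Suc k) f = \<one>\<^bsub>H (Suc (Suc k))\<^esub>"
  shows "\<exists>u \<in> homs C (sob S k) A.
    normalized k (Suc k) (f \<otimes>\<^bsub>H (Suc k)\<^esub> inv\<^bsub>H (Suc k)\<^esub> coboundary C S A k u)"
proof -
  interpret Hk: comm_group "H k" by (rule H)
  interpret H: comm_group "H (Suc k)" by (rule H)
  interpret H2: comm_group "H (Suc (Suc k))" by (rule H)
  interpret \<delta>: group_hom "H k" "H (Suc k)" "coboundary C S A k" by (rule coboundary_hom)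
  interpret \<delta>2: group_hom "H (Suc k)" "H (Suc (Suc k))" "coboundary C S A (Suc k)" by (rule coboundary_hom)
  have "\<exists>u \<in> homs C (sob S k) A.
      normalized k j (f \<otimes>\<^bsub>H (Suc k)\<^esub> inv\<^bsub>H (Suc k)\<^esub> coboundary C S A k u)" if "j \<le> Suc k" for j
    using that
  proof (induction j)
    case 0
    have "coboundary C S A k \<one>\<^bsub>H k\<^esub> = \<one>\<^bsub>H (Suc k)\<^esub>" by simp
    then show ?case using f H.r_one[of f] Hk.one_closed
      by (intro bexI[of _ "\<one>\<^bsub>H k\<^esub>"]) (simp_all add: normalized_def)
  next
    case (Suc j)
    then obtain u where u: "u \<in> homs C (sob S k) A"
      and n: "normalized k j (f \<otimes>\<^bsub>H (Suc k)\<^esub> inv\<^bsub>H (Suc k)\<^esub> coboundary C S A k u)" by auto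
    let ?f = "f \<otimes>\<^bsub>H (Suc k)\<^esub> inv\<^bsub>H (Suc k)\<^esub> coboundary C S A k u"
    have du: "coboundary C S A k u \<in> carrier (H (Suc k))" using coboundary_in[OF u] by simp
    have fc: "f \<in> carrier (H (Suc k))" using f by simp
    then have "coboundary C S A (Suc k) ?f = \<one>\<^bsub>H (Suc (Suc k))\<^esub>"
      using du cocycle coboundary_coboundary[OF u] by (simp del: carrier_hom_group)
    from normalize_step[OF n _ this] Suc.prems obtain v where v: "v = signed (H k) j (?f \<cdot> degen S k j)"
      "normalized k (Suc j) (?f \<otimes>\<^bsub>H (Suc k)\<^esub> inv\<^bsub>H (Suc k)\<^esub> coboundary C S A k v)" by auto
    have "?f \<cdot> degen S k j \<in> homs C (sob S k) A"
      using n Suc.prems degen unfolding normalized_def by auto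
    then have vin: "v \<in> homs C (sob S k) A"
      using Hk.signed_closed[of "?f \<cdot> degen S k j" j] unfolding v(1) by simp
    then have dv: "coboundary C S A k v \<in> carrier (H (Suc k))" using coboundary_in by simp
    have "u \<in> carrier (H k)" "v \<in> carrier (H k)" "f \<in> carrier (H (Suc k))" using u vin f by simp_all
    then have "?f \<otimes>\<^bsub>H (Suc k)\<^esub> inv\<^bsub>H (Suc k)\<^esub> coboundary C S A k v
        = f \<otimes>\<^bsub>H (Suc k)\<^esub> inv\<^bsub>H (Suc k)\<^esub> coboundary C S A k (u \<otimes>\<^bsub>H k\<^esub> v)"
      using du dv by (simp add: H.m_assoc H.inv_mult del: carrier_hom_group)
    moreover have "u \<otimes>\<^bsub>H k\<^esub> v \<in> homs C (sob S k) A" using Hk.m_closed[of u v] u vin by simp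
    ultimately show ?case using v(2) by metis
  qed
  then show ?thesis by blast
qed

end

section \<open>Images and cokernels\<close>

context semiabelian_category
begin

lemma regular: "regular_category C"
  using semiabelian by (simp add: semiabelian_def barr_exact_def)

lemma regular_epiE:
  assumes "regular_epi C e" "e \<in> homs C A B"
  obtains f g K where "f \<in> homs C K A" "g \<in> homs C K A" "e \<cdot> f = e \<cdot> g"
    "\<And>D h. h \<in> homs C A D \<Longrightarrow> h \<cdot> f = h \<cdot> g \<Longrightarrow> \<exists>!u. u \<in> homs C B D \<and> u \<cdot> e = h"
proof -
  obtain f g where fg: "is_coequalizer C f g e" using assms(1) by (auto simp: regular_epi_def)
  show ?thesis
  proof (rule that[of f "src C f" g])
    show "f \<in> homs C (src C f) A" "g \<in> homs C (src C f) A" "e \<cdot> f = e \<cdot> g"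
      using fg homsD[OF assms(2)] by (auto simp: is_coequalizer_def homs_def)
    fix D h assume h: "h \<in> homs C A D" and eq: "h \<cdot> f = h \<cdot> g"
    have "\<forall>h \<in> arr C. src C h = tgt C f \<and> h \<cdot> f = h \<cdot> g \<longrightarrow>
        (\<exists>!u. u \<in> homs C (tgt C e) (tgt C h) \<and> u \<cdot> e = h)" and "tgt C f = A"
      using fg homsD[OF assms(2)] by (auto simp: is_coequalizer_def)
    from this(1)[rule_format, OF homsD(1)[OF h]] this(2) show "\<exists>!u. u \<in> homs C B D \<and> u \<cdot> e = h"
      using homsD[OF h] homsD[OF assms(2)] eq by simp
  qed
qed

lemma regular_epi_cancel:
  assumes e: "regular_epi C e" "e \<in> homs C A B"
    and u: "u \<in> homs C B D" and v: "v \<in> homs C B D" and eq: "u \<cdot> e = v \<cdot> e"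
  shows "u = v"
proof -
  obtain f g K where K: "f \<in> homs C K A" "g \<in> homs C K A" "e \<cdot> f = e \<cdot> g"
    "\<And>D h. h \<in> homs C A D \<Longrightarrow> h \<cdot> f = h \<cdot> g \<Longrightarrow> \<exists>!u. u \<in> homs C B D \<and> u \<cdot> e = h"
    by (rule regular_epiE[OF e]) blast
  have "(u \<cdot> e) \<cdot> f = (u \<cdot> e) \<cdot> g"
    using comp_assoc[OF K(1) e(2) u] comp_assoc[OF K(2) e(2) u] K(3) by simp
  from K(4)[OF comp_in[OF e(2) u] this] show ?thesis using u v eq by metis
qed

definition monic :: "'a \<Rightarrow> 'o \<Rightarrow> 'o \<Rightarrow> bool" where
  "monic m I D \<longleftrightarrow> m \<in> homs C I D \<and>
     (\<forall>X u v. u \<in> homs C X I \<and> v \<in> homs C X I \<and> m \<cdot> u = m \<cdot> v \<longrightarrow> u = v)"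

lemma monicD:
  assumes "monic m I D"
  shows "m \<in> homs C I D"
    "u \<in> homs C X I \<Longrightarrow> v \<in> homs C X I \<Longrightarrow> m \<cdot> u = m \<cdot> v \<Longrightarrow> u = v"
  using assms unfolding monic_def by blast+

text \<open>Regular epimorphisms are orthogonal to monomorphisms: since \<open>m\<close> is monic,
  \<open>y\<close> identifies the pair whose coequaliser is \<open>e\<close>, and so descends along
  \<open>e\<close>.\<close>

lemma regular_epi_factor:
  assumes e: "regular_epi C e" "e \<in> homs C A B" and m: "monic m I D"
    and y: "y \<in> homs C A I" and x: "x \<in> homs C B D" and eq: "x \<cdot> e = m \<cdot> y"
  obtains w where "w \<in> homs C B I" "m \<cdot> w = x"
proof -
  note mi = monicD(1)[OF m]
  obtain f g K where K: "f \<in> homs C K A" "g \<in> homs C K A" "e \<cdot> f = e \<cdot> g"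
    "\<And>D h. h \<in> homs C A D \<Longrightarrow> h \<cdot> f = h \<cdot> g \<Longrightarrow> \<exists>!u. u \<in> homs C B D \<and> u \<cdot> e = h"
    by (rule regular_epiE[OF e]) blast
  have "m \<cdot> (y \<cdot> f) = m \<cdot> (y \<cdot> g)"
    using comp_assoc[OF K(1) y mi] comp_assoc[OF K(2) y mi] eq K(3)
      comp_assoc[OF K(1) e(2) x] comp_assoc[OF K(2) e(2) x] by simp
  then have "y \<cdot> f = y \<cdot> g" using monicD(2)[OF m comp_in[OF K(1) y] comp_in[OF K(2) y]] by blast
  from K(4)[OF y this] obtain w where w: "w \<in> homs C B I" "w \<cdot> e = y" by auto
  have "m \<cdot> w = x"
    using regular_epi_cancel[OF e comp_in[OF w(1) mi] x] comp_assoc[OF e(2) w(1) mi] w(2) eq by simp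
  with w show ?thesis using that by blast
qed

text \<open>Generalised elements of \<open>B\<close> lift along \<open>e\<close> after passing to a
  cover \<open>q\<close>. This replaces the choice of preimages in the next proofs.\<close>

lemma regular_epi_pullback:
  assumes e: "regular_epi C e" "e \<in> homs C A B" and x: "x \<in> homs C X B"
  obtains Q p q where "regular_epi C q" "p \<in> homs C Q A" "q \<in> homs C Q X" "e \<cdot> p = x \<cdot> q"
proof -
  obtain Q p q where pb: "is_pullback C e x Q p q" using ex_pullback[OF e(2) x] .
  moreover have "regular_epi C q" using regular e(1) pb unfolding regular_category_def by blast
  ultimately show ?thesis using that pullbackD(1-3)[OF pb e(2) x] by blast
qed

lemma ex_image:
  assumes b: "b \<in> homs C N Z"
  obtains I e m where "e \<in> homs C N I" "regular_epi C e" "monic m I Z" "m \<cdot> e = b"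
proof -
  obtain Q p q where pb: "is_pullback C b b Q p q" using ex_pullback[OF b b] .
  note pq = pullbackD[OF pb b b]
  obtain e where e: "is_coequalizer C p q e" using regular pb unfolding regular_category_def by blast
  define I where "I = tgt C e"
  have ein: "e \<in> homs C N I" "e \<cdot> p = e \<cdot> q"
    using e homsD[OF pq(1)] unfolding I_def is_coequalizer_def homs_def by auto
  have ree: "regular_epi C e" using e by (auto simp: regular_epi_def)
  have "\<forall>h \<in> arr C. src C h = tgt C p \<and> h \<cdot> p = h \<cdot> q \<longrightarrow>
      (\<exists>!u. u \<in> homs C I (tgt C h) \<and> u \<cdot> e = h)"
    using e unfolding is_coequalizer_def I_def by blast
  from this[rule_format, OF homsD(1)[OF b]] have "\<exists>!u. u \<in> homs C I Z \<and> u \<cdot> e = b"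
    using homsD[OF b] homsD[OF pq(1)] pq(3) by simp
  then obtain m where m: "m \<in> homs C I Z" "m \<cdot> e = b" by auto
  have "monic m I Z"
    unfolding monic_def
  proof (intro conjI allI impI m(1))
    fix X u v assume "u \<in> homs C X I \<and> v \<in> homs C X I \<and> m \<cdot> u = m \<cdot> v"
    then have u: "u \<in> homs C X I" and v: "v \<in> homs C X I" and eq: "m \<cdot> u = m \<cdot> v" by auto
    \<comment> \<open>Lift \<open>u\<close> and \<open>v\<close> to \<open>N\<close> over a common
      cover. The lifts agree under \<open>b\<close>, hence factor through its kernel pair and are
      identified by \<open>e\<close>; the cover is then cancelled in two stages.\<close>
    obtain Q1 p1 q1 where 1: "regular_epi C q1" "p1 \<in> homs C Q1 N" "q1 \<in> homs C Q1 X" "e \<cdot> p1 = u \<cdot> q1"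
      using regular_epi_pullback[OF ree ein(1) u] by metis
    have vq: "v \<cdot> q1 \<in> homs C Q1 I" using 1 v by blast
    obtain Q2 p2 q2 where 2: "regular_epi C q2" "p2 \<in> homs C Q2 N" "q2 \<in> homs C Q2 Q1" "e \<cdot> p2 = (v \<cdot> q1) \<cdot> q2"
      using regular_epi_pullback[OF ree ein(1) vq] by metis
    have pq2: "p1 \<cdot> q2 \<in> homs C Q2 N" using 1 2 by blast
    have l: "e \<cdot> (p1 \<cdot> q2) = (u \<cdot> q1) \<cdot> q2" using comp_assoc[OF 2(3) 1(2) ein(1)] 1(4) by simp
    have mm: "m \<cdot> ((u \<cdot> q1) \<cdot> q2) = m \<cdot> ((v \<cdot> q1) \<cdot> q2)"
      using comp_assoc[OF 2(3) 1(3) u] comp_assoc[OF 2(3) 1(3) v] eq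
        comp_assoc[OF comp_in[OF 2(3) 1(3)] u m(1)] comp_assoc[OF comp_in[OF 2(3) 1(3)] v m(1)] by simp
    have "b \<cdot> (p1 \<cdot> q2) = b \<cdot> p2"
      using mm l 2(4) comp_assoc[OF pq2 ein(1) m(1)] comp_assoc[OF 2(2) ein(1) m(1)] m(2) by simp
    then obtain c where c: "c \<in> homs C Q2 Q" "p \<cdot> c = p1 \<cdot> q2" "q \<cdot> c = p2"
      using pq(4)[OF pq2 2(2)] by auto
    have "e \<cdot> (p1 \<cdot> q2) = e \<cdot> p2"
      using c comp_assoc[OF c(1) pq(1) ein(1)] comp_assoc[OF c(1) pq(2) ein(1)] ein(2) by simp
    then have "(u \<cdot> q1) \<cdot> q2 = (v \<cdot> q1) \<cdot> q2" using l 2(4) by simp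
    then have "u \<cdot> q1 = v \<cdot> q1"
      using regular_epi_cancel[OF 2(1,3) comp_in[OF 1(3) u] vq] by blast
    then show "u = v" using regular_epi_cancel[OF 1(1,3) u v] by blast
  qed
  with ein ree m show ?thesis using that by blast
qed

text \<open>No group structure on \<open>I\<close> is at hand. Over a cover both elements come from
  \<open>N\<close>, where they can be subtracted; the difference then descends along the two covers
  because \<open>m\<close> is monic.\<close>

lemma image_diff:
  assumes N: "N \<in> Ab" and Z: "Z \<in> Ab" and e: "e \<in> homs C N I" "regular_epi C e"
    and m: "monic m I Z" and i: "i \<in> homs C X I" and j: "j \<in> homs C X I"
  obtains k where "k \<in> homs C X I"
    "m \<cdot> k = (m \<cdot> i) \<otimes>\<^bsub>hom_group C X Z\<^esub> inv\<^bsub>hom_group C X Z\<^esub> (m \<cdot> j)"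
proof -
  note mi = monicD(1)[OF m]
  have b: "m \<cdot> e \<in> homs C N Z" using e mi by blast
  obtain Q1 p1 q1 where 1: "regular_epi C q1" "p1 \<in> homs C Q1 N" "q1 \<in> homs C Q1 X" "e \<cdot> p1 = i \<cdot> q1"
    using regular_epi_pullback[OF e(2,1) i] by metis
  have jq: "j \<cdot> q1 \<in> homs C Q1 I" using 1 j by blast
  obtain Q2 p2 q2 where 2: "regular_epi C q2" "p2 \<in> homs C Q2 N" "q2 \<in> homs C Q2 Q1" "e \<cdot> p2 = (j \<cdot> q1) \<cdot> q2"
    using regular_epi_pullback[OF e(2,1) jq] by metis
  have pq2: "p1 \<cdot> q2 \<in> homs C Q2 N" and q12: "q1 \<cdot> q2 \<in> homs C Q2 X" using 1 2 by blast+
  interpret X: comm_group "hom_group C X Z" using comm_group_hom_group Z homsD[OF i] by blast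
  interpret Q: comm_group "hom_group C Q2 N" using comm_group_hom_group N homsD[OF pq2] by blast
  interpret p: group_hom "hom_group C X Z" "hom_group C Q2 Z" "\<lambda>f. f \<cdot> (q1 \<cdot> q2)"
    by (rule precomp_group_hom[OF Z q12])
  interpret c: group_hom "hom_group C Q2 N" "hom_group C Q2 Z" "\<lambda>f. (m \<cdot> e) \<cdot> f"
    by (rule postcomp_group_hom[OF N Z b homsD(4)[OF pq2]])
  define d where "d = (m \<cdot> i) \<otimes>\<^bsub>hom_group C X Z\<^esub> inv\<^bsub>hom_group C X Z\<^esub> (m \<cdot> j)"
  define y where "y = (p1 \<cdot> q2) \<otimes>\<^bsub>hom_group C Q2 N\<^esub> inv\<^bsub>hom_group C Q2 N\<^esub> p2"
  have mij: "m \<cdot> i \<in> carrier (hom_group C X Z)" "m \<cdot> j \<in> carrier (hom_group C X Z)" using mi i j by auto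
  have pp: "p1 \<cdot> q2 \<in> carrier (hom_group C Q2 N)" "p2 \<in> carrier (hom_group C Q2 N)" using pq2 2 by auto
  have "d \<in> carrier (hom_group C X Z)" unfolding d_def using mij by (simp del: carrier_hom_group)
  then have d: "d \<in> homs C X Z" by simp
  have "y \<in> carrier (hom_group C Q2 N)" unfolding y_def using pp by (simp del: carrier_hom_group)
  then have y: "y \<in> homs C Q2 N" by simp
  have 3: "(m \<cdot> i) \<cdot> (q1 \<cdot> q2) = (m \<cdot> e) \<cdot> (p1 \<cdot> q2)"
    using comp_assoc[OF q12 i mi] comp_assoc[OF pq2 e(1) mi] comp_assoc[OF 2(3) 1(3) i]
      comp_assoc[OF 2(3) 1(2) e(1)] 1(4) by simp
  have 4: "(m \<cdot> j) \<cdot> (q1 \<cdot> q2) = (m \<cdot> e) \<cdot> p2"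
    using comp_assoc[OF q12 j mi] comp_assoc[OF 2(2) e(1) mi] comp_assoc[OF 2(3) 1(3) j] 2(4) by simp
  have "d \<cdot> (q1 \<cdot> q2) = (m \<cdot> e) \<cdot> y"
    unfolding d_def y_def using mij pp 3 4 by (simp del: carrier_hom_group)
  then have "(d \<cdot> q1) \<cdot> q2 = m \<cdot> (e \<cdot> y)"
    using comp_assoc[OF 2(3) 1(3) d] comp_assoc[OF y e(1) mi] by simp
  then obtain w where w: "w \<in> homs C Q1 I" "m \<cdot> w = d \<cdot> q1"
    by (rule regular_epi_factor[OF 2(1,3) m comp_in[OF y e(1)] comp_in[OF 1(3) d]])
  obtain k where "k \<in> homs C X I" "m \<cdot> k = d"
    by (rule regular_epi_factor[OF 1(1,3) m w(1) d w(2)[symmetric]])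
  then show ?thesis using that unfolding d_def by blast
qed

lemma cokernelD:
  assumes "is_cokernel C b L q" "b \<in> homs C N Z"
  shows "q \<in> homs C Z L" "zero_arrow C (q \<cdot> b)"
    and "a \<in> homs C Z X \<Longrightarrow> zero_arrow C (a \<cdot> b) \<Longrightarrow> \<exists>!u. u \<in> homs C L X \<and> u \<cdot> q = a"
  using assms(1) homsD[OF assms(2)] homsD(5)[of a Z X] by (simp_all add: is_cokernel_def)

lemma product_lift:
  assumes "is_product C A B Q p q" "f \<in> homs C X A" "g \<in> homs C X B"
  obtains u where "u \<in> homs C X Q" "p \<cdot> u = f" "q \<cdot> u = g"
  using product_pairing[OF assms] that by blast

text \<open>The image \<open>I\<close> of \<open>b\<close> induces the congruence \<open>{(x, y) | y - x \<in> I}\<close> on \<open>Z\<close>.  By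
  exactness it is the kernel pair of some \<open>f\<close>; as \<open>f\<close> factors through the cokernel of
  \<open>b\<close>, it is zero, so the congruence is total and \<open>I = Z\<close>.\<close>

lemma zero_cokernel_lift:
  assumes N: "N \<in> Ab" and Z: "Z \<in> Ab" and b: "b \<in> homs C N Z"
    and coker: "is_cokernel C b L q" and L: "zero_object C L"
    and Q: "projective_object C Q" and x: "x \<in> homs C Q Z"
  obtains y where "y \<in> homs C Q N" "b \<cdot> y = x"
proof -
  obtain I e m where e: "e \<in> homs C N I" "regular_epi C e" and m: "monic m I Z" and me: "m \<cdot> e = b"
    using ex_image[OF b] by metis
  note mi = monicD(1)[OF m]
  have oZ: "Z \<in> obj C" and oI: "I \<in> obj C" using homsD[OF mi] by auto
  let ?Q = "sq (ab_str C Z)" and ?p = "prj1 (ab_str C Z)" and ?q = "prj2 (ab_str C Z)"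
  have prod: "is_product C Z Z ?Q ?p ?q" using ab_product[OF Z] .
  then have pq: "?p \<in> homs C ?Q Z" "?q \<in> homs C ?Q Z" and oQ: "?Q \<in> obj C" by (auto simp: is_product_def)
  \<comment> \<open>The second projection minus the first. The pullback of \<open>d\<close> along
    \<open>m\<close> consists of the pairs whose difference lies in \<open>I\<close>;
    \<open>r\<close> and \<open>s\<close> will be its two components.\<close>
  define d where "d = ?q \<otimes>\<^bsub>hom_group C ?Q Z\<^esub> inv\<^bsub>hom_group C ?Q Z\<^esub> ?p"
  have pqc: "?p \<in> carrier (hom_group C ?Q Z)" "?q \<in> carrier (hom_group C ?Q Z)" using pq by auto
  interpret GQ: comm_group "hom_group C ?Q Z" by (rule comm_group_hom_group[OF Z oQ])
  have "d \<in> carrier (hom_group C ?Q Z)" unfolding d_def using pqc by (simp del: carrier_hom_group)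
  then have d: "d \<in> homs C ?Q Z" by simp
  have dx: "d \<cdot> w = (?q \<cdot> w) \<otimes>\<^bsub>hom_group C X Z\<^esub> inv\<^bsub>hom_group C X Z\<^esub> (?p \<cdot> w)" if w: "w \<in> homs C X ?Q" for w X
  proof -
    interpret p: group_hom "hom_group C ?Q Z" "hom_group C X Z" "\<lambda>f. f \<cdot> w"
      by (rule precomp_group_hom[OF Z w])
    show ?thesis unfolding d_def using pqc by (simp del: carrier_hom_group)
  qed
  obtain E k w where pb: "is_pullback C m d E k w" using ex_pullback[OF mi d] .
  note kw = pullbackD[OF pb mi d]
  define r s where "r = ?p \<cdot> w" and "s = ?q \<cdot> w"
  have rs: "r \<in> homs C E Z" "s \<in> homs C E Z" using pq kw unfolding r_def s_def by auto
  have oE: "E \<in> obj C" using homsD[OF rs(1)] by blast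
  have elemI: "\<exists>u \<in> homs C X E. r \<cdot> u = x \<and> s \<cdot> u = y"
    if xy: "x \<in> homs C X Z" "y \<in> homs C X Z" and i: "i \<in> homs C X I"
      "m \<cdot> i = y \<otimes>\<^bsub>hom_group C X Z\<^esub> inv\<^bsub>hom_group C X Z\<^esub> x" for X x y i
  proof -
    obtain v where v: "v \<in> homs C X ?Q" "?p \<cdot> v = x" "?q \<cdot> v = y" using product_lift[OF prod xy] .
    have "m \<cdot> i = d \<cdot> v" using dx[OF v(1)] v i by simp
    then obtain u where u: "u \<in> homs C X E" "w \<cdot> u = v" using kw(4)[OF i(1) v(1)] by auto
    show ?thesis
      using u v comp_assoc[OF u(1) kw(2) pq(1)] comp_assoc[OF u(1) kw(2) pq(2)]
      unfolding r_def s_def by auto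
  qed
  have elemD: "k \<cdot> u \<in> homs C X I"
      "m \<cdot> (k \<cdot> u) = (s \<cdot> u) \<otimes>\<^bsub>hom_group C X Z\<^esub> inv\<^bsub>hom_group C X Z\<^esub> (r \<cdot> u)"
    if u: "u \<in> homs C X E" for X u
  proof -
    show "k \<cdot> u \<in> homs C X I" using kw u by blast
    have "m \<cdot> (k \<cdot> u) = d \<cdot> (w \<cdot> u)"
      using comp_assoc[OF u kw(1) mi] comp_assoc[OF u kw(2) d] kw(3) by simp
    then show "m \<cdot> (k \<cdot> u) = (s \<cdot> u) \<otimes>\<^bsub>hom_group C X Z\<^esub> inv\<^bsub>hom_group C X Z\<^esub> (r \<cdot> u)"
      using dx[OF comp_in[OF u kw(2)]] comp_assoc[OF u kw(2) pq(1)] comp_assoc[OF u kw(2) pq(2)]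
      unfolding r_def s_def by simp
  qed
  have zero: "\<exists>i \<in> homs C X I. m \<cdot> i = \<one>\<^bsub>hom_group C X Z\<^esub>" if X: "X \<in> obj C" for X
  proof -
    obtain i where i: "i \<in> homs C X I" "zero_arrow C i" using ex_zero_arrow[OF X oI] by blast
    then show ?thesis
      using zero_arrow_iff[OF Z comp_in[OF i(1) mi]] zero_arrow_comp_left[OF i(2,1) mi] by blast
  qed
  have refl: "\<exists>u \<in> homs C X E. r \<cdot> u = x \<and> s \<cdot> u = x" if x: "x \<in> homs C X Z" for X x
  proof -
    interpret G: comm_group "hom_group C X Z" by (rule comm_group_hom_group[OF Z homsD(4)[OF x]])
    obtain i where i: "i \<in> homs C X I" "m \<cdot> i = \<one>\<^bsub>hom_group C X Z\<^esub>" using zero[OF homsD(4)[OF x]] by blast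
    then show ?thesis using elemI[OF x x i(1)] G.r_inv[of x] x by simp
  qed
  have equiv: "internal_equivalence C Z E r s"
    unfolding internal_equivalence_def
  proof (intro conjI ballI impI allI oZ oE rs)
    fix X u v assume u: "u \<in> homs C X E" and v: "v \<in> homs C X E" and eq: "r \<cdot> u = r \<cdot> v \<and> s \<cdot> u = s \<cdot> v"
    have wu: "w \<cdot> u \<in> homs C X ?Q" "w \<cdot> v \<in> homs C X ?Q" using kw u v by auto
    have 1: "w \<cdot> u = w \<cdot> v"
      using product_eqI[OF prod wu] eq comp_assoc[OF u kw(2) pq(1)] comp_assoc[OF u kw(2) pq(2)]
        comp_assoc[OF v kw(2) pq(1)] comp_assoc[OF v kw(2) pq(2)] unfolding r_def s_def by simp
    have 2: "k \<cdot> u = k \<cdot> v"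
      using monicD(2)[OF m elemD(1)[OF u] elemD(1)[OF v]] elemD(2)[OF u] elemD(2)[OF v] eq by simp
    have "m \<cdot> (k \<cdot> u) = d \<cdot> (w \<cdot> u)"
      using comp_assoc[OF u kw(1) mi] comp_assoc[OF u kw(2) d] kw(3) by simp
    from kw(4)[OF elemD(1)[OF u] wu(1) this] show "u = v" using u v 1 2 by metis
  next
    show "\<exists>\<delta> \<in> homs C Z E. r \<cdot> \<delta> = idn C Z \<and> s \<cdot> \<delta> = idn C Z" using refl[OF idn_in[OF oZ]] .
  next
    interpret G: comm_group "hom_group C E Z" by (rule comm_group_hom_group[OF Z oE])
    obtain z where z: "z \<in> homs C E I" "m \<cdot> z = \<one>\<^bsub>hom_group C E Z\<^esub>" using zero[OF oE] by blast
    \<comment> \<open>Symmetry needs a negative, but \<open>image_diff\<close> only subtracts; so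
      \<open>k\<close> is subtracted from the zero element \<open>z\<close>.\<close>
    obtain i where i: "i \<in> homs C E I" "m \<cdot> i = (m \<cdot> z) \<otimes>\<^bsub>hom_group C E Z\<^esub> inv\<^bsub>hom_group C E Z\<^esub> (m \<cdot> k)"
      using image_diff[OF N Z e m z(1) kw(1)] .
    have mk: "m \<cdot> k = s \<otimes>\<^bsub>hom_group C E Z\<^esub> inv\<^bsub>hom_group C E Z\<^esub> r"
      using elemD(2)[OF idn_in[OF oE]] comp_idn[OF kw(1)] comp_idn[OF rs(1)] comp_idn[OF rs(2)] by simp
    have rsc: "r \<in> carrier (hom_group C E Z)" "s \<in> carrier (hom_group C E Z)" using rs by auto
    have "m \<cdot> i = r \<otimes>\<^bsub>hom_group C E Z\<^esub> inv\<^bsub>hom_group C E Z\<^esub> s"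
      unfolding i z mk using rsc by (simp del: carrier_hom_group add: G.inv_mult G.m_comm)
    then show "\<exists>\<sigma> \<in> homs C E E. r \<cdot> \<sigma> = s \<and> s \<cdot> \<sigma> = r" using elemI[OF rs(2,1) i(1)] by blast
  next
    fix Q p q assume pb2: "is_pullback C s r Q p q"
    note pq2 = pullbackD(1-3)[OF pb2 rs(2,1)]
    have oQ: "Q \<in> obj C" using homsD[OF pq2(1)] by blast
    interpret G: comm_group "hom_group C Q Z" by (rule comm_group_hom_group[OF Z oQ])
    obtain z where z: "z \<in> homs C Q I" "m \<cdot> z = \<one>\<^bsub>hom_group C Q Z\<^esub>" using zero[OF oQ] by blast
    obtain i where i: "i \<in> homs C Q I"
      "m \<cdot> i = (m \<cdot> z) \<otimes>\<^bsub>hom_group C Q Z\<^esub> inv\<^bsub>hom_group C Q Z\<^esub> (m \<cdot> (k \<cdot> p))"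
      using image_diff[OF N Z e m z(1) elemD(1)[OF pq2(1)]] .
    \<comment> \<open>Transitivity adds two differences: the negative \<open>i\<close> of the first
      is subtracted from the second.\<close>
    obtain j where j: "j \<in> homs C Q I"
      "m \<cdot> j = (m \<cdot> (k \<cdot> q)) \<otimes>\<^bsub>hom_group C Q Z\<^esub> inv\<^bsub>hom_group C Q Z\<^esub> (m \<cdot> i)"
      using image_diff[OF N Z e m elemD(1)[OF pq2(2)] i(1)] .
    have c: "r \<cdot> p \<in> carrier (hom_group C Q Z)" "r \<cdot> q \<in> carrier (hom_group C Q Z)"
      "s \<cdot> q \<in> carrier (hom_group C Q Z)" using rs pq2 by auto
    have "m \<cdot> j = ((s \<cdot> q) \<otimes>\<^bsub>hom_group C Q Z\<^esub> inv\<^bsub>hom_group C Q Z\<^esub> (r \<cdot> q)) \<otimes>\<^bsub>hom_group C Q Z\<^esub>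
        ((r \<cdot> q) \<otimes>\<^bsub>hom_group C Q Z\<^esub> inv\<^bsub>hom_group C Q Z\<^esub> (r \<cdot> p))"
      unfolding j i z elemD(2)[OF pq2(1)] elemD(2)[OF pq2(2)] pq2(3)
      using c by (simp del: carrier_hom_group)
    also have "\<dots> = (s \<cdot> q) \<otimes>\<^bsub>hom_group C Q Z\<^esub> (inv\<^bsub>hom_group C Q Z\<^esub> (r \<cdot> q) \<otimes>\<^bsub>hom_group C Q Z\<^esub>
        ((r \<cdot> q) \<otimes>\<^bsub>hom_group C Q Z\<^esub> inv\<^bsub>hom_group C Q Z\<^esub> (r \<cdot> p)))"
      using c by (simp del: carrier_hom_group add: G.m_assoc)
    also have "\<dots> = (s \<cdot> q) \<otimes>\<^bsub>hom_group C Q Z\<^esub> inv\<^bsub>hom_group C Q Z\<^esub> (r \<cdot> p)"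
      using c by (simp del: carrier_hom_group add: G.m_assoc[symmetric])
    finally show "\<exists>\<tau> \<in> homs C Q E. r \<cdot> \<tau> = r \<cdot> p \<and> s \<cdot> \<tau> = s \<cdot> q"
      using elemI[OF _ _ j(1)] rs pq2 by blast
  qed
  have "barr_exact C" using semiabelian by (simp add: semiabelian_def)
  then obtain f where f: "is_pullback C f f E r s" using equiv unfolding barr_exact_def by blast
  define D where "D = tgt C f"
  have fin: "f \<in> homs C Z D"
    using f homsD[OF rs(1)] unfolding D_def is_pullback_def homs_def by auto
  note fp = pullbackD[OF f fin fin]
  interpret GI: comm_group "hom_group C I Z" by (rule comm_group_hom_group[OF Z oI])
  interpret GZ: comm_group "hom_group C Z Z" by (rule comm_group_hom_group[OF Z oZ])
  have zI: "\<one>\<^bsub>hom_group C I Z\<^esub> \<in> homs C I Z" and zZ: "\<one>\<^bsub>hom_group C Z Z\<^esub> \<in> homs C Z Z"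
    using one_in[OF Z] oI oZ by auto
  \<comment> \<open>The pair with components zero and \<open>m\<close> belongs to the congruence, so
    \<open>f \<cdot> m\<close> is zero and \<open>f\<close> factors through the cokernel.\<close>
  have "m \<cdot> idn C I = m \<otimes>\<^bsub>hom_group C I Z\<^esub> inv\<^bsub>hom_group C I Z\<^esub> \<one>\<^bsub>hom_group C I Z\<^esub>"
    using GI.r_one[of m] comp_idn[OF mi] mi by simp
  then obtain u where u: "u \<in> homs C I E" "r \<cdot> u = \<one>\<^bsub>hom_group C I Z\<^esub>" "s \<cdot> u = m"
    using elemI[OF zI mi idn_in[OF oI]] by blast
  have "f \<cdot> m = f \<cdot> \<one>\<^bsub>hom_group C I Z\<^esub>"
    using comp_assoc[OF u(1) fp(1) fin] comp_assoc[OF u(1) fp(2) fin] fp(3) u by simp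
  then have "zero_arrow C (f \<cdot> m)" using zero_arrow_comp_left[OF zero_arrow_one[OF Z oI] zI fin] by simp
  then have "zero_arrow C ((f \<cdot> m) \<cdot> e)" using zero_arrow_comp_right[OF _ comp_in[OF mi fin] e(1)] by blast
  then have "zero_arrow C (f \<cdot> b)" using comp_assoc[OF e(1) mi fin] me by simp
  then obtain t where t: "t \<in> homs C L D" "t \<cdot> q = f"
    using cokernelD(3)[OF coker b fin] by blast
  note qL = cokernelD(1)[OF coker b]
  have f0: "zero_arrow C f" using zero_arrow_comp_left[OF zero_arrow_to_zero[OF L qL] qL t(1)] t(2) by simp
  \<comment> \<open>As \<open>f\<close> is zero, its kernel pair contains the pair of zero and the
    identity; membership in the congruence then says that the identity of \<open>Z\<close> factors
    through \<open>m\<close>.\<close>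
  have "f \<cdot> \<one>\<^bsub>hom_group C Z Z\<^esub> = f \<cdot> idn C Z"
    using zero_arrow_unique[OF zero_arrow_comp_right[OF f0 fin zZ] zero_arrow_comp_right[OF f0 fin idn_in[OF oZ]]
      comp_in[OF zZ fin] comp_in[OF idn_in[OF oZ] fin]] .
  then obtain u where u: "u \<in> homs C Z E" "r \<cdot> u = \<one>\<^bsub>hom_group C Z Z\<^esub>" "s \<cdot> u = idn C Z"
    using fp(4)[OF zZ idn_in[OF oZ]] by auto
  have mi1: "m \<cdot> (k \<cdot> u) = idn C Z"
    using elemD(2)[OF u(1)] u GZ.r_one[of "idn C Z"] idn_in[OF oZ] by simp
  note i = elemD(1)[OF u(1)]
  obtain y where y: "y \<in> homs C Q N" "e \<cdot> y = (k \<cdot> u) \<cdot> x"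
    using Q e comp_in[OF x i] homsD[OF e(1)] unfolding projective_object_def by metis
  have "b \<cdot> y = x"
    using comp_assoc[OF y(1) e(1) mi] me y(2) comp_assoc[OF x i mi] mi1 comp_idn[OF x] by simp
  with y(1) show ?thesis using that by blast
qed

end

section \<open>Reflective subcategories of the abelian core\<close>

locale abelian_reflection = semiabelian_category C for C :: "('o, 'a) cat" (structure) +
  fixes R :: "'o set" and To :: "'o \<Rightarrow> 'o" and Ta :: "'a \<Rightarrow> 'a" and \<eta> :: "'o \<Rightarrow> 'a"
  assumes R_Ab: "R \<subseteq> abelian_core C"
    and replete: "replete C R"
    and T_functor: "is_functor C (full_subcat C R) To Ta"
    and unit_in: "A \<in> obj C \<Longrightarrow> \<eta> A \<in> homs C A (To A)"
    and unit_natural: "f \<in> arr C \<Longrightarrow> Ta f \<cdot> \<eta> (src C f) = \<eta> (tgt C f) \<cdot> f"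
    and unit_universal: "A \<in> obj C \<Longrightarrow> B \<in> R \<Longrightarrow> f \<in> homs C A B \<Longrightarrow> \<exists>!g. g \<in> homs C (To A) B \<and> g \<cdot> \<eta> A = f"
begin

lemma in_Ab: "A \<in> R \<Longrightarrow> A \<in> Ab" and in_obj: "A \<in> R \<Longrightarrow> A \<in> obj C"
  using R_Ab Ab_obj by auto

lemma To_in: "A \<in> obj C \<Longrightarrow> To A \<in> R"
  using T_functor by (simp add: is_functor_def full_subcat_def)

lemma Ta_in: "f \<in> homs C A B \<Longrightarrow> Ta f \<in> homs C (To A) (To B)"
  using T_functor by (auto simp: is_functor_def full_subcat_def homs_def)

lemma Ta_comp: "f \<in> homs C A B \<Longrightarrow> g \<in> homs C B D \<Longrightarrow> Ta (g \<cdot> f) = Ta g \<cdot> Ta f"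
  using T_functor by (auto simp: is_functor_def full_subcat_def homs_def)

lemma Ta_idn: "A \<in> obj C \<Longrightarrow> Ta (idn C A) = idn C (To A)"
  using T_functor by (auto simp: is_functor_def full_subcat_def)

lemma extend:
  assumes "f \<in> homs C A B" "B \<in> R"
  obtains g where "g \<in> homs C (To A) B" "g \<cdot> \<eta> A = f"
  using unit_universal[OF homsD(4)[OF assms(1)] assms(2,1)] by auto

lemma extend_unique:
  assumes "A \<in> obj C" "B \<in> R" "g \<in> homs C (To A) B" "g' \<in> homs C (To A) B" "g \<cdot> \<eta> A = g' \<cdot> \<eta> A"
  shows "g = g'"
  using unit_universal[OF assms(1,2) comp_in[OF unit_in[OF assms(1)] assms(3)]] assms by metis

text \<open>Reflective subcategories are closed under limits: \<open>k\<close> extends over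
  \<open>To K\<close>, the extension still satisfies the kernel condition and so factors through
  \<open>K\<close>, and this factorisation inverts the unit; repleteness finishes. Moore objects and
  cycle objects are thereby kept in \<open>R\<close>.\<close>

lemma joint_kernel_in:
  assumes K: "joint_kernel C F A K k" and A: "A \<in> R" and F: "\<And>f. f \<in> F \<Longrightarrow> tgt C f \<in> R"
  shows "K \<in> R"
proof -
  have k: "k \<in> homs C K A" and oK: "K \<in> obj C"
    and F0: "\<And>f. f \<in> F \<Longrightarrow> zero_arrow C (f \<cdot> k)"
    and Fin: "\<And>f. f \<in> F \<Longrightarrow> f \<in> homs C A (tgt C f)"
    using K by (auto simp: joint_kernel_def homs_def)
  have un: "\<exists>!u. u \<in> homs C X K \<and> k \<cdot> u = a" if "a \<in> homs C X A" "\<And>f. f \<in> F \<Longrightarrow> zero_arrow C (f \<cdot> a)" for X a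
    using K that homsD(4)[OF that(1)] by (simp add: joint_kernel_def)
  note \<eta> = unit_in[OF oK]
  obtain k' where k': "k' \<in> homs C (To K) A" "k' \<cdot> \<eta> K = k" using extend[OF k A] .
  have "zero_arrow C (f \<cdot> k')" if f: "f \<in> F" for f
  proof -
    obtain z where z: "z \<in> homs C (To K) (tgt C f)" "zero_arrow C z"
      using ex_zero_arrow[OF in_obj[OF To_in[OF oK]] in_obj[OF F[OF f]]] by blast
    have "z \<cdot> \<eta> K = f \<cdot> k"
      by (rule zero_arrow_unique[OF zero_arrow_comp_right[OF z(2,1) \<eta>] F0[OF f] comp_in[OF \<eta> z(1)] comp_in[OF k Fin[OF f]]])
    then have "z \<cdot> \<eta> K = (f \<cdot> k') \<cdot> \<eta> K" using comp_assoc[OF \<eta> k'(1) Fin[OF f]] k'(2) by simp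
    then have "z = f \<cdot> k'"
      by (rule extend_unique[OF oK F[OF f] z(1) comp_in[OF k'(1) Fin[OF f]]])
    then show ?thesis using z by simp
  qed
  then obtain u where u: "u \<in> homs C (To K) K" "k \<cdot> u = k'" using un[OF k'(1)] by blast
  have "k \<cdot> (u \<cdot> \<eta> K) = k \<cdot> idn C K" using comp_assoc[OF \<eta> u(1) k] u(2) k'(2) comp_idn[OF k] by simp
  then have u\<eta>: "u \<cdot> \<eta> K = idn C K"
    using un[OF k F0] comp_in[OF \<eta> u(1)] idn_in[OF oK] comp_idn[OF k] by metis
  have "(\<eta> K \<cdot> u) \<cdot> \<eta> K = idn C (To K) \<cdot> \<eta> K"
    using comp_assoc[OF \<eta> u(1) \<eta>] u\<eta> comp_idn[OF \<eta>] by simp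
  then have "\<eta> K \<cdot> u = idn C (To K)"
    using extend_unique[OF oK To_in[OF oK] comp_in[OF u(1) \<eta>] idn_in[OF homsD(5)[OF \<eta>]]] by blast
  then have "Defs.is_iso C u" using u\<eta> homsD[OF u(1)] \<eta> unfolding Defs.is_iso_def by auto
  then show ?thesis using replete homsD[OF u(1)] To_in[OF oK] unfolding replete_def by metis
qed

lemma simplicial_map:
  assumes P: "simplicial_object C P"
  shows "simplicial_object C (map_simpl To Ta P)"
proof -
  have o: "sob P k \<in> obj C" and f: "i \<le> Suc k \<Longrightarrow> face P k i \<in> homs C (sob P (Suc k)) (sob P k)"
    and d: "i \<le> k \<Longrightarrow> degen P k i \<in> homs C (sob P k) (sob P (Suc k))" for k i
    using P by (auto simp: simplicial_object_def)
  show ?thesis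
    unfolding simplicial_object_def map_simpl_def simpl.simps
    apply (intro conjI allI impI)
    subgoal using in_obj To_in o by blast
    subgoal using Ta_in f by blast
    subgoal using Ta_in d by blast
    subgoal for k i j
      using P Ta_comp[OF f f, of "Suc j" k i] Ta_comp[OF f f, of i k j] by (simp add: simplicial_object_def)
    subgoal for k i j
      using P Ta_comp[OF d d, of j k i] Ta_comp[OF d d, of i k "Suc j"] by (simp add: simplicial_object_def)
    subgoal for k i j
      using P Ta_comp[OF d f, of "Suc j" "Suc k" i] Ta_comp[OF f d, of i k j] by (simp add: simplicial_object_def)
    subgoal for k j
      using P Ta_comp[OF d f, of j k j] Ta_idn[OF o] by (simp add: simplicial_object_def)
    subgoal for k j
      using P Ta_comp[OF d f, of j k "Suc j"] Ta_idn[OF o] by (simp add: simplicial_object_def)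
    subgoal for k i j
      using P Ta_comp[OF d f, of j "Suc k" "Suc i"] Ta_comp[OF f d, of i k j] by (simp add: simplicial_object_def)
    done
qed

end

section \<open>The projection onto the Moore complex\<close>

locale abelian_simplicial = simplicial C S for C :: "('o, 'a) cat" (structure) and S +
  assumes sob_Ab: "sob S k \<in> Ab"
begin

text \<open>The idempotent that projects onto the kernel of face \<open>j\<close> along the image of
  degeneracy \<open>j\<close>; it exists because arrows into abelian objects can be
  subtracted.\<close>

definition eps :: "nat \<Rightarrow> nat \<Rightarrow> 'a" where
  "eps k j = idn C (sob S (Suc k)) \<otimes>\<^bsub>hom_group C (sob S (Suc k)) (sob S (Suc k))\<^esub>
     inv\<^bsub>hom_group C (sob S (Suc k)) (sob S (Suc k))\<^esub> (degen S k j \<cdot> face S k j)"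

lemma degen_face: "j \<le> k \<Longrightarrow> degen S k j \<cdot> face S k j \<in> homs C (sob S (Suc k)) (sob S (Suc k))"
  using comp_in[OF face degen] by simp

lemma eps_in:
  assumes "j \<le> k"
  shows "eps k j \<in> homs C (sob S (Suc k)) (sob S (Suc k))"
proof -
  interpret G: comm_group "hom_group C (sob S (Suc k)) (sob S (Suc k))"
    using comm_group_hom_group sob sob_Ab by blast
  have "eps k j \<in> carrier (hom_group C (sob S (Suc k)) (sob S (Suc k)))"
    unfolding eps_def using idn_in[OF sob] degen_face[OF assms]
    by (intro G.m_closed G.inv_closed) simp_all
  then show ?thesis by simp
qed

lemma eps_comp:
  assumes j: "j \<le> k" and x: "x \<in> homs C Y (sob S (Suc k))"
  shows "eps k j \<cdot> x = x \<otimes>\<^bsub>hom_group C Y (sob S (Suc k))\<^esub>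
    inv\<^bsub>hom_group C Y (sob S (Suc k))\<^esub> (degen S k j \<cdot> (face S k j \<cdot> x))"
proof -
  interpret p: group_hom "hom_group C (sob S (Suc k)) (sob S (Suc k))" "hom_group C Y (sob S (Suc k))" "\<lambda>f. f \<cdot> x"
    by (rule precomp_group_hom[OF sob_Ab x])
  have "idn C (sob S (Suc k)) \<in> carrier (hom_group C (sob S (Suc k)) (sob S (Suc k)))"
    "degen S k j \<cdot> face S k j \<in> carrier (hom_group C (sob S (Suc k)) (sob S (Suc k)))"
    using idn_in[OF sob] degen_face[OF j] by simp_all
  then show ?thesis
    unfolding eps_def using comp_idn[OF x] comp_assoc[OF x face degen[OF j], of j] j
    by (simp del: carrier_hom_group)
qed

lemma comp_eps:
  assumes A: "A \<in> Ab" and j: "j \<le> k" and f: "f \<in> homs C (sob S (Suc k)) A"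
  shows "f \<cdot> eps k j = f \<otimes>\<^bsub>hom_group C (sob S (Suc k)) A\<^esub>
    inv\<^bsub>hom_group C (sob S (Suc k)) A\<^esub> ((f \<cdot> degen S k j) \<cdot> face S k j)"
proof -
  interpret p: group_hom "hom_group C (sob S (Suc k)) (sob S (Suc k))" "hom_group C (sob S (Suc k)) A" "\<lambda>g. f \<cdot> g"
    by (rule postcomp_group_hom[OF sob_Ab A f sob])
  have "idn C (sob S (Suc k)) \<in> carrier (hom_group C (sob S (Suc k)) (sob S (Suc k)))"
    "degen S k j \<cdot> face S k j \<in> carrier (hom_group C (sob S (Suc k)) (sob S (Suc k)))"
    using idn_in[OF sob] degen_face[OF j] by simp_all
  then show ?thesis
    unfolding eps_def using comp_idn[OF f] comp_assoc[OF face degen[OF j] f, of j] j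
    by (simp del: carrier_hom_group)
qed

text \<open>Face \<open>j\<close> is killed because degeneracy \<open>j\<close> is a section of it.
  For \<open>i < j\<close> the simplicial identities move face \<open>i\<close> in the subtracted
  term to the innermost position, where it meets \<open>x\<close> and vanishes.\<close>

lemma face_eps:
  assumes j: "j \<le> k" and x: "x \<in> homs C Y (sob S (Suc k))"
    and 0: "\<And>i. i < j \<Longrightarrow> face S k i \<cdot> x = \<one>\<^bsub>hom_group C Y (sob S k)\<^esub>" and i: "i \<le> j"
  shows "face S k i \<cdot> (eps k j \<cdot> x) = \<one>\<^bsub>hom_group C Y (sob S k)\<^esub>"
proof -
  have oY: "Y \<in> obj C" using homsD[OF x] by blast
  interpret G: comm_group "hom_group C Y (sob S k)" using comm_group_hom_group sob_Ab oY by blast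
  have ik: "i \<le> Suc k" "j \<le> Suc k" using i j by auto
  interpret p: group_hom "hom_group C Y (sob S (Suc k))" "hom_group C Y (sob S k)" "\<lambda>g. face S k i \<cdot> g"
    by (rule postcomp_group_hom[OF sob_Ab sob_Ab face[OF ik(1)] oY])
  have jx: "face S k j \<cdot> x \<in> homs C Y (sob S k)" using comp_in[OF x face[OF ik(2)]] .
  have c: "x \<in> carrier (hom_group C Y (sob S (Suc k)))"
    "degen S k j \<cdot> (face S k j \<cdot> x) \<in> carrier (hom_group C Y (sob S (Suc k)))"
    using comp_in[OF jx degen[OF j]] x by simp_all
  have 1: "face S k i \<cdot> (eps k j \<cdot> x) = (face S k i \<cdot> x) \<otimes>\<^bsub>hom_group C Y (sob S k)\<^esub>
      inv\<^bsub>hom_group C Y (sob S k)\<^esub> (face S k i \<cdot> (degen S k j \<cdot> (face S k j \<cdot> x)))"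
    unfolding eps_comp[OF j x] using c by (simp del: carrier_hom_group)
  have 2: "face S k i \<cdot> (degen S k j \<cdot> (face S k j \<cdot> x)) = (face S k i \<cdot> degen S k j) \<cdot> (face S k j \<cdot> x)"
    using comp_assoc[OF jx degen[OF j] face[OF ik(1)]] by simp
  show ?thesis
  proof (cases "i = j")
    case True
    then show ?thesis
      using 1 2 face_degen_eq[OF j] comp_idn[OF jx] G.r_inv[of "face S k j \<cdot> x"] jx by simp
  next
    case False
    then have ij: "i < j" using i by simp
    then obtain k' j' where kj: "k = Suc k'" "j = Suc j'" using j by (cases k; cases j) auto
    then have ij': "i \<le> j'" "j' \<le> k'" "i \<le> Suc k'" "j' \<le> Suc k'" using ij j by auto
    have f: "face S k' i \<in> homs C (sob S k) (sob S k')" "face S k' j' \<in> homs C (sob S k) (sob S k')"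
      "degen S k' j' \<in> homs C (sob S k') (sob S k)"
      using face[OF ij'(3)] face[OF ij'(4)] degen[OF ij'(2)] kj by auto
    have "face S k i \<cdot> (degen S k j \<cdot> (face S k j \<cdot> x)) = degen S k' j' \<cdot> ((face S k' i \<cdot> face S k j) \<cdot> x)"
      using 2 face_degen_less[OF ij'(1,2)] comp_assoc[OF jx f(1) f(3)] comp_assoc[OF x face[OF ik(2)] f(1)] kj by simp
    also have "face S k' i \<cdot> face S k j = face S k' j' \<cdot> face S k i"
      using face_face[OF ij'(1,4)] kj by simp
    also have "(face S k' j' \<cdot> face S k i) \<cdot> x = \<one>\<^bsub>hom_group C Y (sob S k')\<^esub>"
      using comp_assoc[OF x face[OF ik(1)] f(2)] 0[OF ij] comp_one[OF sob_Ab sob_Ab f(2) oY] by simp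
    finally show ?thesis
      using 1 0[OF ij] comp_one[OF sob_Ab sob_Ab f(3) oY] by (simp del: carrier_hom_group)
  qed
qed

text \<open>\<open>proj k j = e\<^sub>j\<^sub>-\<^sub>1 \<cdots> e\<^sub>0\<close> with \<open>e\<^sub>i = 1 - s\<^sub>i d\<^sub>i\<close>, for \<open>j \<le> k\<close>.\<close>

primrec proj :: "nat \<Rightarrow> nat \<Rightarrow> 'a" where
  "proj k 0 = idn C (sob S k)"
| "proj k (Suc j) = eps (k - 1) j \<cdot> proj k j"

lemma proj_in: "j \<le> k \<Longrightarrow> proj k j \<in> homs C (sob S k) (sob S k)"
proof (induction j)
  case (Suc j)
  then obtain k' where k': "k = Suc k'" "j \<le> k'" by (cases k) auto
  then show ?case using comp_in[OF Suc.IH] eps_in[OF k'(2)] by simp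
qed (use sob in auto)

lemma face_proj:
  "j \<le> Suc k \<Longrightarrow> i < j \<Longrightarrow> face S k i \<cdot> proj (Suc k) j = \<one>\<^bsub>hom_group C (sob S (Suc k)) (sob S k)\<^esub>"
proof (induction j arbitrary: i)
  case (Suc j)
  show ?case
    using face_eps[of j k "proj (Suc k) j" "sob S (Suc k)" i] Suc proj_in[of j "Suc k"] by simp
qed simp

lemma proj_fix:
  assumes x: "x \<in> homs C Y (sob S (Suc k))"
  shows "j \<le> Suc k \<Longrightarrow> (\<And>i. i < j \<Longrightarrow> face S k i \<cdot> x = \<one>\<^bsub>hom_group C Y (sob S k)\<^esub>) \<Longrightarrow> proj (Suc k) j \<cdot> x = x"
proof (induction j)
  case (Suc j)
  have oY: "Y \<in> obj C" using homsD[OF x] by blast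
  interpret G: comm_group "hom_group C Y (sob S (Suc k))" using comm_group_hom_group sob_Ab oY by blast
  have j: "j \<le> k" using Suc.prems by simp
  have "eps k j \<cdot> x = x"
    unfolding eps_comp[OF j x] using Suc.prems(2)[of j] comp_one[OF sob_Ab sob_Ab degen[OF j] oY] x G.r_one[of x]
    by simp
  moreover have "proj (Suc k) j \<cdot> x = x" using Suc by simp
  ultimately show ?case using comp_assoc[OF x proj_in eps_in[OF j]] j by simp
qed (use comp_idn[OF x] in simp)

text \<open>Dual to \<open>proj_fix\<close>: an arrow that kills the degeneracies does not see the
  terms subtracted in the factors \<open>eps\<close>.\<close>

lemma comp_proj:
  assumes A: "A \<in> Ab" and f: "f \<in> homs C (sob S (Suc k)) A"
  shows "j \<le> Suc k \<Longrightarrow> (\<And>i. i < j \<Longrightarrow> f \<cdot> degen S k i = \<one>\<^bsub>hom_group C (sob S k) A\<^esub>) \<Longrightarrow> f \<cdot> proj (Suc k) j = f"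
proof (induction j)
  case (Suc j)
  interpret G: comm_group "hom_group C (sob S (Suc k)) A" using comm_group_hom_group A sob by blast
  have j: "j \<le> k" using Suc.prems by simp
  have "f \<cdot> eps k j = f"
    unfolding comp_eps[OF A j f] using Suc.prems(2)[of j] one_comp[OF A face] f G.r_one[of f] j by simp
  moreover have "f \<cdot> proj (Suc k) j = f" using Suc by simp
  ultimately show ?case using comp_assoc[OF proj_in eps_in[OF j] f, of j] j by simp
qed (use comp_idn[OF f] in simp)

lemma eps_degen:
  assumes "j \<le> i" "i \<le> k"
  shows "eps (Suc k) j \<cdot> degen S (Suc k) (Suc i) = degen S (Suc k) (Suc i) \<cdot> eps k j"
proof -
  have l: "j \<le> k" "j \<le> Suc k" "Suc i \<le> Suc k" using assms by auto
  let ?s = "degen S (Suc k) (Suc i)"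
  note s = degen[OF l(3)]
  interpret p: group_hom "hom_group C (sob S (Suc k)) (sob S (Suc k))" "hom_group C (sob S (Suc k)) (sob S (Suc (Suc k)))" "\<lambda>g. ?s \<cdot> g"
    by (rule postcomp_group_hom[OF sob_Ab sob_Ab s sob])
  have c: "idn C (sob S (Suc k)) \<in> carrier (hom_group C (sob S (Suc k)) (sob S (Suc k)))"
    "degen S k j \<cdot> face S k j \<in> carrier (hom_group C (sob S (Suc k)) (sob S (Suc k)))"
    using idn_in[OF sob] degen_face[OF l(1)] by simp_all
  have "degen S (Suc k) j \<cdot> (face S (Suc k) j \<cdot> ?s) = degen S (Suc k) j \<cdot> (degen S k i \<cdot> face S k j)"
    using face_degen_less[OF assms] by simp
  also have "\<dots> = (?s \<cdot> degen S k j) \<cdot> face S k j"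
    using comp_assoc[OF face[of j k] degen[OF assms(2)] degen[OF l(2)]] degen_degen[OF assms] l by simp
  also have "\<dots> = ?s \<cdot> (degen S k j \<cdot> face S k j)"
    using comp_assoc[OF face[of j k] degen[OF l(1)] s] l by simp
  finally have "eps (Suc k) j \<cdot> ?s = ?s \<otimes>\<^bsub>hom_group C (sob S (Suc k)) (sob S (Suc (Suc k)))\<^esub>
      inv\<^bsub>hom_group C (sob S (Suc k)) (sob S (Suc (Suc k)))\<^esub> (?s \<cdot> (degen S k j \<cdot> face S k j))"
    unfolding eps_comp[OF l(2) s] by simp
  also have "\<dots> = ?s \<cdot> eps k j"
    unfolding eps_def using c comp_idn[OF s] by (simp del: carrier_hom_group)
  finally show ?thesis .
qed

lemma proj_degen_commute: "j \<le> i \<Longrightarrow> i \<le> k \<Longrightarrow> proj (Suc k) j \<cdot> degen S k i = degen S k i \<cdot> proj k j"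
proof (induction j)
  case 0
  then show ?case using comp_idn[OF degen] by simp
next
  case (Suc j)
  then obtain i' k' where e: "i = Suc i'" "k = Suc k'" by (cases i; cases k) auto
  then have l: "j \<le> i'" "i' \<le> k'" "j \<le> k" "j \<le> k'" "j \<le> i" using Suc.prems by auto
  have k: "eps k j \<in> homs C (sob S (Suc k)) (sob S (Suc k))" "eps k' j \<in> homs C (sob S k) (sob S k)"
    using eps_in l e by auto
  have p: "proj (Suc k) j \<in> homs C (sob S (Suc k)) (sob S (Suc k))" "proj k j \<in> homs C (sob S k) (sob S k)"
    using proj_in l by auto
  have d: "degen S k i \<in> homs C (sob S k) (sob S (Suc k))" using degen Suc.prems by blast
  have "proj (Suc k) (Suc j) \<cdot> degen S k i = eps k j \<cdot> (degen S k i \<cdot> proj k j)"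
    using comp_assoc[OF d p(1) k(1)] Suc.IH l Suc.prems by simp
  also have "\<dots> = (degen S k i \<cdot> eps k' j) \<cdot> proj k j"
    using comp_assoc[OF p(2) d k(1)] eps_degen[OF l(1,2)] e by simp
  also have "\<dots> = degen S k i \<cdot> proj k (Suc j)"
    using comp_assoc[OF p(2) k(2) d] e by simp
  finally show ?case .
qed

text \<open>The factors with index below \<open>i\<close> commute with the degeneracy
  \<open>i\<close>, the factor with index \<open>i\<close> kills it, and the later ones preserve
  zero.\<close>

lemma proj_degen:
  "j \<le> Suc k \<Longrightarrow> i < j \<Longrightarrow> proj (Suc k) j \<cdot> degen S k i = \<one>\<^bsub>hom_group C (sob S k) (sob S (Suc k))\<^esub>"
proof (induction j)
  case (Suc j)
  then have l: "j \<le> k" "i \<le> k" "i \<le> j" by auto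
  note k = eps_in[OF l(1)]
  have p: "proj (Suc k) j \<in> homs C (sob S (Suc k)) (sob S (Suc k))" using proj_in l by simp
  have 1: "proj (Suc k) (Suc j) \<cdot> degen S k i = eps k j \<cdot> (proj (Suc k) j \<cdot> degen S k i)"
    using comp_assoc[OF degen[OF l(2)] p k] by simp
  show ?case
  proof (cases "i = j")
    case True
    interpret G: comm_group "hom_group C (sob S k) (sob S (Suc k))" using comm_group_hom_group sob_Ab sob by blast
    have d: "degen S k j \<in> homs C (sob S k) (sob S (Suc k))" using degen[OF l(1)] .
    have "eps k j \<cdot> degen S k j = \<one>\<^bsub>hom_group C (sob S k) (sob S (Suc k))\<^esub>"
      unfolding eps_comp[OF l(1) d] using face_degen_eq[OF l(1)] comp_idn[OF d] G.r_inv[of "degen S k j"] d by simp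
    then show ?thesis
      using 1 True proj_degen_commute[of j j k] comp_assoc[OF proj_in[OF l(1)] d k]
        one_comp[OF sob_Ab proj_in[OF l(1)]] l by simp
  next
    case False
    then show ?thesis using 1 Suc comp_one[OF sob_Ab sob_Ab k sob] by simp
  qed
qed simp

declare proj.simps(2) [simp del]

end

section \<open>Cocycles and the Moore complex\<close>

locale moore = abelian_simplicial C S for C :: "('o, 'a) cat" (structure) and S +
  fixes N :: "nat \<Rightarrow> 'o" and \<nu> bd :: "nat \<Rightarrow> 'a"
  assumes kernel: "joint_kernel C (case k of 0 \<Rightarrow> {} | Suc j \<Rightarrow> face S j ` {..j}) (sob S k) (N k) (\<nu> k)"
    and bd_in: "bd k \<in> homs C (N (Suc k)) (N k)"
    and nu_bd: "\<nu> k \<cdot> bd k = face S k (Suc k) \<cdot> \<nu> (Suc k)"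
    and N_Ab: "N k \<in> Ab"
begin

lemma nu_in: "\<nu> k \<in> homs C (N k) (sob S k)" and N_obj: "N k \<in> obj C"
  using kernel[of k] by (auto simp: joint_kernel_def)

lemma nu_face:
  assumes "i \<le> k"
  shows "face S k i \<cdot> \<nu> (Suc k) = \<one>\<^bsub>hom_group C (N (Suc k)) (sob S k)\<^esub>"
proof -
  have "zero_arrow C (face S k i \<cdot> \<nu> (Suc k))" using kernel[of "Suc k"] assms by (auto simp: joint_kernel_def)
  then show ?thesis using zero_arrow_iff[OF sob_Ab comp_in[OF nu_in face]] assms by simp
qed

lemma nu_ex1:
  assumes x: "x \<in> homs C Y (sob S k)"
    and 0: "\<And>i j. k = Suc j \<Longrightarrow> i \<le> j \<Longrightarrow> face S j i \<cdot> x = \<one>\<^bsub>hom_group C Y (sob S j)\<^esub>"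
  shows "\<exists>!u. u \<in> homs C Y (N k) \<and> \<nu> k \<cdot> u = x"
proof -
  have "\<forall>f \<in> (case k of 0 \<Rightarrow> {} | Suc j \<Rightarrow> face S j ` {..j}). zero_arrow C (f \<cdot> x)"
    using 0 zero_arrow_one[OF sob_Ab homsD(4)[OF x]] by (auto split: nat.splits)
  then show ?thesis using kernel[of k] x homsD(4)[OF x] unfolding joint_kernel_def by simp
qed

lemma face_nu_comp:
  assumes u: "u \<in> homs C Y (N k)" and "k = Suc j" "i \<le> j"
  shows "face S j i \<cdot> (\<nu> k \<cdot> u) = \<one>\<^bsub>hom_group C Y (sob S j)\<^esub>"
  using comp_assoc[OF u nu_in, of "face S j i" "sob S j"] face[of i j] nu_face[of i j]
    one_comp[OF sob_Ab u] assms by simp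

lemma nu_cancel:
  assumes u: "u \<in> homs C Y (N k)" and v: "v \<in> homs C Y (N k)" and eq: "\<nu> k \<cdot> u = \<nu> k \<cdot> v"
  shows "u = v"
  using nu_ex1[OF comp_in[OF u nu_in] face_nu_comp[OF u]] assms by metis

text \<open>The Moore projection with its codomain restricted to the Moore object; by
  \<open>pi_nu\<close> it exhibits \<open>N k\<close> as a retract of
  \<open>sob S k\<close>.\<close>

definition pi :: "nat \<Rightarrow> 'a" where
  "pi k = (THE u. u \<in> homs C (sob S k) (N k) \<and> \<nu> k \<cdot> u = proj k k)"

lemma pi: "pi k \<in> homs C (sob S k) (N k)" "\<nu> k \<cdot> pi k = proj k k"
proof -
  have "\<exists>!u. u \<in> homs C (sob S k) (N k) \<and> \<nu> k \<cdot> u = proj k k"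
    by (rule nu_ex1) (use proj_in face_proj in auto)
  from theI'[OF this] show "pi k \<in> homs C (sob S k) (N k)" "\<nu> k \<cdot> pi k = proj k k"
    unfolding pi_def by auto
qed

lemma pi_nu: "pi k \<cdot> \<nu> k = idn C (N k)"
proof (rule nu_cancel)
  show "pi k \<cdot> \<nu> k \<in> homs C (N k) (N k)" "idn C (N k) \<in> homs C (N k) (N k)"
    using pi nu_in N_obj by auto
  have "proj k k \<cdot> \<nu> k = \<nu> k"
  proof (cases k)
    case 0
    then show ?thesis using comp_idn[OF nu_in] by simp
  next
    case (Suc j)
    then show ?thesis using proj_fix[OF nu_in[of "Suc j"], of "Suc j"] nu_face by simp
  qed
  then show "\<nu> k \<cdot> (pi k \<cdot> \<nu> k) = \<nu> k \<cdot> idn C (N k)"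
    using comp_assoc[OF nu_in pi(1) nu_in] pi(2) comp_idn[OF nu_in] by simp
qed

lemma pi_degen:
  assumes "i \<le> k"
  shows "pi (Suc k) \<cdot> degen S k i = \<one>\<^bsub>hom_group C (sob S k) (N (Suc k))\<^esub>"
proof (rule nu_cancel)
  show "pi (Suc k) \<cdot> degen S k i \<in> homs C (sob S k) (N (Suc k))"
    using pi degen[OF assms] by blast
  show "\<one>\<^bsub>hom_group C (sob S k) (N (Suc k))\<^esub> \<in> homs C (sob S k) (N (Suc k))"
    using one_in[OF N_Ab sob] .
  show "\<nu> (Suc k) \<cdot> (pi (Suc k) \<cdot> degen S k i) = \<nu> (Suc k) \<cdot> \<one>\<^bsub>hom_group C (sob S k) (N (Suc k))\<^esub>"
    using comp_assoc[OF degen[OF assms] pi(1) nu_in] pi(2) proj_degen[of "Suc k" k i] assms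
      comp_one[OF N_Ab sob_Ab nu_in sob] by simp
qed

text \<open>A simplicial identity replaces the last face out of degree \<open>k + 2\<close> by the
  one before it, which vanishes on the Moore object.\<close>

lemma bd_bd: "bd k \<cdot> bd (Suc k) = \<one>\<^bsub>hom_group C (N (Suc (Suc k))) (N k)\<^esub>"
proof (rule nu_cancel)
  show "bd k \<cdot> bd (Suc k) \<in> homs C (N (Suc (Suc k))) (N k)" using bd_in by blast
  show "\<one>\<^bsub>hom_group C (N (Suc (Suc k))) (N k)\<^esub> \<in> homs C (N (Suc (Suc k))) (N k)" using one_in N_Ab N_obj by blast
  have f: "face S k (Suc k) \<in> homs C (sob S (Suc k)) (sob S k)"
    "face S (Suc k) (Suc k) \<in> homs C (sob S (Suc (Suc k))) (sob S (Suc k))"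
    "face S (Suc k) (Suc (Suc k)) \<in> homs C (sob S (Suc (Suc k))) (sob S (Suc k))" using face by auto
  have "\<nu> k \<cdot> (bd k \<cdot> bd (Suc k)) = face S k (Suc k) \<cdot> (\<nu> (Suc k) \<cdot> bd (Suc k))"
    using comp_assoc[OF bd_in bd_in nu_in, of k] nu_bd[of k] comp_assoc[OF bd_in nu_in f(1)] by simp
  also have "\<dots> = face S k (Suc k) \<cdot> (face S (Suc k) (Suc k) \<cdot> \<nu> (Suc (Suc k)))"
    using nu_bd[of "Suc k"] comp_assoc[OF nu_in f(3,1)] comp_assoc[OF nu_in f(2,1)] face_face[of "Suc k" "Suc k" k] by simp
  also have "\<dots> = \<nu> k \<cdot> \<one>\<^bsub>hom_group C (N (Suc (Suc k))) (N k)\<^esub>"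
    using nu_face[of "Suc k" "Suc k"] comp_one[OF sob_Ab sob_Ab f(1) N_obj] comp_one[OF N_Ab sob_Ab nu_in N_obj] by simp
  finally show "\<nu> k \<cdot> (bd k \<cdot> bd (Suc k)) = \<nu> k \<cdot> \<one>\<^bsub>hom_group C (N (Suc (Suc k))) (N k)\<^esub>" .
qed

text \<open>Only arrows out of \<open>sob S k\<close> can be lifted, so the argument passes through
  the retraction \<open>pi\<close> onto \<open>N k\<close>. The conclusion says that
  \<open>y\<close> is a generalised inverse of \<open>bd k\<close>; one in degree \<open>k\<close>
  provides a projection onto the cycles of degree \<open>Suc k\<close>, and lifting that projection
  gives the next one.\<close>

lemma bd_splits:
  assumes lift: "\<And>k x. k < n \<Longrightarrow> x \<in> homs C (sob S k) (N k) \<Longrightarrow>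
      (\<And>j. k = Suc j \<Longrightarrow> bd j \<cdot> x = \<one>\<^bsub>hom_group C (sob S k) (N j)\<^esub>) \<Longrightarrow>
      \<exists>y \<in> homs C (sob S k) (N (Suc k)). bd k \<cdot> y = x"
  shows "k < n \<Longrightarrow> \<exists>y \<in> homs C (N k) (N (Suc k)). bd k \<cdot> (y \<cdot> bd k) = bd k"
proof (induction k)
  case 0
  obtain y where y: "y \<in> homs C (sob S 0) (N (Suc 0))" "bd 0 \<cdot> y = pi 0"
    using lift[OF 0 pi(1)] by blast
  have "bd 0 \<cdot> ((y \<cdot> \<nu> 0) \<cdot> bd 0) = bd 0"
    using comp_assoc[OF comp_in[OF bd_in nu_in] y(1) bd_in] comp_assoc[OF bd_in nu_in y(1)] y(2)
      comp_assoc[OF bd_in nu_in pi(1)] pi_nu comp_idn[OF bd_in] by simp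
  then show ?case using y nu_in by blast
next
  case (Suc k)
  obtain y where y: "y \<in> homs C (N k) (N (Suc k))" "bd k \<cdot> (y \<cdot> bd k) = bd k"
    using Suc by auto
  interpret G: comm_group "hom_group C (N (Suc k)) (N (Suc k))" using comm_group_hom_group N_Ab N_obj by blast
  \<comment> \<open>The projection onto the cycles of \<open>N (Suc k)\<close>: \<open>bd k\<close>
    kills it, and it fixes boundaries.\<close>
  define \<rho> where "\<rho> = idn C (N (Suc k)) \<otimes>\<^bsub>hom_group C (N (Suc k)) (N (Suc k))\<^esub>
    inv\<^bsub>hom_group C (N (Suc k)) (N (Suc k))\<^esub> (y \<cdot> bd k)"
  have ybd: "y \<cdot> bd k \<in> homs C (N (Suc k)) (N (Suc k))" using y bd_in by blast
  have c: "idn C (N (Suc k)) \<in> carrier (hom_group C (N (Suc k)) (N (Suc k)))"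
    "y \<cdot> bd k \<in> carrier (hom_group C (N (Suc k)) (N (Suc k)))" using N_obj ybd by auto
  have "\<rho> \<in> carrier (hom_group C (N (Suc k)) (N (Suc k)))" unfolding \<rho>_def using c by (simp del: carrier_hom_group)
  then have \<rho>: "\<rho> \<in> homs C (N (Suc k)) (N (Suc k))" by simp
  interpret p: group_hom "hom_group C (N (Suc k)) (N (Suc k))" "hom_group C (N (Suc k)) (N k)" "\<lambda>g. bd k \<cdot> g"
    by (rule postcomp_group_hom[OF N_Ab N_Ab bd_in N_obj])
  have bd\<rho>: "bd k \<cdot> \<rho> = \<one>\<^bsub>hom_group C (N (Suc k)) (N k)\<^esub>"
    unfolding \<rho>_def using c y(2) comp_idn[OF bd_in] p.H.r_inv[of "bd k"] bd_in p.hom_mult[OF c(1) G.inv_closed[OF c(2)]]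
      p.hom_inv[OF c(2)] by simp
  interpret r: group_hom "hom_group C (N (Suc k)) (N (Suc k))" "hom_group C (N (Suc (Suc k))) (N (Suc k))" "\<lambda>g. g \<cdot> bd (Suc k)"
    by (rule precomp_group_hom[OF N_Ab bd_in])
  have "(y \<cdot> bd k) \<cdot> bd (Suc k) = \<one>\<^bsub>hom_group C (N (Suc (Suc k))) (N (Suc k))\<^esub>"
    using comp_assoc[OF bd_in bd_in y(1)] bd_bd comp_one[OF N_Ab N_Ab y(1) N_obj] by simp
  then have \<rho>bd: "\<rho> \<cdot> bd (Suc k) = bd (Suc k)"
    unfolding \<rho>_def using c comp_idn[OF bd_in] r.H.r_one[of "bd (Suc k)"] bd_in r.hom_mult[OF c(1) G.inv_closed[OF c(2)]]
      r.hom_inv[OF c(2)] by simp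
  obtain z where z: "z \<in> homs C (sob S (Suc k)) (N (Suc (Suc k)))" "bd (Suc k) \<cdot> z = \<rho> \<cdot> pi (Suc k)"
  proof -
    have "bd k \<cdot> (\<rho> \<cdot> pi (Suc k)) = \<one>\<^bsub>hom_group C (sob S (Suc k)) (N k)\<^esub>"
      using comp_assoc[OF pi(1) \<rho> bd_in] bd\<rho> one_comp[OF N_Ab pi(1)] by simp
    then show ?thesis using lift[OF Suc.prems comp_in[OF pi(1) \<rho>]] that by auto
  qed
  have "bd (Suc k) \<cdot> ((z \<cdot> \<nu> (Suc k)) \<cdot> bd (Suc k)) = ((\<rho> \<cdot> pi (Suc k)) \<cdot> \<nu> (Suc k)) \<cdot> bd (Suc k)"
    using comp_assoc[OF bd_in comp_in[OF nu_in z(1)] bd_in] comp_assoc[OF nu_in z(1) bd_in] z(2) by simp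
  also have "(\<rho> \<cdot> pi (Suc k)) \<cdot> \<nu> (Suc k) = \<rho>"
    using comp_assoc[OF nu_in pi(1) \<rho>] pi_nu comp_idn[OF \<rho>] by simp
  finally show ?case using \<rho>bd z(1) nu_in by (metis comp_in)
qed

end

text \<open>The degree of interest is \<open>n = Suc m\<close>, so that there is a differential
  \<open>bd m\<close> out of \<open>N n\<close>: \<open>Z\<close> is the object of cycles and
  \<open>L\<close> the homology there. Acyclicity below \<open>n\<close> is recorded only through
  \<open>split\<close>.\<close>

locale split_moore = moore C S N \<nu> bd
  for C :: "('o, 'a) cat" (structure) and S N \<nu> bd +
  fixes m :: nat and Z L :: 'o and \<zeta> b q :: 'a
  assumes cycles: "joint_kernel C {bd m} (N (Suc m)) Z \<zeta>"
    and boundary: "b \<in> homs C (N (Suc (Suc m))) Z" "\<zeta> \<cdot> b = bd (Suc m)"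
    and cokernel: "is_cokernel C b L q"
    and split: "\<exists>y \<in> homs C (N m) (N (Suc m)). bd m \<cdot> (y \<cdot> bd m) = bd m"
begin

lemma zeta_in: "\<zeta> \<in> homs C Z (N (Suc m))" and Z_obj: "Z \<in> obj C"
  using cycles by (auto simp: joint_kernel_def)

lemma bd_zeta: "bd m \<cdot> \<zeta> = \<one>\<^bsub>hom_group C Z (N m)\<^esub>"
  using cycles zero_arrow_iff[OF N_Ab comp_in[OF zeta_in bd_in]] by (simp add: joint_kernel_def)

lemma zeta_ex1:
  assumes "x \<in> homs C Y (N (Suc m))" "bd m \<cdot> x = \<one>\<^bsub>hom_group C Y (N m)\<^esub>"
  shows "\<exists>!u. u \<in> homs C Y Z \<and> \<zeta> \<cdot> u = x"
  using cycles assms homsD(4)[OF assms(1)] zero_arrow_one[OF N_Ab homsD(4)[OF assms(1)]]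
  by (simp add: joint_kernel_def)

lemma q_in: "q \<in> homs C Z L" and L_obj: "L \<in> obj C"
  using cokernelD[OF cokernel boundary(1)] homsD by auto

lemma nu_zeta_in: "\<nu> (Suc m) \<cdot> \<zeta> \<in> homs C Z (sob S (Suc m))"
  using comp_in[OF zeta_in nu_in] .

text \<open>The idempotent \<open>1 - y bd\<close> lands in the cycles and corestricts to
  \<open>\<rho>\<close>. The witness \<open>y\<close> is returned as well, because the complement of
  the cycles has to be expressed through \<open>bd m\<close> when a primitive is
  constructed.\<close>

lemma ex_retraction:
  obtains y \<rho> where "y \<in> homs C (N m) (N (Suc m))" "\<rho> \<in> homs C (N (Suc m)) Z" "\<rho> \<cdot> \<zeta> = idn C Z"
    "\<zeta> \<cdot> \<rho> = idn C (N (Suc m)) \<otimes>\<^bsub>hom_group C (N (Suc m)) (N (Suc m))\<^esub>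
       inv\<^bsub>hom_group C (N (Suc m)) (N (Suc m))\<^esub> (y \<cdot> bd m)"
proof -
  obtain y where y: "y \<in> homs C (N m) (N (Suc m))" "bd m \<cdot> (y \<cdot> bd m) = bd m" using split by blast
  interpret G: comm_group "hom_group C (N (Suc m)) (N (Suc m))" using comm_group_hom_group N_Ab N_obj by blast
  define r where "r = idn C (N (Suc m)) \<otimes>\<^bsub>hom_group C (N (Suc m)) (N (Suc m))\<^esub>
    inv\<^bsub>hom_group C (N (Suc m)) (N (Suc m))\<^esub> (y \<cdot> bd m)"
  have c: "idn C (N (Suc m)) \<in> carrier (hom_group C (N (Suc m)) (N (Suc m)))"
    "y \<cdot> bd m \<in> carrier (hom_group C (N (Suc m)) (N (Suc m)))" using N_obj y bd_in by auto
  have "r \<in> carrier (hom_group C (N (Suc m)) (N (Suc m)))" unfolding r_def using c by (simp del: carrier_hom_group)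
  then have r: "r \<in> homs C (N (Suc m)) (N (Suc m))" by simp
  interpret p: group_hom "hom_group C (N (Suc m)) (N (Suc m))" "hom_group C (N (Suc m)) (N m)" "\<lambda>g. bd m \<cdot> g"
    by (rule postcomp_group_hom[OF N_Ab N_Ab bd_in N_obj])
  have "bd m \<cdot> r = \<one>\<^bsub>hom_group C (N (Suc m)) (N m)\<^esub>"
    unfolding r_def using c y(2) comp_idn[OF bd_in] p.H.r_inv[of "bd m"] bd_in p.hom_mult[OF c(1) G.inv_closed[OF c(2)]]
      p.hom_inv[OF c(2)] by simp
  then obtain \<rho> where \<rho>: "\<rho> \<in> homs C (N (Suc m)) Z" "\<zeta> \<cdot> \<rho> = r" using zeta_ex1[OF r] by blast
  interpret c: group_hom "hom_group C (N (Suc m)) (N (Suc m))" "hom_group C Z (N (Suc m))" "\<lambda>g. g \<cdot> \<zeta>"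
    by (rule precomp_group_hom[OF N_Ab zeta_in])
  have "(y \<cdot> bd m) \<cdot> \<zeta> = \<one>\<^bsub>hom_group C Z (N (Suc m))\<^esub>"
    using comp_assoc[OF zeta_in bd_in y(1)] bd_zeta comp_one[OF N_Ab N_Ab y(1) Z_obj] by simp
  then have "r \<cdot> \<zeta> = \<zeta>"
    unfolding r_def using c comp_idn[OF zeta_in] c.H.r_one[of \<zeta>] zeta_in c.hom_mult[OF c(1) G.inv_closed[OF c(2)]]
      c.hom_inv[OF c(2)] by simp
  then have "\<zeta> \<cdot> (\<rho> \<cdot> \<zeta>) = \<zeta>" using comp_assoc[OF zeta_in \<rho>(1) zeta_in] \<rho>(2) by simp
  then have "\<rho> \<cdot> \<zeta> = idn C Z"
    using zeta_ex1[OF zeta_in bd_zeta] comp_in[OF zeta_in \<rho>(1)] idn_in[OF Z_obj] comp_idn[OF zeta_in] by metis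
  then show ?thesis using that y(1) \<rho> unfolding r_def by blast
qed

end

locale split_cochains = split_moore C S N \<nu> bd m Z L \<zeta> b q + cochains C S A
  for C :: "('o, 'a) cat" (structure) and S N \<nu> bd m Z L \<zeta> b q A
begin

text \<open>All faces but the last vanish on a Moore object; up to the sign of that face, cochains
  restrict to arrows out of the complex \<open>N\<close>.\<close>

lemma coboundary_nu:
  assumes f: "f \<in> homs C (sob S k) A"
  shows "coboundary C S A k f \<cdot> \<nu> (Suc k) = signed (hom_group C (N (Suc k)) A) (Suc k) (f \<cdot> (\<nu> k \<cdot> bd k))"
proof -
  interpret G: comm_group "hom_group C (N (Suc k)) A" using comm_group_hom_group A N_obj by blast
  let ?t = "\<lambda>i. f \<cdot> (face S k i \<cdot> \<nu> (Suc k))"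
  have "alt_sum (hom_group C (N (Suc k)) A) ?t (Suc k) = signed (hom_group C (N (Suc k)) A) (Suc k) (?t (Suc k))"
  proof (rule G.alt_sum_last)
    show "?t i = \<one>\<^bsub>hom_group C (N (Suc k)) A\<^esub>" if "i < Suc k" for i
      using nu_face[of i k] that comp_one[OF sob_Ab A f N_obj] by simp
    show "?t (Suc k) \<in> carrier (hom_group C (N (Suc k)) A)" using comp_in[OF comp_in[OF nu_in face] f] by simp
  qed
  then show ?thesis using coboundary_comp[OF f nu_in] nu_bd by simp
qed

lemma nu_bd_in: "\<nu> k \<cdot> bd k \<in> homs C (N (Suc k)) (sob S k)"
  using comp_in[OF bd_in nu_in] .

lemma coboundary_vanishes_on_cycles:
  assumes f: "f \<in> homs C (sob S m) A"
  shows "coboundary C S A m f \<cdot> (\<nu> (Suc m) \<cdot> \<zeta>) = \<one>\<^bsub>hom_group C Z A\<^esub>"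
proof -
  interpret p: group_hom "hom_group C (N (Suc m)) A" "hom_group C Z A" "\<lambda>g. g \<cdot> \<zeta>"
    by (rule precomp_group_hom[OF A zeta_in])
  interpret Z: comm_group "hom_group C Z A" using comm_group_hom_group A Z_obj by blast
  have c: "f \<cdot> (\<nu> m \<cdot> bd m) \<in> carrier (hom_group C (N (Suc m)) A)" using comp_in[OF nu_bd_in f] by simp
  have "(f \<cdot> (\<nu> m \<cdot> bd m)) \<cdot> \<zeta> = \<one>\<^bsub>hom_group C Z A\<^esub>"
    using comp_assoc[OF zeta_in nu_bd_in f] comp_assoc[OF zeta_in bd_in nu_in] bd_zeta
      comp_one[OF N_Ab sob_Ab nu_in Z_obj] comp_one[OF sob_Ab A f Z_obj] by simp
  then show ?thesis
    using comp_assoc[OF zeta_in nu_in coboundary_in[OF f]] coboundary_nu[OF f] p.hom_signed[OF c] by simp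
qed

lemma cocycle_vanishes_on_boundaries:
  assumes f: "f \<in> homs C (sob S (Suc m)) A"
    and cocycle: "coboundary C S A (Suc m) f = \<one>\<^bsub>H (Suc (Suc m))\<^esub>"
  shows "(f \<cdot> (\<nu> (Suc m) \<cdot> \<zeta>)) \<cdot> b = \<one>\<^bsub>hom_group C (N (Suc (Suc m))) A\<^esub>"
proof -
  interpret G: comm_group "hom_group C (N (Suc (Suc m))) A" using comm_group_hom_group A N_obj by blast
  have c: "f \<cdot> (\<nu> (Suc m) \<cdot> bd (Suc m)) \<in> carrier (hom_group C (N (Suc (Suc m))) A)"
    using comp_in[OF nu_bd_in f] by simp
  have "signed (hom_group C (N (Suc (Suc m))) A) (Suc (Suc m)) (f \<cdot> (\<nu> (Suc m) \<cdot> bd (Suc m)))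
      = \<one>\<^bsub>hom_group C (N (Suc (Suc m))) A\<^esub>"
    unfolding coboundary_nu[OF f, symmetric] cocycle by (rule one_comp[OF A nu_in])
  then have "f \<cdot> (\<nu> (Suc m) \<cdot> bd (Suc m)) = \<one>\<^bsub>hom_group C (N (Suc (Suc m))) A\<^esub>"
    using G.signed_signed[OF c, of "Suc (Suc m)"] by simp
  then show ?thesis
    using comp_assoc[OF boundary(1) nu_zeta_in f] comp_assoc[OF boundary(1) zeta_in nu_in] boundary(2) by simp
qed

text \<open>Normalised cochains are fixed by the Moore projection. Together with
  \<open>normalized_pi\<close> this identifies them with the arrows \<open>N (Suc k) -> A\<close>,
  so that equations between them can be tested after \<open>\<nu>\<close>.\<close>

lemma normalized_decompose:
  assumes "normalized k (Suc k) f"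
  shows "f = (f \<cdot> \<nu> (Suc k)) \<cdot> pi (Suc k)"
proof -
  have f: "f \<in> homs C (sob S (Suc k)) A" "\<And>i. i \<le> k \<Longrightarrow> f \<cdot> degen S k i = \<one>\<^bsub>H k\<^esub>"
    using assms by (auto simp: normalized_def)
  then have "f \<cdot> proj (Suc k) (Suc k) = f" using comp_proj[OF A f(1), of "Suc k"] by simp
  then show ?thesis using comp_assoc[OF pi(1) nu_in f(1)] pi(2) by simp
qed

lemma normalized_pi:
  assumes c: "c \<in> homs C (N (Suc k)) A"
  shows "normalized k (Suc k) (c \<cdot> pi (Suc k))"
  unfolding normalized_def
proof (intro conjI allI impI)
  show "c \<cdot> pi (Suc k) \<in> homs C (sob S (Suc k)) A" using comp_in[OF pi(1) c] .
  fix i assume "i < Suc k"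
  then have i: "i \<le> k" by simp
  show "c \<cdot> pi (Suc k) \<cdot> degen S k i = \<one>\<^bsub>H k\<^esub>"
    using comp_assoc[OF degen[OF i] pi(1) c] pi_degen[OF i] comp_one[OF N_Ab A c sob] by simp
qed

lemma coboundary_pi_normalized:
  assumes g: "g \<in> homs C (N k) A"
  shows "normalized k (Suc k) (coboundary C S A k (g \<cdot> pi k))"
proof (cases k)
  \<comment> \<open>A cochain of degree 0 has no degeneracies to vanish on, so
    \<open>coboundary_normalized\<close> does not apply; the only degeneracy is a section of both
    faces, and their terms cancel.\<close>
  case 0
  have f: "g \<cdot> pi k \<in> homs C (sob S 0) A" using comp_in[OF pi(1) g] 0 by simp
  interpret G: comm_group "H 0" by (rule H)
  have "alt_sum (H 0) (\<lambda>i. (g \<cdot> pi k) \<cdot> (face S 0 i \<cdot> degen S 0 0)) (Suc 0) = \<one>\<^bsub>H 0\<^esub>"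
    by (rule G.alt_sum_two[of _ 0])
      (use face_degen_eq[of 0 0] face_degen_Suc[of 0 0] comp_idn[OF f] f in auto)
  then show ?thesis
    using 0 coboundary_in[OF f] coboundary_comp[OF f degen[of 0 0]] by (simp add: normalized_def)
next
  case (Suc j)
  then show ?thesis using coboundary_normalized[OF normalized_pi] g by simp
qed

lemma normalized_eqI:
  assumes "normalized k (Suc k) f" "normalized k (Suc k) g" "f \<cdot> \<nu> (Suc k) = g \<cdot> \<nu> (Suc k)"
  shows "f = g"
  using normalized_decompose assms by metis

text \<open>Extend \<open>h \<cdot> q\<close> from the cycles to \<open>N (Suc m)\<close> along the
  retraction \<open>\<rho>\<close>, then to \<open>sob S (Suc m)\<close> along \<open>pi\<close>.
  The result is normalised, so the cocycle condition may be tested on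
  \<open>N (Suc (Suc m))\<close>, where it reduces to \<open>q \<cdot> b\<close> being zero.\<close>

lemma ex_cocycle:
  assumes h: "h \<in> homs C L A"
  obtains f where "f \<in> homs C (sob S (Suc m)) A" "coboundary C S A (Suc m) f = \<one>\<^bsub>H (Suc (Suc m))\<^esub>"
    "f \<cdot> (\<nu> (Suc m) \<cdot> \<zeta>) = h \<cdot> q"
proof -
  obtain y \<rho> where "y \<in> homs C (N m) (N (Suc m))" and \<rho>: "\<rho> \<in> homs C (N (Suc m)) Z" "\<rho> \<cdot> \<zeta> = idn C Z"
    using ex_retraction by metis
  have hq: "h \<cdot> q \<in> homs C Z A" using comp_in[OF q_in h] .
  define c where "c = (h \<cdot> q) \<cdot> \<rho>"
  have c: "c \<in> homs C (N (Suc m)) A" unfolding c_def using comp_in[OF \<rho>(1) hq] .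
  let ?f = "c \<cdot> pi (Suc m)"
  have f: "?f \<in> homs C (sob S (Suc m)) A" using comp_in[OF pi(1) c] .
  have f\<nu>: "?f \<cdot> \<nu> (Suc m) = c" using comp_assoc[OF nu_in pi(1) c] pi_nu comp_idn[OF c] by simp
  have c\<zeta>: "c \<cdot> \<zeta> = h \<cdot> q" unfolding c_def using comp_assoc[OF zeta_in \<rho>(1) hq] \<rho>(2) comp_idn[OF hq] by simp
  have f\<nu>\<zeta>: "?f \<cdot> (\<nu> (Suc m) \<cdot> \<zeta>) = h \<cdot> q" using comp_assoc[OF zeta_in nu_in f] f\<nu> c\<zeta> by simp
  interpret G: comm_group "hom_group C (N (Suc (Suc m))) A" using comm_group_hom_group A N_obj by blast
  have qb: "q \<cdot> b \<in> homs C (N (Suc (Suc m))) L" using comp_in[OF boundary(1) q_in] .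
  have "zero_arrow C (h \<cdot> (q \<cdot> b))"
    using zero_arrow_comp_left[OF cokernelD(2)[OF cokernel boundary(1)] qb h] .
  then have "h \<cdot> (q \<cdot> b) = \<one>\<^bsub>hom_group C (N (Suc (Suc m))) A\<^esub>"
    using zero_arrow_iff[OF A comp_in[OF qb h]] by simp
  then have "?f \<cdot> (\<nu> (Suc m) \<cdot> bd (Suc m)) = \<one>\<^bsub>hom_group C (N (Suc (Suc m))) A\<^esub>"
    using comp_assoc[OF boundary(1) nu_zeta_in f] comp_assoc[OF boundary(1) zeta_in nu_in] boundary(2)
      f\<nu>\<zeta> comp_assoc[OF boundary(1) q_in h] by simp
  then have 0: "coboundary C S A (Suc m) ?f \<cdot> \<nu> (Suc (Suc m)) = \<one>\<^bsub>hom_group C (N (Suc (Suc m))) A\<^esub>"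
    using coboundary_nu[OF f] by simp
  have "coboundary C S A (Suc m) ?f = \<one>\<^bsub>H (Suc (Suc m))\<^esub>"
    using normalized_decompose[OF coboundary_normalized[OF normalized_pi[OF c]]] 0 one_comp[OF A pi(1)] by simp
  then show ?thesis using that[OF f _ f\<nu>\<zeta>] by blast
qed

text \<open>After normalisation the cocycle amounts to an arrow \<open>c\<close> on
  \<open>N (Suc m)\<close> that vanishes on cycles. The identity of \<open>N (Suc m)\<close> is the
  sum of its cycle part and \<open>y \<cdot> bd m\<close>, so \<open>c\<close> factors through
  \<open>bd m\<close>, and the factor yields a primitive.\<close>

lemma cocycle_coboundary:
  assumes f: "f \<in> homs C (sob S (Suc m)) A"
    and cocycle: "coboundary C S A (Suc m) f = \<one>\<^bsub>H (Suc (Suc m))\<^esub>"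
    and zero: "f \<cdot> (\<nu> (Suc m) \<cdot> \<zeta>) = \<one>\<^bsub>hom_group C Z A\<^esub>"
  obtains u where "u \<in> homs C (sob S m) A" "coboundary C S A m u = f"
proof -
  interpret Hm: comm_group "H m" by (rule H)
  interpret H: comm_group "H (Suc m)" by (rule H)
  interpret \<delta>: group_hom "H m" "H (Suc m)" "coboundary C S A m" by (rule coboundary_hom)
  obtain u where u: "u \<in> homs C (sob S m) A"
    and n: "normalized m (Suc m) (f \<otimes>\<^bsub>H (Suc m)\<^esub> inv\<^bsub>H (Suc m)\<^esub> coboundary C S A m u)"
    using ex_normalized[OF f cocycle] by blast
  define f' where "f' = f \<otimes>\<^bsub>H (Suc m)\<^esub> inv\<^bsub>H (Suc m)\<^esub> coboundary C S A m u"
  have n': "normalized m (Suc m) f'" using n unfolding f'_def .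
  then have f': "f' \<in> homs C (sob S (Suc m)) A" by (simp add: normalized_def)
  have fc: "f \<in> carrier (H (Suc m))" "coboundary C S A m u \<in> carrier (H (Suc m))"
    using f coboundary_in[OF u] by auto
  interpret p: group_hom "H (Suc m)" "hom_group C Z A" "\<lambda>g. g \<cdot> (\<nu> (Suc m) \<cdot> \<zeta>)"
    by (rule precomp_group_hom[OF A nu_zeta_in])
  have "f' \<cdot> (\<nu> (Suc m) \<cdot> \<zeta>) = \<one>\<^bsub>hom_group C Z A\<^esub>"
    unfolding f'_def using fc zero coboundary_vanishes_on_cycles[OF u] by (simp del: carrier_hom_group)
  then have f'\<zeta>: "(f' \<cdot> \<nu> (Suc m)) \<cdot> \<zeta> = \<one>\<^bsub>hom_group C Z A\<^esub>" using comp_assoc[OF zeta_in nu_in f'] by simp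
  define c where "c = f' \<cdot> \<nu> (Suc m)"
  have c: "c \<in> homs C (N (Suc m)) A" unfolding c_def using comp_in[OF nu_in f'] .
  obtain y \<rho> where y: "y \<in> homs C (N m) (N (Suc m))" and \<rho>: "\<rho> \<in> homs C (N (Suc m)) Z"
    and \<zeta>\<rho>: "\<zeta> \<cdot> \<rho> = idn C (N (Suc m)) \<otimes>\<^bsub>hom_group C (N (Suc m)) (N (Suc m))\<^esub>
       inv\<^bsub>hom_group C (N (Suc m)) (N (Suc m))\<^esub> (y \<cdot> bd m)"
    using ex_retraction by metis
  interpret G: comm_group "hom_group C (N (Suc m)) A" using comm_group_hom_group A N_obj by blast
  interpret pc: group_hom "hom_group C (N (Suc m)) (N (Suc m))" "hom_group C (N (Suc m)) A" "\<lambda>g. c \<cdot> g"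
    by (rule postcomp_group_hom[OF N_Ab A c N_obj])
  have ybd: "idn C (N (Suc m)) \<in> carrier (hom_group C (N (Suc m)) (N (Suc m)))"
    "y \<cdot> bd m \<in> carrier (hom_group C (N (Suc m)) (N (Suc m)))" using N_obj y bd_in by auto
  have "c \<cdot> (\<zeta> \<cdot> \<rho>) = \<one>\<^bsub>hom_group C (N (Suc m)) A\<^esub>"
    using comp_assoc[OF \<rho> zeta_in c] f'\<zeta> one_comp[OF A \<rho>] unfolding c_def by simp
  then have "c \<otimes>\<^bsub>hom_group C (N (Suc m)) A\<^esub> inv\<^bsub>hom_group C (N (Suc m)) A\<^esub> (c \<cdot> (y \<cdot> bd m)) = \<one>\<^bsub>hom_group C (N (Suc m)) A\<^esub>"
    unfolding \<zeta>\<rho> using ybd comp_idn[OF c] by (simp del: carrier_hom_group)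
  then have cy: "c = (c \<cdot> y) \<cdot> bd m"
    using G.inv_equality[of c "inv\<^bsub>hom_group C (N (Suc m)) A\<^esub> (c \<cdot> (y \<cdot> bd m))"] pc.hom_closed[OF ybd(2)]
      c comp_assoc[OF bd_in y c] G.inv_inv G.inv_closed by simp
  \<comment> \<open>The sign compensates for that of the last face in
    \<open>coboundary_nu\<close>.\<close>
  define g where "g = signed (hom_group C (N m) A) (Suc m) (c \<cdot> y)"
  interpret Nm: comm_group "hom_group C (N m) A" using comm_group_hom_group A N_obj by blast
  have cyc: "c \<cdot> y \<in> carrier (hom_group C (N m) A)" using comp_in[OF y c] by simp
  have "g \<in> carrier (hom_group C (N m) A)" unfolding g_def using cyc by (rule Nm.signed_closed)
  then have g: "g \<in> homs C (N m) A" by simp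
  interpret bdh: group_hom "hom_group C (N m) A" "hom_group C (N (Suc m)) A" "\<lambda>g. g \<cdot> bd m"
    by (rule precomp_group_hom[OF A bd_in])
  have gpi: "g \<cdot> pi m \<in> homs C (sob S m) A" using comp_in[OF pi(1) g] .
  have "(g \<cdot> pi m) \<cdot> (\<nu> m \<cdot> bd m) = g \<cdot> bd m"
    using comp_assoc[OF bd_in nu_in gpi] comp_assoc[OF nu_in pi(1) g] pi_nu comp_idn[OF g] by simp
  also have "\<dots> = signed (hom_group C (N (Suc m)) A) (Suc m) c"
    unfolding g_def using bdh.hom_signed[OF cyc] cy by simp
  finally have "coboundary C S A m (g \<cdot> pi m) \<cdot> \<nu> (Suc m) = f' \<cdot> \<nu> (Suc m)"
    using coboundary_nu[OF gpi] G.signed_signed[of c "Suc m"] c unfolding c_def by simp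
  then have "coboundary C S A m (g \<cdot> pi m) = f'"
    by (rule normalized_eqI[OF coboundary_pi_normalized[OF g] n'])
  then have *: "f \<otimes>\<^bsub>H (Suc m)\<^esub> inv\<^bsub>H (Suc m)\<^esub> coboundary C S A m u = coboundary C S A m (g \<cdot> pi m)"
    unfolding f'_def by simp
  have uc: "u \<in> carrier (H m)" "g \<cdot> pi m \<in> carrier (H m)" using u gpi by auto
  \<comment> \<open>Adding \<open>u\<close> back undoes the normalisation.\<close>
  have "coboundary C S A m ((g \<cdot> pi m) \<otimes>\<^bsub>H m\<^esub> u)
      = (f \<otimes>\<^bsub>H (Suc m)\<^esub> inv\<^bsub>H (Suc m)\<^esub> coboundary C S A m u) \<otimes>\<^bsub>H (Suc m)\<^esub> coboundary C S A m u"
    unfolding * using uc by (simp del: carrier_hom_group)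
  also have "\<dots> = f" using fc by (simp del: carrier_hom_group add: H.m_assoc)
  finally show ?thesis using that[of "(g \<cdot> pi m) \<otimes>\<^bsub>H m\<^esub> u"] Hm.m_closed[OF uc(2,1)] by simp
qed

end

section \<open>Natural equivalences of functors to abelian groups\<close>

text \<open>Commutativity and functoriality are transferred from \<open>F\<close> to
  \<open>G\<close> along the injective maps \<open>\<kappa>\<close>, which spares a direct
  verification on quotient groups; the equivalence itself consists of the inverses of
  \<open>\<kappa>\<close>.\<close>

lemma naturally_equivalent_by_iso:
  assumes D: "category D" and F: "is_ab_functor D F"
    and grp: "\<And>A. A \<in> obj D \<Longrightarrow> group (fob G A)"
    and iso: "\<And>A. A \<in> obj D \<Longrightarrow> \<kappa> A \<in> iso (fob G A) (fob F A)"
    and nat: "\<And>a x. a \<in> arr D \<Longrightarrow> x \<in> carrier (fob G (src D a)) \<Longrightarrow>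
      farr G a x \<in> carrier (fob G (tgt D a)) \<and> \<kappa> (tgt D a) (farr G a x) = farr F a (\<kappa> (src D a) x)"
  shows "naturally_equivalent D F G"
proof -
  have ob: "src D a \<in> obj D" "tgt D a \<in> obj D" if "a \<in> arr D" for a
    using D that by (auto simp: category_def)
  have id: "idn D A \<in> arr D" "src D (idn D A) = A" "tgt D (idn D A) = A" if "A \<in> obj D" for A
    using D that by (auto simp: category_def homs_def)
  have comp: "b \<cdot>\<^bsub>D\<^esub> a \<in> arr D" "src D (b \<cdot>\<^bsub>D\<^esub> a) = src D a" "tgt D (b \<cdot>\<^bsub>D\<^esub> a) = tgt D b"
    if "a \<in> arr D" "b \<in> arr D" "tgt D a = src D b" for a b
    using D that by (auto simp: category_def homs_def)
  have inj: "inj_on (\<kappa> A) (carrier (fob G A))" if "A \<in> obj D" for A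
    using iso[OF that] by (simp add: iso_def bij_betw_def)
  have \<kappa>in: "\<kappa> A x \<in> carrier (fob F A)" if "A \<in> obj D" "x \<in> carrier (fob G A)" for A x
    using iso[OF that(1)] that(2) by (auto simp: iso_def hom_def)
  have \<kappa>mult: "\<kappa> A (x \<otimes>\<^bsub>fob G A\<^esub> y) = \<kappa> A x \<otimes>\<^bsub>fob F A\<^esub> \<kappa> A y"
    if "A \<in> obj D" "x \<in> carrier (fob G A)" "y \<in> carrier (fob G A)" for A x y
    using iso[OF that(1)] that by (auto simp: iso_def hom_def)
  have cF: "comm_group (fob F A)" and idF: "x \<in> carrier (fob F A) \<Longrightarrow> farr F (idn D A) x = x" if "A \<in> obj D" for A x
    using F that by (auto simp: is_ab_functor_def)
  have homF: "farr F a \<in> hom (fob F (src D a)) (fob F (tgt D a))" if "a \<in> arr D" for a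
    using F that by (auto simp: is_ab_functor_def)
  have compF: "farr F (b \<cdot>\<^bsub>D\<^esub> a) x = farr F b (farr F a x)"
    if "a \<in> arr D" "b \<in> arr D" "tgt D a = src D b" "x \<in> carrier (fob F (src D a))" for a b x
    using F that by (auto simp: is_ab_functor_def)
  have Gclosed: "x \<otimes>\<^bsub>fob G A\<^esub> y \<in> carrier (fob G A)"
    if "A \<in> obj D" "x \<in> carrier (fob G A)" "y \<in> carrier (fob G A)" for A x y
    using grp[OF that(1)] that by (simp add: group.subgroup_self subgroup.m_closed)
  have "is_ab_functor D G"
    unfolding is_ab_functor_def
  proof (intro conjI ballI impI)
    fix A assume A: "A \<in> obj D"
    interpret group "fob G A" by (rule grp[OF A])
    interpret F: comm_group "fob F A" by (rule cF[OF A])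
    show "comm_group (fob G A)"
    proof (rule group_comm_groupI)
      fix x y assume xy: "x \<in> carrier (fob G A)" "y \<in> carrier (fob G A)"
      show "x \<otimes>\<^bsub>fob G A\<^esub> y = y \<otimes>\<^bsub>fob G A\<^esub> x"
        using inj_onD[OF inj[OF A], of "x \<otimes>\<^bsub>fob G A\<^esub> y" "y \<otimes>\<^bsub>fob G A\<^esub> x"] \<kappa>mult[OF A] xy
          F.m_comm[OF \<kappa>in[OF A xy(1)] \<kappa>in[OF A xy(2)]] by simp
    qed
    fix x assume x: "x \<in> carrier (fob G A)"
    show "farr G (idn D A) x = x"
      using inj_onD[OF inj[OF A], of "farr G (idn D A) x" x] nat[OF id(1)[OF A], of x] id[OF A] x
        idF[OF A \<kappa>in[OF A x]] by simp
  next
    fix a assume a: "a \<in> arr D"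
    note o = ob[OF a]
    show "farr G a \<in> hom (fob G (src D a)) (fob G (tgt D a))"
    proof (rule homI)
      fix x y assume xy: "x \<in> carrier (fob G (src D a))" "y \<in> carrier (fob G (src D a))"
      note n = nat[OF a xy(1)] nat[OF a xy(2)] nat[OF a Gclosed[OF o(1) xy]]
      have "\<kappa> (tgt D a) (farr G a (x \<otimes>\<^bsub>fob G (src D a)\<^esub> y))
          = \<kappa> (tgt D a) (farr G a x \<otimes>\<^bsub>fob G (tgt D a)\<^esub> farr G a y)"
        using n \<kappa>mult[OF o(1) xy] \<kappa>mult[OF o(2)] hom_mult[OF homF[OF a] \<kappa>in[OF o(1) xy(1)] \<kappa>in[OF o(1) xy(2)]]
        by simp
      then show "farr G a (x \<otimes>\<^bsub>fob G (src D a)\<^esub> y) = farr G a x \<otimes>\<^bsub>fob G (tgt D a)\<^esub> farr G a y"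
        using inj_onD[OF inj[OF o(2)]] n Gclosed[OF o(2)] by blast
    qed (use nat[OF a] in blast)
  next
    fix a b x assume a: "a \<in> arr D" and b: "b \<in> arr D" and ab: "tgt D a = src D b" and x: "x \<in> carrier (fob G (src D a))"
    note c = comp[OF a b ab]
    have ga: "farr G a x \<in> carrier (fob G (src D b))" using nat[OF a x] ab by simp
    have "\<kappa> (tgt D b) (farr G (b \<cdot>\<^bsub>D\<^esub> a) x) = \<kappa> (tgt D b) (farr G b (farr G a x))"
      using nat[OF c(1)] nat[OF b ga] nat[OF a x] c x compF[OF a b ab \<kappa>in[OF ob(1)[OF a] x]] ab by simp
    then show "farr G (b \<cdot>\<^bsub>D\<^esub> a) x = farr G b (farr G a x)"
      using inj_onD[OF inj[OF ob(2)[OF b]]] nat[OF c(1)] nat[OF b ga] c x by simp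
  qed
  moreover have "inv_into (carrier (fob G A)) (\<kappa> A) \<in> iso (fob F A) (fob G A)" if "A \<in> obj D" for A
    using group.iso_set_sym[OF grp iso] that by blast
  moreover have "inv_into (carrier (fob G (tgt D a))) (\<kappa> (tgt D a)) (farr F a x)
      = farr G a (inv_into (carrier (fob G (src D a))) (\<kappa> (src D a)) x)"
    if a: "a \<in> arr D" and x: "x \<in> carrier (fob F (src D a))" for a x
  proof -
    have "x \<in> \<kappa> (src D a) ` carrier (fob G (src D a))"
      using iso[OF ob(1)[OF a]] x by (simp add: iso_def bij_betw_def)
    then obtain y where y: "y \<in> carrier (fob G (src D a))" "\<kappa> (src D a) y = x" by blast
    then show ?thesis
      using nat[OF a y(1)] inv_into_f_f[OF inj[OF ob(1)[OF a]] y(1)] inv_into_f_f[OF inj[OF ob(2)[OF a]]] by metis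
  qed
  ultimately show ?thesis using F unfolding naturally_equivalent_def
    by (intro conjI exI[of _ "\<lambda>A. inv_into (carrier (fob G A)) (\<kappa> A)"]) auto
qed

section \<open>Derived functors and cohomology\<close>

context abelian_reflection
begin

lemma moore_complexE:
  assumes S: "simplicial_object C S" and SR: "\<And>k. sob S k \<in> R" and "moore_complex C S N bd"
  obtains \<nu> where "moore C S N \<nu> bd" "\<And>k. N k \<in> R"
proof -
  obtain \<nu> where jk: "\<And>k. joint_kernel C (case k of 0 \<Rightarrow> {} | Suc j \<Rightarrow> face S j ` {..j}) (sob S k) (N k) (\<nu> k)"
    and bd: "\<And>k. bd k \<in> homs C (N (Suc k)) (N k)" "\<And>k. \<nu> k \<cdot> bd k = face S k (Suc k) \<cdot> \<nu> (Suc k)"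
    using assms(3) unfolding moore_complex_def by blast
  have N: "N k \<in> R" for k
  proof (rule joint_kernel_in[OF jk SR])
    fix f assume "f \<in> (case k of 0 \<Rightarrow> {} | Suc j \<Rightarrow> face S j ` {..j})"
    then obtain i j where "f = face S j i" "i \<le> j" by (auto split: nat.splits)
    moreover have "face S j i \<in> homs C (sob S (Suc j)) (sob S j)" if "i \<le> j" for i j
      using S that by (auto simp: simplicial_object_def)
    ultimately show "tgt C f \<in> R" using SR homsD by metis
  qed
  have "moore C S N \<nu> bd"
    by unfold_locales (use S SR in_Ab jk bd N in auto)
  then show ?thesis using that N by blast
qed

lemma sob_map: "sob (map_simpl To Ta P) k = To (sob P k)"
  and face_map: "face (map_simpl To Ta P) k i = Ta (face P k i)"
  by (simp_all add: map_simpl_def)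

text \<open>Acyclicity provides some Moore complex \<open>N'\<close> with zero homology in degree
  \<open>k\<close>, possibly different from the given \<open>N\<close>. Both sit inside the same
  simplicial object, so \<open>x\<close> is carried over to \<open>N'\<close>, lifted there, and the
  lift is carried back.\<close>

lemma acyclic_lift:
  assumes P: "simplicial_object C P" and proj: "projective_object C (sob P k)"
    and M: "moore C (map_simpl To Ta P) N \<nu> bd"
    and L: "moore_homology C (map_simpl To Ta P) k L" "zero_object C L"
    and x: "x \<in> homs C (sob (map_simpl To Ta P) k) (N k)"
    and cycle: "\<And>j. k = Suc j \<Longrightarrow> bd j \<cdot> x = \<one>\<^bsub>hom_group C (sob (map_simpl To Ta P) k) (N j)\<^esub>"
  shows "\<exists>y \<in> homs C (sob (map_simpl To Ta P) k) (N (Suc k)). bd k \<cdot> y = x"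
proof -
  define S where "S = map_simpl To Ta P"
  note [folded S_def] = M L x cycle
  note M = this(1) and L = this(2,3) and x = this(4) and cycle = this(5)
  have oP: "sob P k \<in> obj C" for k using P by (simp add: simplicial_object_def)
  have SR: "sob S k \<in> R" for k using To_in oP by (simp add: S_def sob_map)
  have S: "simplicial_object C S" unfolding S_def by (rule simplicial_map[OF P])
  obtain N' bd' where "moore_complex C S N' bd'" and h: "homology_object C N' bd' k L"
    using L(1) unfolding moore_homology_def by blast
  then obtain \<nu>' where M': "moore C S N' \<nu>' bd'" and NR: "\<And>k. N' k \<in> R"
    using moore_complexE[OF S SR] by metis
  interpret M: moore C S N \<nu> bd by (rule M)
  interpret M': moore C S N' \<nu>' bd' by (rule M')
  obtain Z \<zeta> b q where jk: "joint_kernel C (case k of 0 \<Rightarrow> {} | Suc j \<Rightarrow> {bd' j}) (N' k) Z \<zeta>"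
    and b: "b \<in> homs C (N' (Suc k)) Z" "\<zeta> \<cdot> b = bd' k" and coker: "is_cokernel C b L q"
    using h unfolding homology_object_def by blast
  have ZR: "Z \<in> R"
    by (rule joint_kernel_in[OF jk NR]) (use NR homsD[OF M'.bd_in] in \<open>auto split: nat.splits\<close>)
  have \<zeta>: "\<zeta> \<in> homs C Z (N' k)" using jk by (simp add: joint_kernel_def)
  obtain x' where x': "x' \<in> homs C (sob S k) (N' k)" "\<nu>' k \<cdot> x' = \<nu> k \<cdot> x"
    using M'.nu_ex1[OF comp_in[OF x M.nu_in] M.face_nu_comp[OF x]] by blast
  have "bd' j \<cdot> x' = \<one>\<^bsub>hom_group C (sob S k) (N' j)\<^esub>" if k: "k = Suc j" for j
  proof (rule M'.nu_cancel)
    show "bd' j \<cdot> x' \<in> homs C (sob S k) (N' j)" using x'(1) M'.bd_in k by blast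
    show "\<one>\<^bsub>hom_group C (sob S k) (N' j)\<^esub> \<in> homs C (sob S k) (N' j)" using one_in[OF M'.N_Ab M.sob] .
    have d: "face S j k \<in> homs C (sob S k) (sob S j)" using M.face[of k j] k by simp
    have x1: "x \<in> homs C (sob S k) (N (Suc j))" "x' \<in> homs C (sob S k) (N' (Suc j))" using x x' k by auto
    have "\<nu>' j \<cdot> (bd' j \<cdot> x') = face S j k \<cdot> (\<nu>' k \<cdot> x')"
      using comp_assoc[OF x1(2) M'.bd_in M'.nu_in] M'.nu_bd[of j] comp_assoc[OF x'(1) M'.nu_in d] k by simp
    also have "\<dots> = \<nu> j \<cdot> (bd j \<cdot> x)"
      using comp_assoc[OF x1(1) M.bd_in M.nu_in] M.nu_bd[of j] comp_assoc[OF x M.nu_in d] k x'(2) by simp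
    also have "\<dots> = \<nu>' j \<cdot> \<one>\<^bsub>hom_group C (sob S k) (N' j)\<^esub>"
      using cycle[OF k] comp_one[OF M.N_Ab M.sob_Ab M.nu_in M.sob] comp_one[OF M'.N_Ab M.sob_Ab M'.nu_in M.sob] by simp
    finally show "\<nu>' j \<cdot> (bd' j \<cdot> x') = \<nu>' j \<cdot> \<one>\<^bsub>hom_group C (sob S k) (N' j)\<^esub>" .
  qed
  then have "\<forall>f \<in> (case k of 0 \<Rightarrow> {} | Suc j \<Rightarrow> {bd' j}). zero_arrow C (f \<cdot> x')"
    using zero_arrow_one[OF M'.N_Ab M.sob] by (auto split: nat.splits)
  then have "\<exists>!u. u \<in> homs C (sob S k) Z \<and> \<zeta> \<cdot> u = x'"
    using jk x'(1) M.sob by (simp add: joint_kernel_def)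
  then obtain x'' where x'': "x'' \<in> homs C (sob S k) Z" "\<zeta> \<cdot> x'' = x'" by blast
  have \<eta>: "\<eta> (sob P k) \<in> homs C (sob P k) (sob S k)" using unit_in[OF oP] by (simp add: S_def sob_map)
  \<comment> \<open>Projectivity is known for \<open>sob P k\<close>, not for
    \<open>sob S k\<close>, so the lift is made after composing with the unit. It then extends along
    the unit since \<open>N' (Suc k)\<close> is in \<open>R\<close>, and uniqueness of extensions
    restores the equation on \<open>sob S k\<close>.\<close>
  obtain y0 where y0: "y0 \<in> homs C (sob P k) (N' (Suc k))" "b \<cdot> y0 = x'' \<cdot> \<eta> (sob P k)"
    by (rule zero_cokernel_lift[OF in_Ab[OF NR] in_Ab[OF ZR] b(1) coker L(2) proj comp_in[OF \<eta> x''(1)]])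
  obtain y' where y': "y' \<in> homs C (sob S k) (N' (Suc k))" "y' \<cdot> \<eta> (sob P k) = y0"
    using extend[OF y0(1) NR] by (metis S_def sob_map)
  have "(b \<cdot> y') \<cdot> \<eta> (sob P k) = x'' \<cdot> \<eta> (sob P k)" using comp_assoc[OF \<eta> y'(1) b(1)] y'(2) y0(2) by simp
  then have by': "b \<cdot> y' = x''"
    using extend_unique[OF oP ZR, of "b \<cdot> y'" k x''] comp_in[OF y'(1) b(1)] x''(1) by (simp add: S_def sob_map)
  obtain y where y: "y \<in> homs C (sob S k) (N (Suc k))" "\<nu> (Suc k) \<cdot> y = \<nu>' (Suc k) \<cdot> y'"
    using M.nu_ex1[OF comp_in[OF y'(1) M'.nu_in] M'.face_nu_comp[OF y'(1)]] by blast
  have d: "face S k (Suc k) \<in> homs C (sob S (Suc k)) (sob S k)" using M.face by blast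
  have "\<nu> k \<cdot> (bd k \<cdot> y) = face S k (Suc k) \<cdot> (\<nu>' (Suc k) \<cdot> y')"
    using comp_assoc[OF y(1) M.bd_in M.nu_in] M.nu_bd[of k] comp_assoc[OF y(1) M.nu_in d] y(2) by simp
  also have "\<dots> = \<nu>' k \<cdot> (bd' k \<cdot> y')"
    using comp_assoc[OF y'(1) M'.bd_in M'.nu_in] M'.nu_bd[of k] comp_assoc[OF y'(1) M'.nu_in d] by simp
  also have "bd' k \<cdot> y' = x'" using comp_assoc[OF y'(1) b(1) \<zeta>] b(2) by' x''(2) by simp
  finally have "\<nu> k \<cdot> (bd k \<cdot> y) = \<nu> k \<cdot> x" using x'(2) by simp
  then have "bd k \<cdot> y = x" using M.nu_cancel[OF comp_in[OF y(1) M.bd_in] x] by blast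
  then show ?thesis using y(1) unfolding S_def by blast
qed

lemma Hom_functor_ab:
  assumes L: "L \<in> obj C"
  shows "is_ab_functor (full_subcat C R) (Hom_functor C L)"
proof -
  have arr: "a \<in> homs C (src C a) (tgt C a)" if "a \<in> arr (full_subcat C R)" for a
    using that by (simp add: full_subcat_def homs_def)
  show ?thesis
    unfolding is_ab_functor_def Hom_functor_def ab_functor.simps
  proof (intro conjI ballI impI)
    fix A assume "A \<in> obj (full_subcat C R)"
    then have A: "A \<in> R" by (simp add: full_subcat_def)
    show "comm_group (hom_group C L A)" using comm_group_hom_group in_Ab A L by blast
    fix x assume "x \<in> carrier (hom_group C L A)"
    then show "idn (full_subcat C R) A \<cdot> x = x" using comp_idn by (simp add: full_subcat_def)
  next
    fix a assume a: "a \<in> arr (full_subcat C R)"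
    then have "src C a \<in> R" "tgt C a \<in> R" by (auto simp: full_subcat_def)
    then show "(\<lambda>f. a \<cdot> f) \<in> hom (hom_group C L (src (full_subcat C R) a)) (hom_group C L (tgt (full_subcat C R) a))"
      using postcomp_hom[OF in_Ab in_Ab arr[OF a]] by (simp add: full_subcat_def)
  next
    fix a b x assume a: "a \<in> arr (full_subcat C R)" and b: "b \<in> arr (full_subcat C R)"
      and ab: "tgt (full_subcat C R) a = src (full_subcat C R) b"
      and x: "x \<in> carrier (hom_group C L (src (full_subcat C R) a))"
    have "tgt C a = src C b" "x \<in> homs C L (src C a)" using ab x by (auto simp: full_subcat_def)
    then show "(b \<cdot>\<^bsub>full_subcat C R\<^esub> a) \<cdot> x = b \<cdot> (a \<cdot> x)"
      using comp_assoc[of x L "src C a" a "src C b" b] arr[OF a] arr[OF b] by (simp add: full_subcat_def)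
  qed
qed

lemma category_full_subcat: "category (full_subcat C R)"
  using category in_obj unfolding category_def full_subcat_def homs_def by simp

end

locale resolved = abelian_reflection C R To Ta \<eta> + split_moore C "map_simpl To Ta P" N \<nu> bd m Z L \<zeta> b q
  for C :: "('o, 'a) cat" (structure) and R To Ta \<eta> P N \<nu> bd m Z L \<zeta> b q +
  assumes P: "simplicial_object C P"
begin

section \<open>Comparison of the cochains of \<open>P\<close> and \<open>T P\<close>\<close>

abbreviation S where "S \<equiv> map_simpl To Ta P"

abbreviation unit where "unit k \<equiv> \<eta> (sob P k)"

lemma P_obj: "sob P k \<in> obj C"
  using P by (simp add: simplicial_object_def)

lemma P_unit: "unit k \<in> homs C (sob P k) (sob S k)"
  using unit_in[OF P_obj] by (simp add: sob_map)

lemma split_cochains: "A \<in> R \<Longrightarrow> split_cochains C S N \<nu> bd m Z L \<zeta> b q A"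
  using in_Ab by unfold_locales

lemma cochains_S: "A \<in> R \<Longrightarrow> cochains C S A"
  using in_Ab by unfold_locales

lemma cochains_P: "A \<in> R \<Longrightarrow> cochains C P A"
  using in_Ab P by unfold_locales

lemma lift_cochain:
  assumes "A \<in> R" "f \<in> homs C (sob P k) A"
  obtains g where "g \<in> homs C (sob S k) A" "g \<cdot> unit k = f"
  using extend[OF assms(2,1)] that by (metis sob_map)

lemma unit_cancel:
  assumes "A \<in> R" "g \<in> homs C (sob S k) A" "g' \<in> homs C (sob S k) A" "g \<cdot> unit k = g' \<cdot> unit k"
  shows "g = g'"
  using extend_unique[OF P_obj assms(1)] assms(2-4) by (simp add: sob_map)

text \<open>Naturality of the unit turns faces of \<open>P\<close> into faces of \<open>T P\<close>;
  so composition with the unit identifies the two cochain complexes with values in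
  \<open>A\<close>.\<close>

lemma coboundary_unit:
  assumes A: "A \<in> R" and g: "g \<in> homs C (sob S k) A"
  shows "coboundary C P A k (g \<cdot> unit k) = coboundary C S A k g \<cdot> unit (Suc k)"
proof -
  interpret S: cochains C S A by (rule cochains_S[OF A])
  interpret P: cochains C P A by (rule cochains_P[OF A])
  interpret G: comm_group "hom_group C (sob P (Suc k)) A" by (rule P.H)
  have "coboundary C P A k (g \<cdot> unit k) = alt_sum (hom_group C (sob P (Suc k)) A) (\<lambda>i. (g \<cdot> unit k) \<cdot> face P k i) (Suc k)"
    by (rule P.coboundary_alt_sum[OF comp_in[OF P_unit g]])
  also have "\<dots> = alt_sum (hom_group C (sob P (Suc k)) A) (\<lambda>i. g \<cdot> (face S k i \<cdot> unit (Suc k))) (Suc k)"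
  proof (rule G.alt_sum_cong)
    fix i assume "i \<le> Suc k"
    note f = P.face[OF this]
    show "(g \<cdot> unit k) \<cdot> face P k i = g \<cdot> (face S k i \<cdot> unit (Suc k))"
      using comp_assoc[OF f P_unit g] unit_natural[OF homsD(1)[OF f]] homsD[OF f] by (simp add: face_map)
  qed
  also have "\<dots> = coboundary C S A k g \<cdot> unit (Suc k)"
    using S.coboundary_comp[OF g P_unit] by simp
  finally show ?thesis .
qed

lemma cocycles_iff:
  "f \<in> cocycles C P A k \<longleftrightarrow> f \<in> homs C (sob P k) A \<and> coboundary C P A k f = \<one>\<^bsub>hom_group C (sob P (Suc k)) A\<^esub>"
  by (simp add: cocycles_def kernel_def)

lemma unit_cocycle:
  assumes A: "A \<in> R" and g: "g \<in> homs C (sob S k) A"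
  shows "g \<cdot> unit k \<in> cocycles C P A k \<longleftrightarrow> coboundary C S A k g = \<one>\<^bsub>hom_group C (sob S (Suc k)) A\<^esub>"
proof -
  interpret S: cochains C S A by (rule cochains_S[OF A])
  have one: "\<one>\<^bsub>hom_group C (sob S (Suc k)) A\<^esub> \<cdot> unit (Suc k) = \<one>\<^bsub>hom_group C (sob P (Suc k)) A\<^esub>"
    by (rule one_comp[OF in_Ab[OF A] P_unit])
  show ?thesis
    unfolding cocycles_iff coboundary_unit[OF A g]
    using comp_in[OF P_unit g] one unit_cancel[OF A S.coboundary_in[OF g] one_in[OF in_Ab[OF A] sob]] by auto
qed

text \<open>A cocycle on \<open>P\<close> extends along the unit to one on \<open>T P\<close>; restricted to the cycles
  \<open>Z\<close> of the Moore complex this factors through the homology object \<open>L\<close>.\<close>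

definition represents :: "'o \<Rightarrow> 'a \<Rightarrow> 'a \<Rightarrow> bool" where
  "represents A f h \<longleftrightarrow> h \<in> homs C L A \<and>
     (\<exists>g \<in> homs C (sob S (Suc m)) A. g \<cdot> unit (Suc m) = f \<and> h \<cdot> q = g \<cdot> (\<nu> (Suc m) \<cdot> \<zeta>))"

lemma ex_represented:
  assumes A: "A \<in> R" and f: "f \<in> cocycles C P A (Suc m)"
  shows "\<exists>!h. represents A f h"
proof -
  interpret K: split_cochains C S N \<nu> bd m Z L \<zeta> b q A by (rule split_cochains[OF A])
  obtain g where g: "g \<in> homs C (sob S (Suc m)) A" "g \<cdot> unit (Suc m) = f"
    using lift_cochain[OF A] f unfolding cocycles_iff by metis
  have "coboundary C S A (Suc m) g = \<one>\<^bsub>hom_group C (sob S (Suc (Suc m))) A\<^esub>"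
    using unit_cocycle[OF A g(1)] g(2) f by simp
  then have "(g \<cdot> (\<nu> (Suc m) \<cdot> \<zeta>)) \<cdot> b = \<one>\<^bsub>hom_group C (N (Suc (Suc m))) A\<^esub>"
    by (rule K.cocycle_vanishes_on_boundaries[OF g(1)])
  then have "zero_arrow C ((g \<cdot> (\<nu> (Suc m) \<cdot> \<zeta>)) \<cdot> b)"
    using zero_arrow_one[OF in_Ab[OF A] N_obj] by simp
  then have "\<exists>!h. h \<in> homs C L A \<and> h \<cdot> q = g \<cdot> (\<nu> (Suc m) \<cdot> \<zeta>)"
    using cokernelD(3)[OF cokernel boundary(1) comp_in[OF nu_zeta_in g(1)]] by blast
  \<comment> \<open>The extension of \<open>f\<close> along the unit is unique, so the existential
    in \<open>represents\<close> can only refer to this \<open>g\<close>.\<close>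
  moreover have "represents A f h \<longleftrightarrow> h \<in> homs C L A \<and> h \<cdot> q = g \<cdot> (\<nu> (Suc m) \<cdot> \<zeta>)" for h
    using g unit_cancel[OF A] unfolding represents_def by metis
  ultimately show ?thesis by simp
qed

lemma represents_mult:
  assumes A: "A \<in> R" and 1: "represents A f h" and 2: "represents A f' h'"
  shows "represents A (f \<otimes>\<^bsub>hom_group C (sob P (Suc m)) A\<^esub> f') (h \<otimes>\<^bsub>hom_group C L A\<^esub> h')"
proof -
  note A' = in_Ab[OF A]
  obtain g where h: "h \<in> homs C L A" and g: "g \<in> homs C (sob S (Suc m)) A" "g \<cdot> unit (Suc m) = f"
    "h \<cdot> q = g \<cdot> (\<nu> (Suc m) \<cdot> \<zeta>)" using 1 unfolding represents_def by blast
  obtain g' where h': "h' \<in> homs C L A" and g': "g' \<in> homs C (sob S (Suc m)) A" "g' \<cdot> unit (Suc m) = f'"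
    "h' \<cdot> q = g' \<cdot> (\<nu> (Suc m) \<cdot> \<zeta>)" using 2 unfolding represents_def by blast
  have "h \<otimes>\<^bsub>hom_group C L A\<^esub> h' \<in> homs C L A"
    "g \<otimes>\<^bsub>hom_group C (sob S (Suc m)) A\<^esub> g' \<in> homs C (sob S (Suc m)) A"
    using gen_add_in[OF A' h h'] gen_add_in[OF A' g(1) g'(1)] by (simp_all add: hom_group_def)
  then show ?thesis
    using precomp_mult[OF A' h h' q_in] precomp_mult[OF A' g(1) g'(1) P_unit]
      precomp_mult[OF A' g(1) g'(1) nu_zeta_in] g(2,3) g'(2,3)
    unfolding represents_def by auto
qed

lemma ex_representative:
  assumes A: "A \<in> R" and h: "h \<in> homs C L A"
  shows "\<exists>f \<in> cocycles C P A (Suc m). represents A f h"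
proof -
  interpret K: split_cochains C S N \<nu> bd m Z L \<zeta> b q A by (rule split_cochains[OF A])
  obtain g where g: "g \<in> homs C (sob S (Suc m)) A" "coboundary C S A (Suc m) g = \<one>\<^bsub>hom_group C (sob S (Suc (Suc m))) A\<^esub>"
    "g \<cdot> (\<nu> (Suc m) \<cdot> \<zeta>) = h \<cdot> q" using K.ex_cocycle[OF h] .
  then show ?thesis
    using unit_cocycle[OF A g(1)] h unfolding represents_def by (metis g)
qed

text \<open>This determines the kernel of \<open>psi\<close>. From left to right it rests on the
  splitting, via \<open>cocycle_coboundary\<close>; conversely a coboundary vanishes on
  cycles.\<close>

lemma represents_one:
  assumes A: "A \<in> R" and f: "f \<in> cocycles C P A (Suc m)"
  shows "represents A f \<one>\<^bsub>hom_group C L A\<^esub> \<longleftrightarrow> f \<in> coboundaries C P A (Suc m)"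
proof
  interpret K: split_cochains C S N \<nu> bd m Z L \<zeta> b q A by (rule split_cochains[OF A])
  assume "represents A f \<one>\<^bsub>hom_group C L A\<^esub>"
  then obtain g where g: "g \<in> homs C (sob S (Suc m)) A" "g \<cdot> unit (Suc m) = f"
    "g \<cdot> (\<nu> (Suc m) \<cdot> \<zeta>) = \<one>\<^bsub>hom_group C Z A\<^esub>"
    using one_comp[OF in_Ab[OF A] q_in] unfolding represents_def by metis
  have "coboundary C S A (Suc m) g = \<one>\<^bsub>hom_group C (sob S (Suc (Suc m))) A\<^esub>"
    using unit_cocycle[OF A g(1)] g(2) f by simp
  then obtain u where u: "u \<in> homs C (sob S m) A" "coboundary C S A m u = g"
    using K.cocycle_coboundary[OF g(1) _ g(3)] by blast
  then have "f = coboundary C P A m (u \<cdot> unit m)" using coboundary_unit[OF A u(1)] g(2) by simp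
  then show "f \<in> coboundaries C P A (Suc m)"
    using comp_in[OF P_unit u(1)] unfolding coboundaries_def by auto
next
  interpret K: split_cochains C S N \<nu> bd m Z L \<zeta> b q A by (rule split_cochains[OF A])
  assume "f \<in> coboundaries C P A (Suc m)"
  then obtain v where v: "v \<in> homs C (sob P m) A" "f = coboundary C P A m v" unfolding coboundaries_def by auto
  obtain u where u: "u \<in> homs C (sob S m) A" "u \<cdot> unit m = v" using lift_cochain[OF A v(1)] .
  have "coboundary C S A m u \<cdot> unit (Suc m) = f" using coboundary_unit[OF A u(1)] u(2) v(2) by simp
  then show "represents A f \<one>\<^bsub>hom_group C L A\<^esub>"
    using K.coboundary_in[OF u(1)] K.coboundary_vanishes_on_cycles[OF u(1)] one_in[OF in_Ab[OF A] L_obj]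
      one_comp[OF in_Ab[OF A] q_in] unfolding represents_def by metis
qed

lemma represents_natural:
  assumes a: "a \<in> homs C A B" and "represents A f h"
  shows "represents B (a \<cdot> f) (a \<cdot> h)"
proof -
  obtain g where h: "h \<in> homs C L A" and g: "g \<in> homs C (sob S (Suc m)) A" "g \<cdot> unit (Suc m) = f"
    "h \<cdot> q = g \<cdot> (\<nu> (Suc m) \<cdot> \<zeta>)" using assms(2) unfolding represents_def by blast
  have "(a \<cdot> g) \<cdot> unit (Suc m) = a \<cdot> f" "(a \<cdot> h) \<cdot> q = (a \<cdot> g) \<cdot> (\<nu> (Suc m) \<cdot> \<zeta>)"
    using comp_assoc[OF P_unit g(1) a] comp_assoc[OF q_in h a] comp_assoc[OF nu_zeta_in g(1) a] g by auto
  then show ?thesis using comp_in[OF h a] comp_in[OF g(1) a] unfolding represents_def by blast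
qed

lemma coboundary_natural:
  assumes A: "A \<in> R" and B: "B \<in> R" and a: "a \<in> homs C A B" and f: "f \<in> homs C (sob P k) A"
  shows "coboundary C P B k (a \<cdot> f) = a \<cdot> coboundary C P A k f"
proof -
  interpret A: cochains C P A by (rule cochains_P[OF A])
  interpret B: cochains C P B by (rule cochains_P[OF B])
  interpret G: comm_group "hom_group C (sob P (Suc k)) B" by (rule B.H)
  have "coboundary C P B k (a \<cdot> f) = alt_sum (hom_group C (sob P (Suc k)) B) (\<lambda>i. (a \<cdot> f) \<cdot> face P k i) (Suc k)"
    by (rule B.coboundary_alt_sum[OF comp_in[OF f a]])
  also have "\<dots> = alt_sum (hom_group C (sob P (Suc k)) B) (\<lambda>i. a \<cdot> (f \<cdot> face P k i)) (Suc k)"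
    by (rule G.alt_sum_cong) (use comp_assoc[OF A.face f a] in simp)
  also have "\<dots> = a \<cdot> coboundary C P A k f"
    unfolding A.coboundary_alt_sum[OF f]
    by (rule hom_alt_sum[symmetric, OF postcomp_group_hom[OF in_Ab[OF A] in_Ab[OF B] a A.sob] A.H])
      (use comp_in[OF A.face f] in simp)
  finally show ?thesis .
qed

section \<open>The isomorphism from cohomology classes to arrows out of the homology object\<close>

abbreviation cocycle_group where
  "cocycle_group A \<equiv> (hom_group C (sob P (Suc m)) A)\<lparr>carrier := cocycles C P A (Suc m)\<rparr>"

definition psi :: "'o \<Rightarrow> 'a \<Rightarrow> 'a" where
  "psi A f = (THE h. represents A f h)"

lemma psi_eq_iff:
  assumes "A \<in> R" "f \<in> cocycles C P A (Suc m)"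
  shows "psi A f = h \<longleftrightarrow> represents A f h"
  using theI'[OF ex_represented[OF assms]] ex_represented[OF assms] unfolding psi_def by blast

lemma psi_hom:
  assumes A: "A \<in> R"
  shows "group_hom (cocycle_group A) (hom_group C L A) (psi A)"
proof -
  interpret P: cochains C P A by (rule cochains_P[OF A])
  interpret \<delta>: group_hom "hom_group C (sob P (Suc m)) A" "hom_group C (sob P (Suc (Suc m))) A" "coboundary C P A (Suc m)"
    by (rule P.coboundary_hom)
  have Z: "group (cocycle_group A)"
    using \<delta>.subgroup_kernel \<delta>.G.subgroup_imp_group unfolding cocycles_def by blast
  have L: "group (hom_group C L A)" using comm_group_hom_group[OF in_Ab[OF A] L_obj] by (simp add: comm_group_def)
  have rep: "represents A f (psi A f)" if "f \<in> cocycles C P A (Suc m)" for f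
    using psi_eq_iff[OF A that] by blast
  show ?thesis
    unfolding group_hom_def group_hom_axioms_def
  proof (intro conjI Z L homI)
    show "psi A f \<in> carrier (hom_group C L A)" if "f \<in> carrier (cocycle_group A)" for f
      using rep that by (simp add: represents_def)
    fix f g assume fg: "f \<in> carrier (cocycle_group A)" "g \<in> carrier (cocycle_group A)"
    have "f \<otimes>\<^bsub>cocycle_group A\<^esub> g \<in> carrier (cocycle_group A)"
      using group.subgroup_self[OF Z] fg by (rule subgroup.m_closed)
    then show "psi A (f \<otimes>\<^bsub>cocycle_group A\<^esub> g) = psi A f \<otimes>\<^bsub>hom_group C L A\<^esub> psi A g"
      using psi_eq_iff[OF A] represents_mult[OF A rep rep] fg by simp
  qed
qed

lemma psi_kernel:
  assumes A: "A \<in> R"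
  shows "kernel (cocycle_group A) (hom_group C L A) (psi A) = coboundaries C P A (Suc m)"
proof -
  interpret P: cochains C P A by (rule cochains_P[OF A])
  have "coboundaries C P A (Suc m) \<subseteq> cocycles C P A (Suc m)"
    using P.coboundary_in P.coboundary_coboundary by (auto simp: coboundaries_def cocycles_iff)
  then show ?thesis
    using psi_eq_iff[OF A] represents_one[OF A] unfolding kernel_def by auto
qed

lemma psi_surj:
  assumes A: "A \<in> R"
  shows "psi A ` carrier (cocycle_group A) = carrier (hom_group C L A)"
  using ex_representative[OF A] psi_eq_iff[OF A] group_hom.hom_closed[OF psi_hom[OF A]]
  by (auto simp: image_iff) metis

text \<open>Written with \<open>the_elem\<close> because \<open>FactGroup_iso_set\<close> states the
  first isomorphism theorem for a map of this form.\<close>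

definition kappa :: "'o \<Rightarrow> 'a set \<Rightarrow> 'a" where
  "kappa A c = the_elem (psi A ` c)"

lemma kappa_coset:
  assumes A: "A \<in> R" and f: "f \<in> cocycles C P A (Suc m)"
  shows "kappa A (coboundaries C P A (Suc m) #>\<^bsub>cocycle_group A\<^esub> f) = psi A f"
proof -
  interpret \<psi>: group_hom "cocycle_group A" "hom_group C L A" "psi A" by (rule psi_hom[OF A])
  have "psi A ` (coboundaries C P A (Suc m) #>\<^bsub>cocycle_group A\<^esub> f) = {psi A f}"
  proof
    show "psi A ` (coboundaries C P A (Suc m) #>\<^bsub>cocycle_group A\<^esub> f) \<subseteq> {psi A f}"
      unfolding psi_kernel[OF A, symmetric] r_coset_def kernel_def
      using \<psi>.hom_mult[of _ f] \<psi>.hom_closed[of f] \<psi>.H.l_one[of "psi A f"] f by auto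
    have "f \<in> coboundaries C P A (Suc m) #>\<^bsub>cocycle_group A\<^esub> f"
      using \<psi>.G.rcos_self[of f] \<psi>.subgroup_kernel f unfolding psi_kernel[OF A] by simp
    then show "{psi A f} \<subseteq> psi A ` (coboundaries C P A (Suc m) #>\<^bsub>cocycle_group A\<^esub> f)" by blast
  qed
  then show ?thesis by (simp add: kappa_def)
qed

text \<open>The image of a coset under \<open>a\<close> may be only part of a coset, since
  \<open>a\<close> need not reach all coboundaries with values in \<open>B\<close>; the
  multiplication by these coboundaries in \<open>Ext_functor\<close> completes it.\<close>

lemma Ext_functor_arrow:
  assumes A: "A \<in> R" and B: "B \<in> R" and a: "a \<in> homs C A B" and f: "f \<in> cocycles C P A (Suc m)"
  shows "a \<cdot> f \<in> cocycles C P B (Suc m)"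
    and "farr (Ext_functor C P (Suc m)) a (coboundaries C P A (Suc m) #>\<^bsub>cocycle_group A\<^esub> f)
      = coboundaries C P B (Suc m) #>\<^bsub>cocycle_group B\<^esub> (a \<cdot> f)"
proof -
  interpret A: cochains C P A by (rule cochains_P[OF A])
  interpret B: cochains C P B by (rule cochains_P[OF B])
  interpret GB: comm_group "hom_group C (sob P (Suc m)) B" by (rule B.H)
  interpret \<psi>: group_hom "cocycle_group B" "hom_group C L B" "psi B" by (rule psi_hom[OF B])
  let ?BA = "coboundaries C P A (Suc m)" and ?BB = "coboundaries C P B (Suc m)"
  have fin: "f \<in> homs C (sob P (Suc m)) A" using f by (simp add: cocycles_iff)
  show af: "a \<cdot> f \<in> cocycles C P B (Suc m)"
    using f comp_in[OF fin a] coboundary_natural[OF A B a fin] comp_one[OF in_Ab[OF A] in_Ab[OF B] a A.sob]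
    by (simp add: cocycles_iff)
  have sub: "?BB \<subseteq> cocycles C P B (Suc m)"
    using psi_kernel[OF B] unfolding kernel_def by auto
  have subgrp: "subgroup ?BB (cocycle_group B)" using \<psi>.subgroup_kernel unfolding psi_kernel[OF B] .
  have BAin: "u \<in> homs C (sob P (Suc m)) A" if "u \<in> ?BA" for u
    using that A.coboundary_in unfolding coboundaries_def by auto
  have BA: "a \<cdot> u \<in> ?BB" if "u \<in> ?BA" for u
    using that coboundary_natural[OF A B a] comp_in[OF _ a] unfolding coboundaries_def
    by (auto simp: image_iff) metis
  have one: "\<one>\<^bsub>hom_group C (sob P (Suc m)) A\<^esub> \<in> ?BA"
    using psi_kernel[OF A] group_hom.subgroup_kernel[OF psi_hom[OF A]] subgroup.one_closed by fastforce
  have 1: "a \<cdot> (u \<otimes>\<^bsub>hom_group C (sob P (Suc m)) A\<^esub> f) = (a \<cdot> u) \<otimes>\<^bsub>hom_group C (sob P (Suc m)) B\<^esub> (a \<cdot> f)"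
    if "u \<in> ?BA" for u
    using postcomp_mult[OF in_Ab[OF A] in_Ab[OF B] a BAin[OF that] fin] .
  have c: "v \<in> carrier (hom_group C (sob P (Suc m)) B)" if "v \<in> ?BB" for v
    using that sub by (auto simp: cocycles_iff)
  have afc: "a \<cdot> f \<in> carrier (hom_group C (sob P (Suc m)) B)" using comp_in[OF fin a] by simp
  have "?BB <#>\<^bsub>hom_group C (sob P (Suc m)) B\<^esub> ((\<lambda>f. a \<cdot> f) ` (?BA #>\<^bsub>cocycle_group A\<^esub> f))
      = (\<Union>v\<in>?BB. \<Union>u\<in>?BA. {(v \<otimes>\<^bsub>hom_group C (sob P (Suc m)) B\<^esub> (a \<cdot> u)) \<otimes>\<^bsub>hom_group C (sob P (Suc m)) B\<^esub> (a \<cdot> f)})"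
    unfolding set_mult_def r_coset_def using 1 GB.m_assoc[OF c c[OF BA] afc] by auto
  also have "\<dots> = (\<Union>v\<in>?BB. {v \<otimes>\<^bsub>hom_group C (sob P (Suc m)) B\<^esub> (a \<cdot> f)})" (is "?l = ?r")
  proof
    show "?l \<subseteq> ?r" using subgroup.m_closed[OF subgrp _ BA] by auto
    \<comment> \<open>For the reverse inclusion, the neutral element is taken among the coboundaries
      with values in \<open>A\<close>.\<close>
    have "a \<cdot> \<one>\<^bsub>hom_group C (sob P (Suc m)) A\<^esub> = \<one>\<^bsub>hom_group C (sob P (Suc m)) B\<^esub>"
      by (rule comp_one[OF in_Ab[OF A] in_Ab[OF B] a A.sob])
    then have "v = v \<otimes>\<^bsub>hom_group C (sob P (Suc m)) B\<^esub> (a \<cdot> \<one>\<^bsub>hom_group C (sob P (Suc m)) A\<^esub>)" if "v \<in> ?BB" for v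
      using GB.r_one[OF c[OF that]] by simp
    then show "?r \<subseteq> ?l" using one by fastforce
  qed
  finally show "farr (Ext_functor C P (Suc m)) a (?BA #>\<^bsub>cocycle_group A\<^esub> f) = ?BB #>\<^bsub>cocycle_group B\<^esub> (a \<cdot> f)"
    using homsD[OF a] by (simp add: Ext_functor_def r_coset_def)
qed

lemma Hom_Ext_equivalent:
  "naturally_equivalent (full_subcat C R) (Hom_functor C L) (Ext_functor C P (Suc m))"
proof (rule naturally_equivalent_by_iso[OF category_full_subcat Hom_functor_ab[OF L_obj], where \<kappa> = kappa])
  fix A assume "A \<in> obj (full_subcat C R)"
  then have A: "A \<in> R" by (simp add: full_subcat_def)
  interpret \<psi>: group_hom "cocycle_group A" "hom_group C L A" "psi A" by (rule psi_hom[OF A])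
  show "group (fob (Ext_functor C P (Suc m)) A)"
    using normal.factorgroup_is_group[OF \<psi>.normal_kernel] unfolding psi_kernel[OF A] by (simp add: Ext_functor_def)
  show "kappa A \<in> iso (fob (Ext_functor C P (Suc m)) A) (fob (Hom_functor C L) A)"
    using \<psi>.FactGroup_iso_set[OF psi_surj[OF A]] unfolding psi_kernel[OF A]
    by (simp add: Ext_functor_def Hom_functor_def kappa_def[abs_def])
next
  fix a c assume a: "a \<in> arr (full_subcat C R)"
    and c: "c \<in> carrier (fob (Ext_functor C P (Suc m)) (src (full_subcat C R) a))"
  define A B where "A = src C a" and "B = tgt C a"
  have AB: "A \<in> R" "B \<in> R" "a \<in> homs C A B"
    using a by (auto simp: full_subcat_def A_def B_def homs_def)
  have "c \<in> carrier (cocycle_group A Mod coboundaries C P A (Suc m))"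
    using c by (simp add: Ext_functor_def full_subcat_def A_def)
  then obtain f where f: "f \<in> cocycles C P A (Suc m)" "c = coboundaries C P A (Suc m) #>\<^bsub>cocycle_group A\<^esub> f"
    by (auto simp: carrier_FactGroup)
  note e = Ext_functor_arrow[OF AB f(1)]
  have "psi B (a \<cdot> f) = a \<cdot> psi A f"
    using psi_eq_iff[OF AB(2) e(1)] represents_natural[OF AB(3)] psi_eq_iff[OF AB(1) f(1)] by blast
  then have "farr (Ext_functor C P (Suc m)) a c \<in> carrier (cocycle_group B Mod coboundaries C P B (Suc m))
      \<and> kappa B (farr (Ext_functor C P (Suc m)) a c) = a \<cdot> kappa A c"
    using e f kappa_coset[OF AB(1) f(1)] kappa_coset[OF AB(2) e(1)] by (auto simp: carrier_FactGroup)
  then show "farr (Ext_functor C P (Suc m)) a c \<in> carrier (fob (Ext_functor C P (Suc m)) (tgt (full_subcat C R) a)) \<and>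
      kappa (tgt (full_subcat C R) a) (farr (Ext_functor C P (Suc m)) a c)
        = farr (Hom_functor C L) a (kappa (src (full_subcat C R) a) c)"
    by (simp add: Ext_functor_def Hom_functor_def full_subcat_def A_def B_def)
qed

end

theorem theorem6p5:
  fixes \<X> :: "(('f, 'u) algebra, ('f, 'u) alg_arrow) cat"
    and R :: "('f, 'u) algebra set"
    and To :: "('f, 'u) algebra \<Rightarrow> ('f, 'u) algebra"
    and Ta :: "('f, 'u) alg_arrow \<Rightarrow> ('f, 'u) alg_arrow"
    and n :: nat
    and X :: "('f, 'u) algebra"
    and P :: "(('f, 'u) algebra, ('f, 'u) alg_arrow) simpl"
    and \<epsilon> :: "('f, 'u) alg_arrow"
    and L :: "nat \<Rightarrow> ('f, 'u) algebra"
  assumes "semiabelian_variety \<X>"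
    and "R \<subseteq> abelian_core \<X>"
    and "replete \<X> R"
    and "reflector \<X> R To Ta"
    and "n \<ge> 1"
    and "X \<in> obj \<X>"
    and "projective_resolution \<X> P \<epsilon> X"
    and "\<forall>k \<le> n. left_derived \<X> To Ta P k (L k)"
    and "\<forall>k < n. zero_object \<X> (L k)"
  shows "naturally_equivalent (full_subcat \<X> R) (Hom_functor \<X> (L n)) (Ext_functor \<X> P n)"
proof -
  obtain m where n: "n = Suc m" using \<open>n \<ge> 1\<close> by (cases n) auto
  obtain \<eta> where \<eta>: "abelian_reflection \<X> R To Ta \<eta>"
  proof -
    obtain \<eta> where "\<forall>A \<in> obj \<X>. \<eta> A \<in> homs \<X> A (To A)"
      "\<forall>f \<in> arr \<X>. Ta f \<cdot>\<^bsub>\<X>\<^esub> \<eta> (src \<X> f) = \<eta> (tgt \<X> f) \<cdot>\<^bsub>\<X>\<^esub> f"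
      "\<forall>A \<in> obj \<X>. \<forall>B \<in> R. \<forall>f \<in> homs \<X> A B. \<exists>!g. g \<in> homs \<X> (To A) B \<and> g \<cdot>\<^bsub>\<X>\<^esub> \<eta> A = f"
      using assms(4) unfolding reflector_def by blast
    moreover have "semiabelian \<X>" using assms(1) by (simp add: semiabelian_variety_def)
    moreover have "is_functor \<X> (full_subcat \<X> R) To Ta" using assms(4) by (simp add: reflector_def)
    ultimately have "abelian_reflection \<X> R To Ta \<eta>"
      using assms(2,3) by unfold_locales blast+
    then show thesis by (rule that)
  qed
  interpret abelian_reflection \<X> R To Ta \<eta> by (rule \<eta>)
  let ?S = "map_simpl To Ta P"
  have P: "simplicial_object \<X> P" and proj: "\<And>k. projective_object \<X> (sob P k)"
    using assms(7) by (simp_all add: projective_resolution_def)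
  have S: "simplicial_object \<X> ?S" by (rule simplicial_map[OF P])
  have SR: "sob ?S k \<in> R" for k using P To_in by (simp add: sob_map simplicial_object_def)
  have hom: "moore_homology \<X> ?S k (L k)" if "k \<le> n" for k
    using assms(8) that by (simp add: left_derived_def)
  \<comment> \<open>Each degree may come with its own Moore complex. The one for degree
    \<open>n\<close> is fixed here, and \<open>acyclic_lift\<close> compares the others with
    it.\<close>
  then obtain N bd where mc: "moore_complex \<X> ?S N bd" and ho: "homology_object \<X> N bd n (L n)"
    unfolding moore_homology_def by blast
  obtain \<nu> where M: "moore \<X> ?S N \<nu> bd" using moore_complexE[OF S SR mc] by metis
  interpret M: moore \<X> ?S N \<nu> bd by (rule M)
  \<comment> \<open>Degree \<open>m = n - 1\<close> is the last one in which the vanishing of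
    \<open>L k\<close> for \<open>k < n\<close> yields a splitting, and it is the one that makes the
    cycles of degree \<open>n\<close> a summand.\<close>
  have split: "\<exists>y \<in> homs \<X> (N m) (N (Suc m)). bd m \<cdot>\<^bsub>\<X>\<^esub> (y \<cdot>\<^bsub>\<X>\<^esub> bd m) = bd m"
  proof (rule M.bd_splits[of n])
    fix k x assume "k < n" "x \<in> homs \<X> (sob ?S k) (N k)"
      "\<And>j. k = Suc j \<Longrightarrow> bd j \<cdot>\<^bsub>\<X>\<^esub> x = \<one>\<^bsub>hom_group \<X> (sob ?S k) (N j)\<^esub>"
    then show "\<exists>y \<in> homs \<X> (sob ?S k) (N (Suc k)). bd k \<cdot>\<^bsub>\<X>\<^esub> y = x"
      using acyclic_lift[OF P proj M hom] assms(9) by simp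
  qed (simp add: n)
  obtain Z \<zeta> b q where "joint_kernel \<X> {bd m} (N (Suc m)) Z \<zeta>" "b \<in> homs \<X> (N (Suc (Suc m))) Z"
    "\<zeta> \<cdot>\<^bsub>\<X>\<^esub> b = bd (Suc m)" "is_cokernel \<X> b (L n) q"
    using ho unfolding homology_object_def n by auto
  then interpret resolved \<X> R To Ta \<eta> P N \<nu> bd m Z "L n" \<zeta> b q
    using split P by unfold_locales
  show ?thesis using Hom_Ext_equivalent unfolding n .
qed

end
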